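(* Let $\Omega\subset\mathbb{R}^N$ be a bounded domain with Lipschitz boundary $\partial\Omega$, $s\in(0,1)$, $p\in(1,\infty)$, $\gamma>0$, $\delta\in(0,sp)$, and let $K_\delta$ satisfy $\mathcal{C}_1 d(x)^{-\delta}\le K_\delta(x)\le \mathcal{C}_2 d(x)^{-\delta}$ for all $x\in\Omega$, for some constants $\mathcal{C}_1,\mathcal{C}_2>0$. Then: 1. If $\delta-s(1-\gamma)\le0$, there exists a minimal weak solution $u\in W^{s,p}_0(\Omega)$ of problem $(P)$. 2. If $\delta-s(1-\gamma)>0$, there exist a minimal weak solution $u$ of $(P)$ and a constant $\theta_0$ with $$\theta_0>\max\left\{1,\frac{p+\gamma-1}{p},\Lambda\right\},\qquad \Lambda:=\frac{(sp-1)(p-1+\gamma)}{p(sp-\delta)},$$ such that $u^\theta\in W^{s,p}_0(\Omega)$ for all $\theta\ge\theta_0$.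
   Context: Here $d(x)=\operatorname{dist}(x,\partial\Omega)$ and $[t]^{p-1}:=|t|^{p-2}t$ for $t\in\mathbb{R}$. Problem $(P)$ is: $(-\Delta)^s_p u=\frac{K_\delta(x)}{u^\gamma}$, $u>0$ in $\Omega$, $u=0$ in $\mathbb{R}^N\setminus\Omega$, where $(-\Delta)^s_p u(x)=2\lim_{\epsilon\to0}\int_{\mathbb{R}^N\setminus B_\epsilon(x)}\frac{[u(x)-u(y)]^{p-1}}{|x-y|^{N+sp}}\,dy$. Function spaces: $W^{s,p}(\mathbb{R}^N)=\{u\in L^p(\mathbb{R}^N): [u]_{s,p}<\infty\}$ with $[u]_{s,p}^p=\iint_{\mathbb{R}^{2N}}\frac{|u(x)-u(y)|^p}{|x-y|^{N+sp}}dx\,dy$. For an open set $\omega$, $W^{s,p}_0(\omega)=\{u\in W^{s,p}(\mathbb{R}^N): u=0\text{ a.e. in }\mathbb{R}^N\setminus\omega\}$. $W^{s,p}_{loc}(\Omega)$ is the set of $u:\Omega\to\mathbb{R}$ with $u\in L^p(\omega)$ and $\iint_{\omega\times\omega}\frac{|u(x)-u(y)|^p}{|x-y|^{N+sp}}dx\,dy<\infty$ for all $\omega\Subset\Omega$. Put $\mathbb{T}=\bigcup_{\tilde\Omega\Subset\Omega}W^{s,p}_0(\tilde\Omega)$. Weak solution of $(P)$: a function $u\in W^{s,p}_{loc}(\Omega)$, extended by $0$ outside $\Omega$, such that $u^\kappa\in W^{s,p}_0(\Omega)$ for some $\kappa\ge1$, $\inf_K u>0$ for all $K\Subset\Omega$,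 and $$\iint_{\mathbb{R}^{2N}}\frac{[u(x)-u(y)]^{p-1}(\phi(x)-\phi(y))}{|x-y|^{N+sp}}dx\,dy=\int_\Omega\frac{K_\delta(x)}{u^\gamma}\phi\,dx\quad\text{for all }\phi\in\mathbb{T}.$$ A weak solution $u$ is minimal if $u\le v$ a.e. in $\Omega$ for every weak solution $v$ of $(P)$. *)

theory Defs
  imports "HOL-Analysis.Analysis"
begin

text \<open>
  Sobolev functions are represented by genuine functions on the whole space, so all conditions on
  them are invariant under changes on Lebesgue null sets (except that solutions vanish identically
  outside the domain). The dimension \<open>N\<close> is \<open>DIM('a)\<close>, and integrals over the product space are
  with respect to Lebesgue measure on \<open>'a \<times> 'a\<close>.
\<close>

definition compactly_contained :: "'a::euclidean_space set \<Rightarrow> 'a set \<Rightarrow> bool"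
  (infix "\<Subset>" 50) where
  "A \<Subset> S \<longleftrightarrow> compact (closure A) \<and> closure A \<subseteq> S"

text \<open>
  Near each boundary point \<open>x0\<close>, the set is the strict epigraph, in some direction \<open>e\<close>, of a
  Lipschitz function \<open>g\<close> on the hyperplane orthogonal to \<open>e\<close>; coordinates are centred at \<open>x0\<close>.
\<close>

definition lipschitz_boundary :: "'a::euclidean_space set \<Rightarrow> bool" where
  "lipschitz_boundary S \<longleftrightarrow>
     (\<forall>x0\<in>frontier S. \<exists>r>0. \<exists>e g L. norm e = 1 \<and> L-lipschitz_on {y. y \<bullet> e = 0} g \<and>
        S \<inter> ball x0 r =
          {x \<in> ball x0 r. g ((x - x0) - ((x - x0) \<bullet> e) *\<^sub>R e) < (x - x0) \<bullet> e})"

definition bounded_lipschitz_domain :: "'a::euclidean_space set \<Rightarrow> bool" where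
  "bounded_lipschitz_domain S \<longleftrightarrow>
     open S \<and> connected S \<and> S \<noteq> {} \<and> bounded S \<and> lipschitz_boundary S"

definition Lp_on :: "real \<Rightarrow> 'a::euclidean_space set \<Rightarrow> ('a \<Rightarrow> real) set" where
  "Lp_on p A = {u. u \<in> borel_measurable (lebesgue_on A) \<and>
     (\<integral>\<^sup>+x. ennreal (\<bar>u x\<bar> powr p) \<partial>lebesgue_on A) < \<infinity>}"

text \<open>The \<open>p\<close>-th power of the Gagliardo seminorm over \<open>A \<times> A\<close>.\<close>

definition gagliardo_energy ::
    "real \<Rightarrow> real \<Rightarrow> 'a::euclidean_space set \<Rightarrow> ('a \<Rightarrow> real) \<Rightarrow> ennreal" where
  "gagliardo_energy s p A u =
     (\<integral>\<^sup>+z\<in>A \<times> A. ennreal (\<bar>u (fst z) - u (snd z)\<bar> powr p /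
        norm (fst z - snd z) powr (real DIM('a) + s * p)) \<partial>lebesgue)"

definition frac_sobolev :: "real \<Rightarrow> real \<Rightarrow> ('a::euclidean_space \<Rightarrow> real) set" where
  "frac_sobolev s p = {u \<in> Lp_on p UNIV. gagliardo_energy s p UNIV u < \<infinity>}"

definition frac_sobolev_zero ::
    "real \<Rightarrow> real \<Rightarrow> 'a::euclidean_space set \<Rightarrow> ('a \<Rightarrow> real) set" where
  "frac_sobolev_zero s p A =
     {u \<in> frac_sobolev s p. AE x in lebesgue. x \<notin> A \<longrightarrow> u x = 0}"

definition frac_sobolev_loc ::
    "real \<Rightarrow> real \<Rightarrow> 'a::euclidean_space set \<Rightarrow> ('a \<Rightarrow> real) set" where
  "frac_sobolev_loc s p \<Omega> =
     {u. \<forall>A. open A \<and> A \<Subset> \<Omega> \<longrightarrow> u \<in> Lp_on p A \<and> gagliardo_energy s p A u < \<infinity>}"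

definition test_functions ::
    "real \<Rightarrow> real \<Rightarrow> 'a::euclidean_space set \<Rightarrow> ('a \<Rightarrow> real) set" where
  "test_functions s p \<Omega> = (\<Union>A\<in>{A. open A \<and> A \<Subset> \<Omega>}. frac_sobolev_zero s p A)"

definition signed_power :: "real \<Rightarrow> real \<Rightarrow> real" where
  "signed_power p t = \<bar>t\<bar> powr (p - 2) * t"

definition frac_form_integrand ::
    "real \<Rightarrow> real \<Rightarrow> ('a::euclidean_space \<Rightarrow> real) \<Rightarrow> ('a \<Rightarrow> real) \<Rightarrow> 'a \<times> 'a \<Rightarrow> real" where
  "frac_form_integrand s p u \<phi> z =
     signed_power p (u (fst z) - u (snd z)) * (\<phi> (fst z) - \<phi> (snd z)) /
       norm (fst z - snd z) powr (real DIM('a) + s * p)"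

text \<open>
  The infimum over \<open>K\<close> is an essential one. Both integrals in the weak equation are required
  to converge absolutely, because the Bochner integral of a non-integrable function is \<open>0\<close>.
\<close>

definition weak_solution ::
    "real \<Rightarrow> real \<Rightarrow> real \<Rightarrow> ('a::euclidean_space \<Rightarrow> real) \<Rightarrow> 'a set \<Rightarrow> ('a \<Rightarrow> real) \<Rightarrow> bool"
  where
  "weak_solution s p \<gamma> K\<^sub>\<delta> \<Omega> u \<longleftrightarrow>
     u \<in> frac_sobolev_loc s p \<Omega> \<and>
     (\<forall>x. x \<notin> \<Omega> \<longrightarrow> u x = 0) \<and>
     (\<exists>\<kappa>\<ge>1. (\<lambda>x. u x powr \<kappa>) \<in> frac_sobolev_zero s p \<Omega>) \<and>
     (\<forall>K. K \<Subset> \<Omega> \<longrightarrow> (\<exists>c>0. AE x in lebesgue. x \<in> K \<longrightarrow> c \<le> u x)) \<and>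
     (\<forall>\<phi>\<in>test_functions s p \<Omega>.
        integrable lebesgue (frac_form_integrand s p u \<phi>) \<and>
        set_integrable lebesgue \<Omega> (\<lambda>x. K\<^sub>\<delta> x / u x powr \<gamma> * \<phi> x) \<and>
        integral\<^sup>L lebesgue (frac_form_integrand s p u \<phi>) =
          (LINT x:\<Omega>|lebesgue. K\<^sub>\<delta> x / u x powr \<gamma> * \<phi> x))"

definition minimal_weak_solution ::
    "real \<Rightarrow> real \<Rightarrow> real \<Rightarrow> ('a::euclidean_space \<Rightarrow> real) \<Rightarrow> 'a set \<Rightarrow> ('a \<Rightarrow> real) \<Rightarrow> bool"
  where
  "minimal_weak_solution s p \<gamma> K\<^sub>\<delta> \<Omega> u \<longleftrightarrow>
     weak_solution s p \<gamma> K\<^sub>\<delta> \<Omega> u \<and>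
     (\<forall>v. weak_solution s p \<gamma> K\<^sub>\<delta> \<Omega> v \<longrightarrow> (AE x in lebesgue. x \<in> \<Omega> \<longrightarrow> u x \<le> v x))"

end

theory Submission
  imports Defs
begin

text \<open>
  Exhaust \<open>\<Omega>\<close> by the sets \<open>\<Omega>\<^sub>n = {x \<in> \<Omega>. d x > 1 / (n + 1)}\<close>, on which \<open>K\<^sub>\<delta>\<close> is bounded, and let \<open>u\<^sub>n\<close>
  solve the problem on \<open>\<Omega>\<^sub>n\<close> with the nonlinearity \<open>K\<^sub>\<delta> (u + 1 / (n + 1)) powr (- \<gamma>)\<close>; it is the minimizer of
  a strictly convex functional. Since \<open>u\<^sub>n\<close> vanishes outside \<open>\<Omega>\<^sub>n \<Subset> \<Omega>\<close>, the positive part of \<open>u\<^sub>n - v\<close>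
  is an admissible test function for every weak solution \<open>v\<close>, so \<open>u\<^sub>n \<le> v\<close>, and likewise
  \<open>u\<^sub>n \<le> u\<^sub>n\<^sub>+\<^sub>1\<close>; the limit \<open>u\<close> is therefore minimal as soon as it is a weak solution.

  Testing with powers of \<open>u\<^sub>n\<close> bounds \<open>u\<^sub>n powr \<theta>\<close> in the seminorm for all \<open>\<theta> \<ge> 1\<close> with
  \<open>\<theta> \<ge> s (p - 1 + \<gamma>) / (s p - \<delta>)\<close>; the right-hand side is absorbed by Hardy's inequality. This threshold
  is at most \<open>1\<close> exactly in the first case of the theorem. A locally uniform positive lower bound comes
  without regularity theory: the translates of one solution on a small ball lie below
  \<open>u\<^sub>n\<close>, hence so does its essential supremum on that ball. With these two facts the increments of \<open>u\<^sub>n\<close>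
  are bounded near the support of each test function, which suffices to pass to the limit.
\<close>

section \<open>Inequalities for powers\<close>

text \<open>The threshold for \<theta> arises as follows. With \<open>V = u powr \<theta>\<close>,
  the test function \<open>u powr (p * \<theta> - p + 1)\<close> produces the energy of
  \<open>V\<close> on the left and \<open>d powr - \<delta> * V powr q\<close> on the right, where
  \<open>q = p - (p - 1 + \<gamma>) / \<theta>\<close>. Hardy's inequality controls
  \<open>V / d powr s\<close> in L^p, so the leftover weight
  \<open>d powr (s * q - \<delta>)\<close> has to be bounded, and
  \<open>\<delta> \<le> s * q\<close> is the stated condition. The bound \<Lambda> of the theorem is
  \<open>(s * p - 1) / (s * p)\<close> times this threshold and hence lies below it. The obstacle in
  the limit is that the form is nonlocal: even for a compactly supported test function it sees the
  solution near the boundary, where outside the first case no energy bound for \<open>u\<close>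
  itself is at hand. Near the support the lower bound for \<open>u\<close> inverts the power
  \<theta> with controlled slope and turns the energy of \<open>u powr \<theta>\<close> into energy
  of \<open>u\<close>; for pairs with one distant point the kernel is integrable, so an L^p bound on
  \<open>u\<close> is enough.\<close>

lemma signed_power_alt: "signed_power p t = sgn t * \<bar>t\<bar> powr (p - 1)"
proof (cases "t = 0")
  case False
  then have "\<bar>t\<bar> powr (p - 2) * \<bar>t\<bar> = \<bar>t\<bar> powr (p - 1)"
    using powr_mult_base[of "\<bar>t\<bar>" "p - 2"] by (simp add: mult.commute algebra_simps)
  moreover have "t = sgn t * \<bar>t\<bar>" by (simp add: sgn_mult_abs)
  ultimately show ?thesis
    unfolding signed_power_def by (metis mult.assoc mult.commute)
qed (simp add: signed_power_def)

lemma signed_power_0 [simp]: "signed_power p 0 = 0"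
  by (simp add: signed_power_def)

lemma signed_power_minus: "signed_power p (- t) = - signed_power p t"
  by (simp add: signed_power_def)

lemma signed_power_mult_self: "0 < p \<Longrightarrow> signed_power p t * t = \<bar>t\<bar> powr p"
proof -
  assume "0 < p"
  have "signed_power p t * t = \<bar>t\<bar> powr (p - 1) * \<bar>t\<bar>"
    by (simp add: signed_power_alt abs_sgn mult_ac)
  also have "\<dots> = \<bar>t\<bar> powr p"
    using powr_mult_base[of "\<bar>t\<bar>" "p - 1"] by (simp add: mult.commute)
  finally show ?thesis .
qed

lemma abs_signed_power: "\<bar>signed_power p t\<bar> = \<bar>t\<bar> powr (p - 1)"
  by (cases "t = 0") (simp_all add: signed_power_alt abs_mult)

lemma signed_power_strict_mono:
  assumes "1 < p" "x < y"
  shows "signed_power p x < signed_power p y"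
proof -
  have *: "signed_power p a < signed_power p b" if "0 \<le> a" "a < b" for a b
    using that assms(1) powr_less_mono2[of "p - 1" a b] by (auto simp: signed_power_alt sgn_if)
  consider "0 \<le> x" | "x < 0" "0 < y" | "x < 0" "y \<le> 0" by linarith
  then show ?thesis
  proof cases
    case 1
    then show ?thesis using * assms by blast
  next
    case 2
    then have "signed_power p 0 < signed_power p y" "signed_power p 0 < signed_power p (- x)"
      using *[of 0 y] *[of 0 "- x"] by auto
    then show ?thesis by (simp add: signed_power_minus)
  next
    case 3
    then have "signed_power p (- y) < signed_power p (- x)"
      using * assms by auto
    then show ?thesis by (simp add: signed_power_minus)
  qed
qed

lemma signed_power_mono: "1 < p \<Longrightarrow> x \<le> y \<Longrightarrow> signed_power p x \<le> signed_power p y"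
  using signed_power_strict_mono by (metis less_eq_real_def)

text \<open>A crude form of Young's inequality, obtained by bounding both factors by
  \<open>max a b\<close>. It serves to show that the form is integrable, so the size of the
  constants is irrelevant.\<close>

lemma powr_pred_mult_le:
  fixes a b :: real
  assumes "1 < p" "0 \<le> a" "0 \<le> b"
  shows "a powr (p - 1) * b \<le> a powr p + b powr p"
proof -
  have *: "c powr (p - 1) * c = c powr p" if "0 \<le> c" for c :: real
    using powr_mult_base[of c "p - 1"] that by (simp add: mult.commute)
  have "a powr (p - 1) * b \<le> max a b powr (p - 1) * max a b"
    using assms by (intro mult_mono powr_mono2) auto
  also have "\<dots> \<le> a powr p + b powr p"
    using * assms by (auto simp: max_def)
  finally show ?thesis .
qed

lemma abs_signed_power_mult_le:
  assumes "1 < p"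
  shows "\<bar>signed_power p a * b\<bar> \<le> \<bar>a\<bar> powr p + \<bar>b\<bar> powr p"
  using powr_pred_mult_le[OF assms, of "\<bar>a\<bar>" "\<bar>b\<bar>"]
  by (simp add: abs_mult abs_signed_power)

lemma signed_power_measurable [measurable]: "signed_power p \<in> borel_measurable borel"
  unfolding signed_power_def by measurable

lemma isCont_signed_power: "1 < p \<Longrightarrow> isCont (signed_power p) t"
proof (cases "t = 0")
  case False
  then show ?thesis unfolding signed_power_def
    by (intro continuous_intros) auto
next
  case True
  assume p: "1 < p"
  \<comment> \<open>For \<open>p < 2\<close> the factor \<open>\<bar>t\<bar> powr (p - 2)\<close>
    blows up at \<open>0\<close>; continuity there is read off from the absolute value, which is a
    positive power of \<open>\<bar>t\<bar>\<close>.\<close>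
  have "((\<lambda>t. \<bar>signed_power p t\<bar>) \<longlongrightarrow> 0) (at 0)"
    unfolding abs_signed_power
    using p by (intro tendsto_zero_powrI[where b = "p - 1"]) (auto intro!: tendsto_eq_intros)
  then show ?thesis
    unfolding True isCont_def by (simp add: tendsto_rabs_zero_iff)
qed

lemma tendsto_signed_power:
  "1 < p \<Longrightarrow> (f \<longlongrightarrow> l) F \<Longrightarrow> ((\<lambda>x. signed_power p (f x)) \<longlongrightarrow> signed_power p l) F"
  using isCont_tendsto_compose isCont_signed_power by blast

lemma tendsto_abs_powr:
  fixes f :: "'b \<Rightarrow> real"
  assumes "0 < q" "(f \<longlongrightarrow> l) F"
  shows "((\<lambda>x. \<bar>f x\<bar> powr q) \<longlongrightarrow> \<bar>l\<bar> powr q) F"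
  using assms by (intro tendsto_powr2 tendsto_rabs tendsto_const) auto

lemma has_real_derivative_abs_powr:
  assumes "1 < p"
  shows "((\<lambda>t. \<bar>t\<bar> powr p) has_real_derivative p * signed_power p t) (at t)"
proof (cases "t = 0")
  case True
  \<comment> \<open>The difference quotient at \<open>0\<close> is \<open>signed_power p h\<close>
    itself.\<close>
  have "((\<lambda>h. \<bar>h\<bar> powr p / h) \<longlongrightarrow> 0) (at 0)"
  proof (rule Lim_transform_eventually)
    show "(signed_power p \<longlongrightarrow> 0) (at 0)"
      using isCont_signed_power[OF assms, of 0] by (simp add: isCont_def)
    show "\<forall>\<^sub>F h in at 0. signed_power p h = \<bar>h\<bar> powr p / h"
      using assms by (auto simp: eventually_at_filter simp flip: signed_power_mult_self)
  qed
  then show ?thesis by (simp add: True has_field_derivative_iff)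
next
  case False
  have "((\<lambda>t. (if 0 < t then t powr p else (- t) powr p)) has_real_derivative p * signed_power p t) (at t)"
  proof (cases "0 < t")
    case True
    then have "((\<lambda>t. t powr p) has_real_derivative p * signed_power p t) (at t)"
      by (auto intro!: derivative_eq_intros simp: signed_power_alt)
    then show ?thesis
      by (rule has_field_derivative_transform_within_open[where S="{0<..}"]) (use True in auto)
  next
    case False
    then have "t < 0" using \<open>t \<noteq> 0\<close> by simp
    then have "((\<lambda>t. (- t) powr p) has_real_derivative p * signed_power p t) (at t)"
      by (auto intro!: derivative_eq_intros simp: signed_power_alt)
    then show ?thesis
      by (rule has_field_derivative_transform_within_open[where S="{..<0}"]) (use \<open>t < 0\<close> in auto)
  qed
  then show ?thesis
    by (rule has_field_derivative_transform_within_open[where S="-{0}"]) (use False in \<open>auto simp: abs_if\<close>)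
qed

lemma convex_abs_powr:
  assumes "1 < p"
  shows "convex_on UNIV (\<lambda>t::real. \<bar>t\<bar> powr p)"
proof (rule convex_on_realI[where f' = "\<lambda>t. p * signed_power p t"])
  show "p * signed_power p x \<le> p * signed_power p y" if "x \<le> y" for x y
    using signed_power_mono[OF assms that] assms by simp
qed (use assms has_real_derivative_abs_powr in auto)

text \<open>The mean value theorem on the two halves of the interval gives slopes at points on
  either side of the midpoint, and these differ strictly because \<open>signed_power p\<close> is
  strictly increasing.\<close>

lemma abs_powr_midpoint_less:
  fixes a b :: real
  assumes p: "1 < p" and "a \<noteq> b"
  shows "\<bar>(a + b) / 2\<bar> powr p < (\<bar>a\<bar> powr p + \<bar>b\<bar> powr p) / 2"
proof -
  have *: "\<bar>(a + b) / 2\<bar> powr p < (\<bar>a\<bar> powr p + \<bar>b\<bar> powr p) / 2" if "a < b" for a b :: real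
  proof -
    define m where "m = (a + b) / 2"
    have m: "a < m" "m < b" "m - a = b - m" using that by (auto simp: m_def field_simps)
    obtain x where x: "a < x" "x < m" "\<bar>m\<bar> powr p - \<bar>a\<bar> powr p = (m - a) * (p * signed_power p x)"
      using MVT2[of a m "\<lambda>t. \<bar>t\<bar> powr p" "\<lambda>t. p * signed_power p t"] m has_real_derivative_abs_powr[OF p]
      by blast
    obtain y where y: "m < y" "y < b" "\<bar>b\<bar> powr p - \<bar>m\<bar> powr p = (b - m) * (p * signed_power p y)"
      using MVT2[of m b "\<lambda>t. \<bar>t\<bar> powr p" "\<lambda>t. p * signed_power p t"] m has_real_derivative_abs_powr[OF p]
      by blast
    have "(m - a) * (p * signed_power p x) < (b - m) * (p * signed_power p y)"
      using m x y p by (auto intro!: mult_strict_left_mono signed_power_strict_mono)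
    then show ?thesis using x y unfolding m_def by simp
  qed
  show ?thesis using *[of a b] *[of b a] assms(2) by (cases "a < b") (auto simp: add.commute)
qed

text \<open>Uniform convexity of the \<open>p\<close>-th power for all \<open>p > 1\<close> at once: by homogeneity it suffices
  to consider the compact set \<open>max \<bar>a\<bar> \<bar>b\<bar> = 1\<close>, on which the gap is bounded below
  as long as \<open>\<bar>a - b\<bar>\<close> is.\<close>

lemma abs_powr_uniformly_convex:
  assumes p: "1 < p" and e: "0 < e"
  obtains C where "0 \<le> C"
    "\<And>a b::real. \<bar>a - b\<bar> powr p \<le> e * (\<bar>a\<bar> powr p + \<bar>b\<bar> powr p) +
       C * ((\<bar>a\<bar> powr p + \<bar>b\<bar> powr p) / 2 - \<bar>(a + b) / 2\<bar> powr p)"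
proof -
  define gap where "gap = (\<lambda>z::real \<times> real.
    (\<bar>fst z\<bar> powr p + \<bar>snd z\<bar> powr p) / 2 - \<bar>(fst z + snd z) / 2\<bar> powr p)"
  \<comment> \<open>Off \<open>S\<close>, but still with maximum \<open>1\<close>, the summand with
    factor \<open>e\<close> suffices alone, since the sum of the two powers is at least
    \<open>1\<close>. Compactness is used on \<open>S\<close>, where the two points differ and the
    gap is positive.\<close>
  define S where "S = {z::real \<times> real. max \<bar>fst z\<bar> \<bar>snd z\<bar> = 1 \<and> e \<le> \<bar>fst z - snd z\<bar> powr p}"
  have gap0: "0 \<le> gap z" for z
  proof (cases "fst z = snd z")
    case True
    then have "(fst z + snd z) / 2 = snd z" by simp
    then show ?thesis unfolding gap_def using True by simp
  next
    case False
    then show ?thesis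
      using abs_powr_midpoint_less[OF p, of "fst z" "snd z"] by (simp add: gap_def)
  qed
  have "\<exists>C\<ge>0. \<forall>z\<in>S. \<bar>fst z - snd z\<bar> powr p \<le> C * gap z"
  proof (cases "S = {}")
    case False
    have "S \<subseteq> cball 0 2"
    proof
      fix z assume "z \<in> S"
      then have "norm (fst z) \<le> 1" "norm (snd z) \<le> 1" by (auto simp: S_def)
      then show "z \<in> cball 0 2"
        using norm_Pair_le[of "fst z" "snd z"] by simp
    qed
    moreover have "closed S"
      unfolding S_def
      by (intro closed_Collect_conj closed_Collect_eq closed_Collect_le continuous_intros continuous_on_powr') (use p in auto)
    ultimately have S: "compact S"
      using bounded_subset[OF bounded_cball] compact_eq_bounded_closed by blast
    have "continuous_on S gap"
      unfolding gap_def
      by (intro continuous_intros continuous_on_powr') (use p in auto)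
    then obtain z0 where z0: "z0 \<in> S" "\<And>z. z \<in> S \<Longrightarrow> gap z0 \<le> gap z"
      using continuous_attains_inf[OF S False] by blast
    have "fst z0 \<noteq> snd z0" using z0(1) e p by (auto simp: S_def)
    then have g0: "0 < gap z0" using abs_powr_midpoint_less[OF p, of "fst z0" "snd z0"]
      by (simp add: gap_def)
    have "\<bar>fst z - snd z\<bar> powr p \<le> 2 powr p / gap z0 * gap z" if "z \<in> S" for z
    proof -
      have "\<bar>fst z - snd z\<bar> powr p \<le> 2 powr p"
        using that p by (intro powr_mono2) (auto simp: S_def)
      also have "\<dots> \<le> 2 powr p / gap z0 * gap z"
        using z0(2)[OF that] g0 by (simp add: field_simps)
      finally show ?thesis .
    qed
    then show ?thesis using g0 by (intro exI[of _ "2 powr p / gap z0"]) auto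
  qed auto
  then obtain C where C: "0 \<le> C" "\<And>z. z \<in> S \<Longrightarrow> \<bar>fst z - snd z\<bar> powr p \<le> C * gap z"
    by blast
  have "\<bar>a - b\<bar> powr p \<le> e * (\<bar>a\<bar> powr p + \<bar>b\<bar> powr p) +
       C * ((\<bar>a\<bar> powr p + \<bar>b\<bar> powr p) / 2 - \<bar>(a + b) / 2\<bar> powr p)" for a b
  proof (cases "a = 0 \<and> b = 0")
    case False
    define m where "m = max \<bar>a\<bar> \<bar>b\<bar>"
    have m: "0 < m" using False by (auto simp: m_def)
    have scale: "\<bar>m * t\<bar> powr p = m powr p * \<bar>t\<bar> powr p" for t
      using m by (simp add: abs_mult powr_mult)
    define z where "z = (a / m, b / m)"
    have ab: "a = m * fst z" "b = m * snd z" using m by (auto simp: z_def)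
    have max1: "max \<bar>fst z\<bar> \<bar>snd z\<bar> = 1"
      using m unfolding z_def m_def by (auto simp: max_def field_simps)
    have one: "1 \<le> \<bar>fst z\<bar> powr p + \<bar>snd z\<bar> powr p"
    proof (cases "\<bar>fst z\<bar> = 1")
      case True
      then show ?thesis by simp
    next
      case False
      then have "\<bar>snd z\<bar> = 1" using max1 by (auto simp: max_def split: if_splits)
      then show ?thesis by simp
    qed
    have "\<bar>fst z - snd z\<bar> powr p \<le> e * (\<bar>fst z\<bar> powr p + \<bar>snd z\<bar> powr p) + C * gap z"
    proof (cases "z \<in> S")
      case True
      then show ?thesis using C(2)[OF True] e
        by (smt (verit) mult_nonneg_nonneg powr_ge_zero)
    next
      case False
      then have "\<bar>fst z - snd z\<bar> powr p \<le> e" using max1 by (auto simp: S_def)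
      also have "\<dots> \<le> e * (\<bar>fst z\<bar> powr p + \<bar>snd z\<bar> powr p)"
        using mult_left_mono[OF one, of e] e by simp
      finally show ?thesis using C(1) gap0[of z] by (smt (verit) mult_nonneg_nonneg)
    qed
    then have "m powr p * \<bar>fst z - snd z\<bar> powr p \<le>
      m powr p * (e * (\<bar>fst z\<bar> powr p + \<bar>snd z\<bar> powr p) + C * gap z)"
      by (intro mult_left_mono) auto
    moreover have "m powr p * \<bar>fst z - snd z\<bar> powr p = \<bar>a - b\<bar> powr p"
      unfolding scale[symmetric] ab by (simp add: algebra_simps)
    moreover have "m powr p * gap z = (\<bar>a\<bar> powr p + \<bar>b\<bar> powr p) / 2 - \<bar>(a + b) / 2\<bar> powr p"
    proof -
      have "(a + b) / 2 = m * ((fst z + snd z) / 2)" by (simp add: ab algebra_simps)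
      then show ?thesis unfolding gap_def ab scale by (simp only: scale) (simp add: algebra_simps)
    qed
    moreover have "m powr p * (\<bar>fst z\<bar> powr p + \<bar>snd z\<bar> powr p) = \<bar>a\<bar> powr p + \<bar>b\<bar> powr p"
      unfolding ab scale by (simp add: algebra_simps)
    moreover have "m powr p * (e * (\<bar>fst z\<bar> powr p + \<bar>snd z\<bar> powr p) + C * gap z)
      = e * (m powr p * (\<bar>fst z\<bar> powr p + \<bar>snd z\<bar> powr p)) + C * (m powr p * gap z)"
      by (simp add: algebra_simps)
    ultimately show ?thesis by (simp only:)
  qed auto
  with C(1) show thesis using that by blast
qed

text \<open>Together with \<open>powr_diff_le\<close> this compares a difference of powers from both
  sides with the slope at the larger point \<open>a\<close>; here it suffices to enlarge
  \<open>b powr (\<beta> - 1)\<close> to \<open>a powr (\<beta> - 1)\<close>.\<close>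

lemma powr_diff_ge:
  fixes a b :: real
  assumes "0 \<le> b" "b \<le> a" "1 \<le> \<beta>"
  shows "a powr (\<beta> - 1) * (a - b) \<le> a powr \<beta> - b powr \<beta>"
proof (cases "a = 0")
  case False
  have eq: "c powr (\<beta> - 1) * c = c powr \<beta>" if "0 \<le> c" for c :: real
    using powr_mult_base[of c "\<beta> - 1"] that by (simp add: mult.commute)
  have "b powr \<beta> = b powr (\<beta> - 1) * b" using eq assms by simp
  also have "\<dots> \<le> a powr (\<beta> - 1) * b"
    using assms by (intro mult_right_mono powr_mono2) auto
  finally show ?thesis using eq[of a] assms by (simp add: algebra_simps)
qed (use assms in auto)

lemma powr_diff_le:
  fixes a b :: real
  assumes "0 \<le> b" "b \<le> a" "1 \<le> \<theta>"
  shows "a powr \<theta> - b powr \<theta> \<le> \<theta> * a powr (\<theta> - 1) * (a - b)"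
proof (cases "b < a")
  case True
  have cont: "continuous_on {b..a} (\<lambda>x. x powr \<theta>)"
    using assms by (intro continuous_on_powr' continuous_intros) auto
  obtain l z where z: "b < z" "z < a" "DERIV (\<lambda>x. x powr \<theta>) z :> l" "a powr \<theta> - b powr \<theta> = (a - b) * l"
    using MVT[OF True cont] assms
    by (metis differentiable_def has_field_derivative_imp_has_derivative has_real_derivative_powr le_less_trans real_differentiable_def)
  then have "l = \<theta> * z powr (\<theta> - 1)"
    using has_real_derivative_powr[of z \<theta>] assms DERIV_unique by (metis le_less_trans)
  also have "\<dots> \<le> \<theta> * a powr (\<theta> - 1)"
    using assms z by (intro mult_left_mono powr_mono2) auto
  finally show ?thesis using z True by (simp add: mult.commute mult_left_mono)
qed (use assms in auto)

text \<open>Both sides are compared with \<open>\<theta> powr p * a powr (p * (\<theta> - 1)) * (a -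
  b) powr p\<close>: \<open>powr_diff_le\<close> puts the left side below it and
  \<open>powr_diff_ge\<close> the right side above it.\<close>

lemma powr_test_inequality_aux:
  fixes a b :: real
  assumes p: "1 < p" and \<theta>: "1 \<le> \<theta>" and "0 \<le> b" "b \<le> a"
  shows "\<bar>a powr \<theta> - b powr \<theta>\<bar> powr p
     \<le> \<theta> powr p * ((a - b) powr (p - 1) * (a powr (p * \<theta> - p + 1) - b powr (p * \<theta> - p + 1)))"
proof -
  have \<beta>: "1 \<le> p * \<theta> - p + 1" using p \<theta> mult_left_mono[of 1 \<theta> p] by simp
  have le: "b powr \<theta> \<le> a powr \<theta>" using assms by (intro powr_mono2) auto
  have "\<bar>a powr \<theta> - b powr \<theta>\<bar> powr p \<le> (\<theta> * a powr (\<theta> - 1) * (a - b)) powr p"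
    using powr_diff_le[of b a \<theta>] assms le by (intro powr_mono2) auto
  also have "\<dots> = \<theta> powr p * (a powr (p * \<theta> - p + 1 - 1) * (a - b) powr p)"
  proof -
    have "(\<theta> - 1) * p = p * \<theta> - p + 1 - 1" by (simp add: algebra_simps)
    then show ?thesis by (simp only: powr_mult powr_powr mult.assoc)
  qed
  also have "(a - b) powr p = (a - b) powr (p - 1) * (a - b)"
    using powr_mult_base[of "a - b" "p - 1"] assms by (simp add: mult.commute)
  also have "a powr (p * \<theta> - p + 1 - 1) * ((a - b) powr (p - 1) * (a - b))
     = (a - b) powr (p - 1) * (a powr (p * \<theta> - p + 1 - 1) * (a - b))"
    by simp
  also have "\<theta> powr p * \<dots> \<le> \<theta> powr p * ((a - b) powr (p - 1) * (a powr (p * \<theta> - p + 1) - b powr (p * \<theta> - p + 1)))"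
    using powr_diff_ge[OF assms(3,4) \<beta>] by (intro mult_left_mono) auto
  finally show ?thesis .
qed

text \<open>The exponent \<open>p * \<theta> - p + 1\<close> is the one for which the two sides have the same homogeneity.\<close>

lemma powr_test_inequality:
  fixes a b M :: real
  assumes p: "1 < p" and \<theta>: "1 \<le> \<theta>" and "0 \<le> a" "0 \<le> b" "0 \<le> M"
  defines "\<beta> \<equiv> p * \<theta> - p + 1"
  shows "\<bar>min a M powr \<theta> - min b M powr \<theta>\<bar> powr p
     \<le> \<theta> powr p * (signed_power p (a - b) * (min a M powr \<beta> - min b M powr \<beta>))"
proof -
  have \<beta>: "1 \<le> \<beta>" using p \<theta> mult_left_mono[of 1 \<theta> p] by (simp add: \<beta>_def)
  have *: "\<bar>min a M powr \<theta> - min b M powr \<theta>\<bar> powr p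
     \<le> \<theta> powr p * (signed_power p (a - b) * (min a M powr \<beta> - min b M powr \<beta>))"
    if "0 \<le> b" "b \<le> a" for a b
  proof -
    have "\<bar>min a M powr \<theta> - min b M powr \<theta>\<bar> powr p
      \<le> \<theta> powr p * ((min a M - min b M) powr (p - 1) * (min a M powr \<beta> - min b M powr \<beta>))"
      unfolding \<beta>_def using that assms by (intro powr_test_inequality_aux) auto
    \<comment> \<open>Truncation shortens differences, and the second factor is nonnegative, so the
      first one may use the untruncated difference. The truncation thus stays in the test function
      only, not in the solution.\<close>
    also have "\<dots> \<le> \<theta> powr p * ((a - b) powr (p - 1) * (min a M powr \<beta> - min b M powr \<beta>))"
      using that assms(1,5) \<beta> by (intro mult_left_mono mult_right_mono powr_mono2) (auto intro!: powr_mono2)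
    also have "(a - b) powr (p - 1) = signed_power p (a - b)"
      using that by (auto simp: signed_power_alt sgn_if)
    finally show ?thesis .
  qed
  show ?thesis
  proof (cases "b \<le> a")
    case False
    have "signed_power p (b - a) * (min b M powr \<beta> - min a M powr \<beta>) =
       signed_power p (a - b) * (min a M powr \<beta> - min b M powr \<beta>)"
      using signed_power_minus[of p "a - b"] by (simp add: algebra_simps)
    with False show ?thesis using *[of a b] assms by (simp add: abs_minus_commute)
  qed (use * assms in auto)
qed

text \<open>Young's inequality with a small factor, by splitting at the point \<open>T\<close> where
  \<open>e * T powr p = T powr q\<close>.\<close>

lemma powr_less_exponent_le:
  fixes p q e :: real
  assumes "0 < q" "q < p" "0 < e"
  obtains C where "0 \<le> C" "\<And>t. 0 \<le> t \<Longrightarrow> t powr q \<le> e * t powr p + C"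
proof -
  define T where "T = (1 / e) powr (1 / (p - q))"
  have T: "T powr (p - q) = 1 / e" "0 < T" using assms by (auto simp: T_def powr_powr)
  have "t powr q \<le> e * t powr p + T powr q" if "0 \<le> t" for t
  proof (cases "t \<le> T")
    case True
    then have "t powr q \<le> T powr q" using that assms by (intro powr_mono2) auto
    then show ?thesis using assms(3) by (smt (verit) mult_nonneg_nonneg powr_ge_zero)
  next
    case False
    then have "1 / e \<le> t powr (p - q)" unfolding T(1)[symmetric]
      using T(2) assms by (intro powr_mono2) auto
    then have "1 \<le> e * t powr (p - q)" using assms by (simp add: field_simps)
    then have "t powr q * 1 \<le> t powr q * (e * t powr (p - q))" by (intro mult_left_mono) auto
    also have "\<dots> = e * t powr p"
      using powr_add[of t q "p - q"] by simp
    finally show ?thesis by (smt (verit) powr_ge_zero)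
  qed
  then show thesis using that[of "T powr q"] by simp
qed

section \<open>Lebesgue measure on products and the fractional kernel\<close>

lemma null_sets_vimage_fst_lborel:
  fixes N :: "'a::euclidean_space set"
  assumes "N \<in> null_sets lborel"
  shows "(fst -` N :: ('a \<times> 'b::euclidean_space) set) \<in> null_sets lborel"
proof -
  have "N \<times> (UNIV :: 'b set) \<in> null_sets (lborel \<Otimes>\<^sub>M lborel)"
    using assms by (auto simp: null_sets_def lborel.emeasure_pair_measure_Times)
  moreover have "fst -` N = N \<times> (UNIV :: 'b set)" by auto
  ultimately show ?thesis by (simp add: lborel_prod)
qed

lemma null_sets_vimage_snd_lborel:
  fixes N :: "'b::euclidean_space set"
  assumes "N \<in> null_sets lborel"
  shows "(snd -` N :: ('a::euclidean_space \<times> 'b) set) \<in> null_sets lborel"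
proof -
  have "(UNIV :: 'a set) \<times> N \<in> null_sets (lborel \<Otimes>\<^sub>M lborel)"
    using assms by (auto simp: null_sets_def lborel.emeasure_pair_measure_Times)
  moreover have "snd -` N = (UNIV :: 'a set) \<times> N" by auto
  ultimately show ?thesis by (simp add: lborel_prod)
qed

text \<open>\<open>lebesgue\<close> on the product is the completion of \<open>lborel\<close> there,
  so besides Borel sets the preimages of null sets have to be treated; those are null
  cylinders.\<close>

lemma measurable_fst_lebesgue [measurable]:
  "(fst :: 'a::euclidean_space \<times> 'b::euclidean_space \<Rightarrow> 'a) \<in> lebesgue \<rightarrow>\<^sub>M lebesgue"
proof (rule completion.measurable_completion2)
  have m: "fst \<in> (borel :: ('a \<times> 'b) measure) \<rightarrow>\<^sub>M borel"
    by (rule borel_measurable_continuous_onI) (intro continuous_intros)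
  then show m': "(fst :: 'a \<times> 'b \<Rightarrow> 'a) \<in> lebesgue \<rightarrow>\<^sub>M lborel"
    by (auto intro: measurable_completion)
  show "null_sets lborel \<subseteq> null_sets (distr lebesgue lborel (fst :: 'a \<times> 'b \<Rightarrow> 'a))"
  proof
    fix N :: "'a set" assume N: "N \<in> null_sets lborel"
    then have "(fst -` N :: ('a \<times> 'b) set) \<in> null_sets lebesgue"
      by (intro null_sets_completionI null_sets_vimage_fst_lborel)
    then show "N \<in> null_sets (distr lebesgue lborel (fst :: 'a \<times> 'b \<Rightarrow> 'a))"
      using N m' by (auto simp: null_sets_def emeasure_distr)
  qed
qed

lemma measurable_snd_lebesgue [measurable]:
  "(snd :: 'a::euclidean_space \<times> 'b::euclidean_space \<Rightarrow> 'b) \<in> lebesgue \<rightarrow>\<^sub>M lebesgue"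
proof (rule completion.measurable_completion2)
  have m: "snd \<in> (borel :: ('a \<times> 'b) measure) \<rightarrow>\<^sub>M borel"
    by (rule borel_measurable_continuous_onI) (intro continuous_intros)
  then show m': "(snd :: 'a \<times> 'b \<Rightarrow> 'b) \<in> lebesgue \<rightarrow>\<^sub>M lborel"
    by (auto intro: measurable_completion)
  show "null_sets lborel \<subseteq> null_sets (distr lebesgue lborel (snd :: 'a \<times> 'b \<Rightarrow> 'b))"
  proof
    fix N :: "'b set" assume N: "N \<in> null_sets lborel"
    then have "(snd -` N :: ('a \<times> 'b) set) \<in> null_sets lebesgue"
      by (intro null_sets_completionI null_sets_vimage_snd_lborel)
    then show "N \<in> null_sets (distr lebesgue lborel (snd :: 'a \<times> 'b \<Rightarrow> 'b))"
      using N m' by (auto simp: null_sets_def emeasure_distr)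
  qed
qed

lemma AE_lebesgue_fst:
  fixes P :: "'a::euclidean_space \<Rightarrow> bool"
  assumes "AE x in lebesgue. P x"
  shows "AE z in (lebesgue :: ('a \<times> 'b::euclidean_space) measure). P (fst z)"
proof -
  obtain N where N: "{x. \<not> P x} \<subseteq> N" "N \<in> null_sets lborel"
    using assms unfolding AE_completion_iff by (auto elim!: AE_E simp: null_sets_def)
  show ?thesis unfolding AE_completion_iff
    by (rule AE_I'[OF null_sets_vimage_fst_lborel[OF N(2)]]) (use N in auto)
qed

lemma AE_lebesgue_snd:
  fixes P :: "'b::euclidean_space \<Rightarrow> bool"
  assumes "AE x in lebesgue. P x"
  shows "AE z in (lebesgue :: ('a::euclidean_space \<times> 'b) measure). P (snd z)"
proof -
  obtain N where N: "{x. \<not> P x} \<subseteq> N" "N \<in> null_sets lborel"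
    using assms unfolding AE_completion_iff by (auto elim!: AE_E simp: null_sets_def)
  show ?thesis unfolding AE_completion_iff
    by (rule AE_I'[OF null_sets_vimage_snd_lborel[OF N(2)]]) (use N in auto)
qed

lemma borel_imp_lebesgue_measurable:
  "f \<in> borel_measurable borel \<Longrightarrow> f \<in> borel_measurable lebesgue"
  by (auto intro: measurable_completion)

lemma borel_measurable_lebesgue_AE_eq:
  fixes f g :: "'a::euclidean_space \<Rightarrow> 'b::topological_space"
  assumes "f \<in> borel_measurable lebesgue" "AE x in lebesgue. f x = g x"
  shows "g \<in> borel_measurable lebesgue"
proof (rule measurableI)
  fix B :: "'b set" assume B: "B \<in> sets borel"
  obtain N where N: "{x. f x \<noteq> g x} \<subseteq> N" "N \<in> null_sets lebesgue"
    using assms(2) by (auto elim!: AE_E simp: null_sets_def)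
  have "g x = f x" if "x \<notin> N" for x using N(1) that by force
  then have "g -` B = (f -` B - N) \<union> (g -` B \<inter> N)" by auto
  moreover have "f -` B \<in> sets lebesgue" using measurable_sets[OF assms(1) B] by simp
  moreover have "g -` B \<inter> N \<in> null_sets lebesgue"
    using N(2) null_sets_completion_subset by (metis inf_le2)
  ultimately have "g -` B \<in> sets lebesgue"
    using N(2) by (metis null_setsD2 sets.Diff sets.Un)
  then show "g -` B \<inter> space lebesgue \<in> sets lebesgue" by simp
qed auto

text \<open>Tonelli's theorem for a Lebesgue measurable weight against a Borel kernel: the weight is
  replaced by a Borel representative, after which the product of two copies of \<open>lborel\<close>
  is available.\<close>

lemma nn_integral_lebesgue_fst_times:
  fixes f :: "'a::euclidean_space \<Rightarrow> ennreal" and g :: "'a \<times> 'b::euclidean_space \<Rightarrow> ennreal"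
  assumes f: "f \<in> borel_measurable lebesgue" and g: "g \<in> borel_measurable borel"
  shows "(\<integral>\<^sup>+z. f (fst z) * g z \<partial>lebesgue) = (\<integral>\<^sup>+x. f x * (\<integral>\<^sup>+y. g (x, y) \<partial>lborel) \<partial>lebesgue)"
proof -
  obtain f' where f'[measurable]: "f' \<in> borel_measurable borel" and ae: "AE x in lborel. f x = f' x"
    using completion_ex_borel_measurable[OF f] by auto
  have g'[measurable]: "g \<in> borel_measurable (lborel \<Otimes>\<^sub>M lborel)"
    using g by (simp add: lborel_prod)
  have ae': "AE x in lebesgue. f x = f' x" using ae by (simp add: AE_completion_iff)
  have gf: "(\<lambda>z. f' (fst z) * g z) \<in> borel_measurable (lborel \<Otimes>\<^sub>M lborel)" by measurable
  have "(\<integral>\<^sup>+z. f (fst z) * g z \<partial>lebesgue) = (\<integral>\<^sup>+z. f' (fst z) * g z \<partial>lebesgue)"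
    by (rule nn_integral_cong_AE) (use AE_lebesgue_fst[OF ae', where 'b='b] in auto)
  also have "\<dots> = (\<integral>\<^sup>+z. f' (fst z) * g z \<partial>(lborel \<Otimes>\<^sub>M lborel))"
    by (simp add: nn_integral_completion lborel_prod)
  also have "\<dots> = (\<integral>\<^sup>+x. \<integral>\<^sup>+y. f' x * g (x, y) \<partial>lborel \<partial>lborel)"
    using lborel.nn_integral_fst[OF gf] by simp
  also have "\<dots> = (\<integral>\<^sup>+x. f' x * (\<integral>\<^sup>+y. g (x, y) \<partial>lborel) \<partial>lborel)"
    by (intro nn_integral_cong nn_integral_cmult) measurable
  also have "\<dots> = (\<integral>\<^sup>+x. f' x * (\<integral>\<^sup>+y. g (x, y) \<partial>lborel) \<partial>lebesgue)"
    by (simp add: nn_integral_completion)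
  also have "\<dots> = (\<integral>\<^sup>+x. f x * (\<integral>\<^sup>+y. g (x, y) \<partial>lborel) \<partial>lebesgue)"
    by (rule nn_integral_cong_AE) (use ae' in auto)
  finally show ?thesis .
qed

lemma nn_integral_lebesgue_snd_times:
  fixes f :: "'b::euclidean_space \<Rightarrow> ennreal" and g :: "'a::euclidean_space \<times> 'b \<Rightarrow> ennreal"
  assumes f: "f \<in> borel_measurable lebesgue" and g: "g \<in> borel_measurable borel"
  shows "(\<integral>\<^sup>+z. f (snd z) * g z \<partial>lebesgue) = (\<integral>\<^sup>+y. f y * (\<integral>\<^sup>+x. g (x, y) \<partial>lborel) \<partial>lebesgue)"
proof -
  obtain f' where f'[measurable]: "f' \<in> borel_measurable borel" and ae: "AE x in lborel. f x = f' x"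
    using completion_ex_borel_measurable[OF f] by auto
  have g'[measurable]: "g \<in> borel_measurable (lborel \<Otimes>\<^sub>M lborel)"
    using g by (simp add: lborel_prod)
  have ae': "AE x in lebesgue. f x = f' x" using ae by (simp add: AE_completion_iff)
  have gf: "(\<lambda>z. f' (snd z) * g z) \<in> borel_measurable (lborel \<Otimes>\<^sub>M lborel)" by measurable
  have "(\<integral>\<^sup>+z. f (snd z) * g z \<partial>lebesgue) = (\<integral>\<^sup>+z. f' (snd z) * g z \<partial>lebesgue)"
    by (rule nn_integral_cong_AE) (use AE_lebesgue_snd[OF ae', where 'a='a] in auto)
  also have "\<dots> = (\<integral>\<^sup>+z. f' (snd z) * g z \<partial>(lborel \<Otimes>\<^sub>M lborel))"
    by (simp add: nn_integral_completion lborel_prod)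
  also have "\<dots> = (\<integral>\<^sup>+y. \<integral>\<^sup>+x. f' y * g (x, y) \<partial>lborel \<partial>lborel)"
    using lborel_pair.nn_integral_snd[OF gf] by simp
  also have "\<dots> = (\<integral>\<^sup>+y. f' y * (\<integral>\<^sup>+x. g (x, y) \<partial>lborel) \<partial>lborel)"
    by (intro nn_integral_cong nn_integral_cmult) measurable
  also have "\<dots> = (\<integral>\<^sup>+y. f' y * (\<integral>\<^sup>+x. g (x, y) \<partial>lborel) \<partial>lebesgue)"
    by (simp add: nn_integral_completion)
  also have "\<dots> = (\<integral>\<^sup>+y. f y * (\<integral>\<^sup>+x. g (x, y) \<partial>lborel) \<partial>lebesgue)"
    by (rule nn_integral_cong_AE) (use ae' in auto)
  finally show ?thesis .
qed

section \<open>Invariance of Lebesgue measure under translation and reflection\<close>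

lemma measurable_plus_lebesgue [measurable]:
  fixes a :: "'a::euclidean_space"
  shows "(+) a \<in> lebesgue \<rightarrow>\<^sub>M lebesgue"
  using lebesgue_affine_measurable[of "\<lambda>_. 1" a] by (simp add: euclidean_representation)

lemma distr_plus_lebesgue:
  fixes a :: "'a::euclidean_space"
  shows "distr lebesgue lebesgue ((+) a) = lebesgue"
  using lebesgue_affine_euclidean[of "\<lambda>_. 1" a] by (simp add: euclidean_representation density_1)

lemma integrable_lebesgue_translate:
  fixes f :: "'a::euclidean_space \<Rightarrow> real"
  assumes "f \<in> borel_measurable lebesgue"
  shows "integrable lebesgue (\<lambda>x. f (a + x)) \<longleftrightarrow> integrable lebesgue f"
  using integrable_distr_eq[OF measurable_plus_lebesgue assms, of a] by (simp add: distr_plus_lebesgue)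

lemma integral_lebesgue_translate:
  fixes f :: "'a::euclidean_space \<Rightarrow> real"
  assumes "f \<in> borel_measurable lebesgue"
  shows "(\<integral>x. f (a + x) \<partial>lebesgue) = (\<integral>x. f x \<partial>lebesgue)"
  using integral_distr[OF measurable_plus_lebesgue assms, of a] by (simp add: distr_plus_lebesgue)

lemma AE_lebesgue_translate:
  fixes a :: "'a::euclidean_space"
  assumes "AE x in lebesgue. P x"
  shows "AE x in lebesgue. P (a + x)"
proof -
  have "AE x in distr lebesgue lebesgue ((+) a). P x" by (subst distr_plus_lebesgue) (rule assms)
  then show ?thesis by (rule AE_distrD[OF measurable_plus_lebesgue])
qed

lemma nn_integral_lborel_reflect:
  fixes f :: "'a::euclidean_space \<Rightarrow> ennreal"
  assumes [measurable]: "f \<in> borel_measurable borel"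
  shows "(\<integral>\<^sup>+y. f (x - y) \<partial>lborel) = (\<integral>\<^sup>+y. f y \<partial>lborel)"
proof -
  have "lborel = distr lborel borel ((-) x)"
    using lborel_affine[of "-1" x] by (simp add: density_1)
  then have "(\<integral>\<^sup>+y. f y \<partial>lborel) = (\<integral>\<^sup>+y. f y \<partial>distr lborel borel ((-) x))"
    by (rule arg_cong)
  also have "\<dots> = (\<integral>\<^sup>+y. f (x - y) \<partial>lborel)"
    by (simp add: nn_integral_distr)
  finally show ?thesis by simp
qed

lemma nn_integral_lborel_translate:
  fixes f :: "'a::euclidean_space \<Rightarrow> ennreal"
  assumes [measurable]: "f \<in> borel_measurable borel"
  shows "(\<integral>\<^sup>+y. f (y - x) \<partial>lborel) = (\<integral>\<^sup>+y. f y \<partial>lborel)"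
proof -
  have "(\<integral>\<^sup>+y. f y \<partial>lborel) = (\<integral>\<^sup>+y. f y \<partial>distr lborel borel ((+) (- x)))"
    by (simp add: lborel_distr_plus)
  also have "\<dots> = (\<integral>\<^sup>+y. f (y - x) \<partial>lborel)"
    by (simp add: nn_integral_distr)
  finally show ?thesis by simp
qed

section \<open>The fractional kernel and its integrability\<close>

definition frac_kernel :: "real \<Rightarrow> real \<Rightarrow> 'a::euclidean_space \<Rightarrow> real" where
  "frac_kernel s p h = 1 / norm h powr (real DIM('a) + s * p)"

lemma frac_kernel_nonneg [simp]: "0 \<le> frac_kernel s p h"
  by (simp add: frac_kernel_def)

lemma frac_kernel_measurable [measurable]: "frac_kernel s p \<in> borel_measurable borel"
  unfolding frac_kernel_def by measurable

text \<open>Does the work of polar coordinates: every point lies in one of countably many balls with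
  an attached bound for \<open>f\<close>, and only the scaling of ball volumes with the radius
  enters.\<close>

lemma nn_integral_ball_dyadic_finite:
  fixes f :: "'a::euclidean_space \<Rightarrow> real" and R T :: "nat \<Rightarrow> real"
  assumes le: "\<And>h. h \<in> S \<Longrightarrow> \<exists>j. norm h < R j \<and> f h \<le> T j"
    and "\<And>j. 0 \<le> T j" "\<And>j. 0 \<le> R j"
    and sm: "summable (\<lambda>j. T j * R j ^ DIM('a))"
  shows "(\<integral>\<^sup>+h\<in>S. ennreal (f h) \<partial>lborel) < \<infinity>"
proof -
  define V where "V = measure lborel (ball (0::'a) 1)"
  have "(\<integral>\<^sup>+h\<in>S. ennreal (f h) \<partial>lborel) \<le> (\<integral>\<^sup>+h. (\<Sum>j. ennreal (T j) * indicator (ball (0::'a) (R j)) h) \<partial>lborel)"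
  proof (rule nn_integral_mono)
    fix h :: 'a
    show "ennreal (f h) * indicator S h \<le> (\<Sum>j. ennreal (T j) * indicator (ball 0 (R j)) h)"
    proof (cases "h \<in> S")
      case True
      then obtain j where j: "norm h < R j" "f h \<le> T j" using le by blast
      define F where "F = (\<lambda>j. ennreal (T j) * indicator (ball 0 (R j)) h)"
      have "ennreal (f h) * indicator S h \<le> F j"
        using True j by (simp add: ennreal_leI F_def)
      also have "\<dots> \<le> suminf F"
        using sum_le_suminf[of F "{j}"] by simp
      finally show ?thesis unfolding F_def .
    qed simp
  qed
  also have "\<dots> = (\<Sum>j. \<integral>\<^sup>+h. ennreal (T j) * indicator (ball (0::'a) (R j)) h \<partial>lborel)"
    by (intro nn_integral_suminf borel_measurable_times_ennreal borel_measurable_indicator) auto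
  also have "\<dots> = (\<Sum>j. ennreal (V * (T j * R j ^ DIM('a))))"
  proof (intro suminf_cong)
    fix j
    have "emeasure lborel (ball (0::'a) (R j)) = ennreal (R j ^ DIM('a) * V)"
      using content_ball_conv_unit_ball[of "R j" "0::'a"] assms(3)[of j] emeasure_lborel_ball_finite[of "0::'a" "R j"]
      by (simp add: V_def emeasure_eq_ennreal_measure)
    then show "(\<integral>\<^sup>+h. ennreal (T j) * indicator (ball (0::'a) (R j)) h \<partial>lborel) = ennreal (V * (T j * R j ^ DIM('a)))"
      using assms(2)[of j] assms(3)[of j]
      by (simp add: nn_integral_cmult_indicator V_def ennreal_mult'[symmetric] mult_ac)
  qed
  also have "\<dots> < \<infinity>"
  proof -
    have "(\<Sum>j. ennreal (V * (T j * R j ^ DIM('a)))) \<noteq> top"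
      using assms(2,3) by (intro ennreal_suminf_neq_top summable_mult sm) (simp add: V_def)
    then show ?thesis unfolding infinity_ennreal_def less_top .
  qed
  finally show ?thesis .
qed

lemma nn_integral_frac_kernel_near_finite:
  fixes s p :: real
  assumes "0 < s" "s < 1" "1 < p"
  shows "(\<integral>\<^sup>+h\<in>{h::'a::euclidean_space. 0 < norm h \<and> norm h \<le> 1}. ennreal (norm h powr p * frac_kernel s p h) \<partial>lborel) < \<infinity>"
proof -
  define N where "N = real DIM('a)"
  \<comment> \<open>The shell for \<open>j\<close> is
    \<open>2 powr - (j + 1) \<le> norm h \<le> 2 powr - j\<close>; the additional factor
    \<open>2\<close> makes \<open>norm h < R j\<close> strict. In \<open>T\<close> the numerator
    uses the outer radius and the kernel the inner one.\<close>
  define R where "R = (\<lambda>j::nat. 2 * 2 powr - real j)"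
  define T where "T = (\<lambda>j::nat. (2 powr - real j) powr p * (1 / (2 powr - (real j + 1)) powr (N + s * p)))"
  have le: "\<exists>j. norm h < R j \<and> norm h powr p * frac_kernel s p h \<le> T j"
    if "h \<in> {h. 0 < norm h \<and> norm h \<le> 1}" for h :: 'a
  proof
    have h: "0 < norm h" "norm h \<le> 1" using that by auto
    define j where "j = nat \<lfloor>- log 2 (norm h)\<rfloor>"
    have "0 \<le> - log 2 (norm h)" using h by simp
    then have j: "real j \<le> - log 2 (norm h)" "- log 2 (norm h) < real j + 1"
      unfolding j_def by linarith+
    have n: "norm h = 2 powr (log 2 (norm h))" using h by simp
    have up: "norm h \<le> 2 powr - real j" and lo: "2 powr - (real j + 1) \<le> norm h"
      using j by (subst n, intro powr_mono; simp)+
    have "0 < (2::real) powr - real j" by simp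
    then have "norm h < R j" unfolding R_def using up by linarith
    moreover have "norm h powr p * frac_kernel s p h \<le> T j"
      unfolding T_def frac_kernel_def N_def[symmetric]
      using h up lo assms by (intro mult_mono powr_mono2 divide_left_mono) (auto simp: N_def)
    ultimately show "norm h < R j \<and> norm h powr p * frac_kernel s p h \<le> T j" by simp
  qed
  have "T j * R j ^ DIM('a) = 2 powr (N + (N + s * p)) * (2 powr - (p * (1 - s))) ^ j" for j
  proof -
    have "R j ^ DIM('a) = (2 powr (1 - real j)) powr N"
      by (simp add: R_def N_def powr_realpow powr_diff powr_minus_divide)
    moreover have "T j = (2 powr - real j) powr p * (2 powr (real j + 1)) powr (N + s * p)"
    proof -
      have "1 / (2 powr - a) powr e = (2 powr a) powr e" for a e :: real
        by (simp only: powr_powr powr_minus_divide[symmetric]) simp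
      then show ?thesis by (simp only: T_def)
    qed
    moreover have "(2 powr - (p * (1 - s))) ^ j = (2::real) powr (- (p * (1 - s)) * real j)"
      by (simp only: powr_realpow[symmetric] powr_gt_zero powr_powr)
    moreover have "- real j * p + (real j + 1) * (N + s * p) + (1 - real j) * N
      = (N + (N + s * p)) + - (p * (1 - s)) * real j"
      by (simp add: algebra_simps)
    ultimately show ?thesis
      by (simp only: powr_powr powr_add[symmetric])
  qed
  \<comment> \<open>The ratio of the geometric series is below \<open>1\<close> because
    \<open>s < 1\<close>: integrability at the origin.\<close>
  moreover have "(2::real) powr - (p * (1 - s)) < 1"
    using assms powr_less_mono[of "- (p * (1 - s))" 0 2] by simp
  ultimately have sm: "summable (\<lambda>j. T j * R j ^ DIM('a))"
    by (simp add: summable_mult summable_geometric)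
  have nonneg: "0 \<le> T j" "0 \<le> R j" for j
    unfolding T_def R_def
    by (intro mult_nonneg_nonneg divide_nonneg_nonneg powr_ge_zero zero_le_numeral zero_le_one)+
  show ?thesis
    by (rule nn_integral_ball_dyadic_finite[where R=R and T=T, OF le nonneg sm])
qed

lemma nn_integral_frac_kernel_far_finite:
  fixes s p :: real
  assumes "0 < s" "1 < p"
  shows "(\<integral>\<^sup>+h\<in>{h::'a::euclidean_space. 1 \<le> norm h}. ennreal (frac_kernel s p h) \<partial>lborel) < \<infinity>"
proof -
  define N where "N = real DIM('a)"
  define R where "R = (\<lambda>j::nat. 2 powr (real j + 1))"
  define T where "T = (\<lambda>j::nat. 1 / (2 powr real j) powr (N + s * p))"
  have le: "\<exists>j. norm h < R j \<and> frac_kernel s p h \<le> T j"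
    if "h \<in> {h. 1 \<le> norm h}" for h :: 'a
  proof
    have h: "1 \<le> norm h" "0 < norm h" using that by (auto intro: less_le_trans[of 0 1])
    define j where "j = nat \<lfloor>log 2 (norm h)\<rfloor>"
    have "0 \<le> log 2 (norm h)" using h by simp
    then have j: "real j \<le> log 2 (norm h)" "log 2 (norm h) < real j + 1"
      unfolding j_def by linarith+
    have n: "norm h = 2 powr (log 2 (norm h))" using h(2) by simp
    have "norm h < R j" "2 powr real j \<le> norm h"
      using j unfolding R_def by (subst n, intro powr_mono powr_less_mono; simp)+
    moreover from this(2) have "frac_kernel s p h \<le> T j"
      unfolding T_def frac_kernel_def N_def[symmetric]
      using h assms by (intro powr_mono2 divide_left_mono) (auto simp: N_def)
    ultimately show "norm h < R j \<and> frac_kernel s p h \<le> T j" by simp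
  qed
  have "T j * R j ^ DIM('a) = 2 powr N * (2 powr - (s * p)) ^ j" for j
  proof -
    have "R j ^ DIM('a) = (2 powr (real j + 1)) powr N"
      by (simp add: R_def N_def powr_realpow)
    moreover have "T j = 2 powr - (real j * (N + s * p))"
      unfolding T_def by (simp add: powr_powr powr_minus_divide)
    moreover have "(2 powr - (s * p)) ^ j = (2::real) powr (- (s * p) * real j)"
      by (simp only: powr_realpow[symmetric] powr_gt_zero powr_powr)
    moreover have "- (real j * (N + s * p)) + (real j + 1) * N = N + - (s * p) * real j"
      by (simp add: algebra_simps)
    ultimately show ?thesis
      by (simp only: powr_powr powr_add[symmetric])
  qed
  \<comment> \<open>At infinity the decay comes from \<open>s * p > 0\<close>.\<close>
  moreover have "(2::real) powr - (s * p) < 1"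
    using assms powr_less_mono[of "- (s * p)" 0 2] by simp
  ultimately have sm: "summable (\<lambda>j. T j * R j ^ DIM('a))"
    by (simp add: summable_mult summable_geometric)
  have nonneg: "0 \<le> T j" "0 \<le> R j" for j
    unfolding T_def R_def
    by (intro mult_nonneg_nonneg divide_nonneg_nonneg powr_ge_zero zero_le_numeral zero_le_one)+
  show ?thesis
    by (rule nn_integral_ball_dyadic_finite[where R=R and T=T, OF le nonneg sm])
qed

text \<open>\<open>min 1 (norm h)\<close> is, up to a factor, the size of an increment of a bounded
  Lipschitz function. Its p-th power tames the singularity of the kernel and keeps the decay at
  infinity.\<close>

lemma nn_integral_frac_kernel_finite:
  fixes s p :: real
  assumes "0 < s" "s < 1" "1 < p"
  shows "(\<integral>\<^sup>+h. ennreal (min 1 (norm (h::'a::euclidean_space)) powr p * frac_kernel s p h) \<partial>lborel) < \<infinity>"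
proof -
  let ?A = "{h::'a. 0 < norm h \<and> norm h \<le> 1}" and ?B = "{h::'a. 1 \<le> norm h}"
  have "(\<integral>\<^sup>+h. ennreal (min 1 (norm (h::'a)) powr p * frac_kernel s p h) \<partial>lborel)
     \<le> (\<integral>\<^sup>+h. ennreal (norm h powr p * frac_kernel s p h) * indicator ?A h
           + ennreal (frac_kernel s p h) * indicator ?B h \<partial>lborel)"
  proof (rule nn_integral_mono)
    fix h :: 'a
    show "ennreal (min 1 (norm h) powr p * frac_kernel s p h) \<le> ennreal (norm h powr p * frac_kernel s p h) * indicator ?A h
           + ennreal (frac_kernel s p h) * indicator ?B h"
    proof -
      consider "h = 0" | "h \<in> ?A" | "h \<in> ?B" by fastforce
      then show ?thesis
      proof cases
        case 1
        then show ?thesis by (simp add: frac_kernel_def)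
      next
        case 2
        then have "min 1 (norm h) = norm h" by auto
        with 2 show ?thesis by simp
      next
        case 3
        then have "min 1 (norm h) = 1" by auto
        with 3 show ?thesis by simp
      qed
    qed
  qed
  also have "\<dots> = (\<integral>\<^sup>+h\<in>?A. ennreal (norm h powr p * frac_kernel s p h) \<partial>lborel)
       + (\<integral>\<^sup>+h\<in>?B. ennreal (frac_kernel s p h) \<partial>lborel)"
    by (rule nn_integral_add) measurable
  also have "\<dots> < \<infinity>"
    using nn_integral_frac_kernel_near_finite[OF assms, where 'a='a]
      nn_integral_frac_kernel_far_finite[OF assms(1,3), where 'a='a] by (simp only: infinity_ennreal_def ennreal_add_less_top)
  finally show ?thesis .
qed

section \<open>Fractional Sobolev spaces\<close>

text \<open>Fatou's lemma for real-valued integrals. The bound is carried into the conclusion,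
  because lower semicontinuity of energies is drawn from it.\<close>

lemma integral_Fatou_AE:
  fixes g :: "nat \<Rightarrow> 'b \<Rightarrow> real"
  assumes int: "\<And>n. integrable M (g n)" and nonneg: "\<And>n x. 0 \<le> g n x"
    and le: "\<And>n. (\<integral>x. g n x \<partial>M) \<le> C"
    and f: "f \<in> borel_measurable M" and lim: "AE x in M. (\<lambda>n. g n x) \<longlonglongrightarrow> f x"
  shows "integrable M f" "(\<integral>x. f x \<partial>M) \<le> C"
proof -
  have f0: "AE x in M. 0 \<le> f x"
    using lim by eventually_elim (auto intro: LIMSEQ_le_const nonneg)
  have "0 \<le> (\<integral>x. g 0 x \<partial>M)" using nonneg by simp
  then have C: "0 \<le> C" using le[of 0] by linarith
  have "(\<integral>\<^sup>+x. ennreal (f x) \<partial>M) = (\<integral>\<^sup>+x. liminf (\<lambda>n. ennreal (g n x)) \<partial>M)"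
  proof (rule nn_integral_cong_AE)
    show "AE x in M. ennreal (f x) = liminf (\<lambda>n. ennreal (g n x))"
      using lim
    proof eventually_elim
      case (elim x)
      then have "(\<lambda>n. ennreal (g n x)) \<longlonglongrightarrow> ennreal (f x)" by (rule tendsto_ennrealI)
      then show ?case by (simp add: lim_imp_Liminf)
    qed
  qed
  also have "\<dots> \<le> liminf (\<lambda>n. \<integral>\<^sup>+x. ennreal (g n x) \<partial>M)"
    using int by (intro nn_integral_liminf) auto
  also have "\<dots> \<le> ennreal C"
  proof (rule Liminf_le)
    have "(\<integral>\<^sup>+x. ennreal (g n x) \<partial>M) \<le> ennreal C" for n
      using int nonneg le[of n] by (simp add: nn_integral_eq_integral ennreal_leI)
    then show "\<forall>\<^sub>F n in sequentially. (\<integral>\<^sup>+x. ennreal (g n x) \<partial>M) \<le> ennreal C" by simp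
  qed simp
  finally have *: "(\<integral>\<^sup>+x. ennreal (f x) \<partial>M) \<le> ennreal C" .
  show i: "integrable M f"
    by (rule integrableI_nonneg[OF f f0]) (use * in \<open>simp add: le_less_trans ennreal_less_top\<close>)
  show "(\<integral>x. f x \<partial>M) \<le> C"
    using * C by (simp add: nn_integral_eq_integral[OF i f0])
qed

lemma borel_measurable_lebesgue_LIMSEQ:
  fixes f :: "nat \<Rightarrow> 'a::euclidean_space \<Rightarrow> real"
  assumes "\<And>n. f n \<in> borel_measurable lebesgue" "AE x in lebesgue. (\<lambda>n. f n x) \<longlonglongrightarrow> g x"
  shows "g \<in> borel_measurable lebesgue"
proof (rule borel_measurable_lebesgue_AE_eq)
  show "(\<lambda>x. lim (\<lambda>n. f n x)) \<in> borel_measurable lebesgue"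
    using assms(1) by (rule borel_measurable_lim_metric)
  show "AE x in lebesgue. lim (\<lambda>n. f n x) = g x"
    using assms(2) by eventually_elim (rule limI)
qed

definition increment :: "('a::euclidean_space \<Rightarrow> real) \<Rightarrow> 'a \<times> 'a \<Rightarrow> real" where
  "increment u z = u (fst z) - u (snd z)"

text \<open>With the kernel absorbed into the measure, finite energy means that
  \<open>increment u\<close> is an ordinary L^p function, and dominated convergence or Fatou's lemma
  apply directly. The diagonal carries no mass, since the kernel has value \<open>0\<close> at
  \<open>0\<close>.\<close>

definition gagliardo_measure :: "real \<Rightarrow> real \<Rightarrow> ('a::euclidean_space \<times> 'a) measure" where
  "gagliardo_measure s p = density lebesgue (\<lambda>z. ennreal (frac_kernel s p (fst z - snd z)))"

definition seminorm_powr :: "real \<Rightarrow> real \<Rightarrow> ('a::euclidean_space \<Rightarrow> real) \<Rightarrow> real" where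
  "seminorm_powr s p u = (\<integral>z. \<bar>increment u z\<bar> powr p \<partial>gagliardo_measure s p)"

lemma increment_measurable [measurable]:
  "u \<in> borel_measurable lebesgue \<Longrightarrow> increment u \<in> borel_measurable lebesgue"
  unfolding increment_def
  by (intro borel_measurable_diff measurable_compose[OF measurable_fst_lebesgue] measurable_compose[OF measurable_snd_lebesgue])

lemma frac_kernel_diff_borel [measurable]:
  "(\<lambda>z::'a::euclidean_space \<times> 'a. frac_kernel s p (fst z - snd z)) \<in> borel_measurable borel"
proof -
  have "(\<lambda>z::'a \<times> 'a. fst z - snd z) \<in> borel_measurable borel"
    by (rule borel_measurable_continuous_onI) (intro continuous_intros)
  then show ?thesis by measurable
qed

lemma frac_kernel_diff_lebesgue [measurable]:
  "(\<lambda>z::'a::euclidean_space \<times> 'a. frac_kernel s p (fst z - snd z)) \<in> borel_measurable lebesgue"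
  by (rule borel_imp_lebesgue_measurable) measurable

lemma sets_gagliardo_measure [simp, measurable_cong]:
  "sets (gagliardo_measure s p) = sets lebesgue"
  by (simp add: gagliardo_measure_def)

lemma space_gagliardo_measure [simp]: "space (gagliardo_measure s p) = UNIV"
  by (simp add: gagliardo_measure_def)

lemma measurable_gagliardo_measure [simp]:
  "measurable (gagliardo_measure s p) N = measurable lebesgue N"
  by (rule measurable_cong_sets) auto

lemma AE_gagliardo_measureI:
  assumes "AE z in lebesgue. P z"
  shows "AE z in gagliardo_measure s p. P z"
  unfolding gagliardo_measure_def by (subst AE_density) (use assms in auto)

lemma nn_integral_gagliardo_measure:
  assumes "f \<in> borel_measurable lebesgue"
  shows "(\<integral>\<^sup>+z. f z \<partial>gagliardo_measure s p) = (\<integral>\<^sup>+z. f z * ennreal (frac_kernel s p (fst z - snd z)) \<partial>lebesgue)"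
  unfolding gagliardo_measure_def using assms by (subst nn_integral_density) (auto simp: mult.commute)

lemma integrable_gagliardo_measure:
  fixes f :: "'a::euclidean_space \<times> 'a \<Rightarrow> real"
  assumes "f \<in> borel_measurable lebesgue"
  shows "integrable (gagliardo_measure s p) f \<longleftrightarrow> integrable lebesgue (\<lambda>z. frac_kernel s p (fst z - snd z) * f z)"
  unfolding gagliardo_measure_def using assms by (subst integrable_density) auto

lemma integral_gagliardo_measure:
  fixes f :: "'a::euclidean_space \<times> 'a \<Rightarrow> real"
  assumes "f \<in> borel_measurable lebesgue"
  shows "(\<integral>z. f z \<partial>gagliardo_measure s p) = (\<integral>z. frac_kernel s p (fst z - snd z) * f z \<partial>lebesgue)"
  unfolding gagliardo_measure_def using assms by (subst integral_density) auto

lemma frac_form_integrand_eq: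
  "frac_form_integrand s p u \<phi> = (\<lambda>z. frac_kernel s p (fst z - snd z) * (signed_power p (increment u z) * increment \<phi> z))"
  by (auto simp: frac_form_integrand_def frac_kernel_def increment_def)

lemma gagliardo_energy_eq:
  assumes "u \<in> borel_measurable lebesgue" "A \<in> sets lebesgue"
  shows "gagliardo_energy s p A u = (\<integral>\<^sup>+z. ennreal (indicator (A \<times> A) z * \<bar>increment u z\<bar> powr p) \<partial>gagliardo_measure s p)"
proof -
  have "A \<times> A = fst -` A \<inter> snd -` A \<inter> space lebesgue" by auto
  also have "\<dots> \<in> sets lebesgue"
    using measurable_sets[OF measurable_fst_lebesgue assms(2)] measurable_sets[OF measurable_snd_lebesgue assms(2)]
    by (auto simp: Int_assoc)
  finally have [measurable]: "A \<times> A \<in> sets lebesgue" .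
  note [measurable] = assms(1)
  show ?thesis
    unfolding gagliardo_energy_def
    by (subst nn_integral_gagliardo_measure, measurable)
      (auto intro!: nn_integral_cong simp: indicator_def increment_def frac_kernel_def simp flip: ennreal_mult)
qed

lemma AE_increment_cong:
  assumes "AE x in lebesgue. u x = v x"
  shows "AE z in gagliardo_measure s p. increment u z = increment v z"
proof (rule AE_gagliardo_measureI)
  show "AE z in lebesgue. increment u z = increment v z"
    using AE_lebesgue_fst[OF assms, where 'b='a] AE_lebesgue_snd[OF assms, where 'a='a]
    by eventually_elim (simp add: increment_def)
qed

lemma abs_add_powr_le:
  fixes a b p :: real
  assumes "0 < p"
  shows "\<bar>a + b\<bar> powr p \<le> 2 powr p * (\<bar>a\<bar> powr p + \<bar>b\<bar> powr p)"
proof -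
  have "\<bar>a + b\<bar> powr p \<le> (2 * max \<bar>a\<bar> \<bar>b\<bar>) powr p"
    using assms by (intro powr_mono2) auto
  also have "\<dots> = 2 powr p * max \<bar>a\<bar> \<bar>b\<bar> powr p"
    by (simp add: powr_mult)
  also have "\<dots> \<le> 2 powr p * (\<bar>a\<bar> powr p + \<bar>b\<bar> powr p)"
    by (intro mult_left_mono) (auto simp: max_def)
  finally show ?thesis .
qed

locale frac_exponents =
  fixes s p :: real
  assumes s_pos: "0 < s" and s_less: "s < 1" and p_gt: "1 < p"
begin

abbreviation \<mu> :: "('a::euclidean_space \<times> 'a) measure" where
  "\<mu> \<equiv> gagliardo_measure s p"

abbreviation \<W> :: "'a::euclidean_space set \<Rightarrow> ('a \<Rightarrow> real) set" where
  "\<W> \<equiv> frac_sobolev_zero s p"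

abbreviation \<E> :: "('a::euclidean_space \<Rightarrow> real) \<Rightarrow> real" where
  "\<E> \<equiv> seminorm_powr s p"

abbreviation form :: "('a::euclidean_space \<Rightarrow> real) \<Rightarrow> ('a \<Rightarrow> real) \<Rightarrow> real" where
  "form u \<phi> \<equiv> \<integral>z. signed_power p (increment u z) * increment \<phi> z \<partial>\<mu>"

lemma p_pos: "0 < p" and sp_pos: "0 < s * p"
  using p_gt s_pos by (auto intro!: mult_pos_pos)

lemma frac_sobolev_zero_iff:
  "u \<in> \<W> A \<longleftrightarrow> u \<in> borel_measurable lebesgue \<and> integrable lebesgue (\<lambda>x. \<bar>u x\<bar> powr p) \<and>
     integrable \<mu> (\<lambda>z. \<bar>increment u z\<bar> powr p) \<and> (AE x in lebesgue. x \<notin> A \<longrightarrow> u x = 0)"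
proof (cases "u \<in> borel_measurable lebesgue")
  case True
  note [measurable] = True
  show ?thesis
    using True
    by (auto simp: frac_sobolev_zero_def frac_sobolev_def Lp_on_def gagliardo_energy_eq
        integrable_iff_bounded lebesgue_on_UNIV_eq)
qed (auto simp: frac_sobolev_zero_def frac_sobolev_def Lp_on_def)

lemma frac_sobolev_zeroD:
  assumes "u \<in> \<W> A"
  shows "u \<in> borel_measurable lebesgue" "integrable lebesgue (\<lambda>x. \<bar>u x\<bar> powr p)"
    "integrable \<mu> (\<lambda>z. \<bar>increment u z\<bar> powr p)" "AE x in lebesgue. x \<notin> A \<longrightarrow> u x = 0"
  using assms by (auto simp: frac_sobolev_zero_iff)

lemma frac_sobolev_zero_mono:
  assumes "u \<in> \<W> A" "A \<subseteq> B"
  shows "u \<in> \<W> B"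
  using assms unfolding frac_sobolev_zero_iff by (auto elim!: eventually_mono)

text \<open>Positive part, absolute value, scaling, truncated powers and changes on null sets all
  shrink values and increments up to a fixed factor; membership of each is reduced to this
  statement.\<close>

lemma frac_sobolev_zero_contract:
  assumes u: "u \<in> \<W> A" and w: "w \<in> borel_measurable lebesgue" and L: "0 \<le> L"
    and inc: "AE z in \<mu>. \<bar>increment w z\<bar> \<le> L * \<bar>increment u z\<bar>"
    and le: "AE x in lebesgue. \<bar>w x\<bar> \<le> L * \<bar>u x\<bar>"
  shows "w \<in> \<W> A"
proof -
  note u' = frac_sobolev_zeroD[OF u]
  note [measurable] = w u'(1)
  have *: "\<bar>a\<bar> powr p \<le> L powr p * \<bar>b\<bar> powr p" if "\<bar>a\<bar> \<le> L * \<bar>b\<bar>" for a b :: real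
    using powr_mono2[OF _ _ that, of p] p_pos L by (simp add: powr_mult)
  have "integrable lebesgue (\<lambda>x. \<bar>w x\<bar> powr p)"
    by (rule Bochner_Integration.integrable_bound[OF integrable_mult_right[OF u'(2), of "L powr p"]])
      (use le * in \<open>auto elim!: eventually_mono\<close>)
  moreover have "integrable \<mu> (\<lambda>z. \<bar>increment w z\<bar> powr p)"
    by (rule Bochner_Integration.integrable_bound[OF integrable_mult_right[OF u'(3), of "L powr p"]])
      (use inc * in \<open>auto elim!: eventually_mono\<close>)
  moreover have "AE x in lebesgue. x \<notin> A \<longrightarrow> w x = 0"
    using le u'(4) by eventually_elim auto
  ultimately show ?thesis using w by (simp add: frac_sobolev_zero_iff)
qed

lemma frac_sobolev_zero_cong:
  assumes "u \<in> \<W> A" "AE x in lebesgue. u x = w x"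
  shows "w \<in> \<W> A"
  by (rule frac_sobolev_zero_contract[OF assms(1) borel_measurable_lebesgue_AE_eq[OF frac_sobolev_zeroD(1)[OF assms(1)] assms(2)], of 1])
    (use AE_increment_cong[OF assms(2), of s p] assms(2) in \<open>auto elim!: eventually_mono\<close>)

lemma frac_sobolev_zero_add:
  assumes u: "u \<in> \<W> A" and v: "v \<in> \<W> A"
  shows "(\<lambda>x. u x + v x) \<in> \<W> A"
proof -
  note u' = frac_sobolev_zeroD[OF u] and v' = frac_sobolev_zeroD[OF v]
  note [measurable] = u'(1) v'(1)
  note bd = abs_add_powr_le[OF p_pos]
  have inc: "increment (\<lambda>x. u x + v x) z = increment u z + increment v z" for z
    by (simp add: increment_def)
  have "integrable lebesgue (\<lambda>x. \<bar>u x + v x\<bar> powr p)"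
    by (rule Bochner_Integration.integrable_bound[OF integrable_mult_right[OF Bochner_Integration.integrable_add[OF u'(2) v'(2)], of "2 powr p"]])
      (use bd in auto)
  moreover have "integrable \<mu> (\<lambda>z. \<bar>increment (\<lambda>x. u x + v x) z\<bar> powr p)"
    by (rule Bochner_Integration.integrable_bound[OF integrable_mult_right[OF Bochner_Integration.integrable_add[OF u'(3) v'(3)], of "2 powr p"]])
      (use bd in \<open>auto simp: inc\<close>)
  moreover have "AE x in lebesgue. x \<notin> A \<longrightarrow> u x + v x = 0"
    using v'(4) u'(4) by eventually_elim auto
  ultimately show ?thesis by (simp add: frac_sobolev_zero_iff)
qed

lemma frac_sobolev_zero_cmult:
  assumes u: "u \<in> \<W> A"
  shows "(\<lambda>x. c * u x) \<in> \<W> A"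
proof (rule frac_sobolev_zero_contract[OF u, of _ "\<bar>c\<bar>"])
  show "(\<lambda>x. c * u x) \<in> borel_measurable lebesgue"
    using frac_sobolev_zeroD(1)[OF u] by measurable
qed (auto simp: increment_def abs_mult simp flip: right_diff_distrib)

lemma frac_sobolev_zero_diff:
  assumes u: "u \<in> \<W> A" and v: "v \<in> \<W> A"
  shows "(\<lambda>x. u x - v x) \<in> \<W> A"
  using frac_sobolev_zero_add[OF u frac_sobolev_zero_cmult[OF v, of "-1"]] by simp

lemma frac_sobolev_zero_max0:
  assumes u: "u \<in> \<W> A"
  shows "(\<lambda>x. max (u x) 0) \<in> \<W> A"
proof (rule frac_sobolev_zero_contract[OF u, of _ 1])
  show "(\<lambda>x. max (u x) 0) \<in> borel_measurable lebesgue"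
    using frac_sobolev_zeroD(1)[OF u] by measurable
qed (auto simp: increment_def)

text \<open>Bounded sets are closed under almost everywhere convergence: Fatou's lemma bounds both
  integrals, and vanishing outside \<open>A\<close> is inherited pointwise.\<close>

lemma frac_sobolev_zero_Fatou:
  fixes f :: "nat \<Rightarrow> 'a::euclidean_space \<Rightarrow> real"
  assumes f: "\<And>n. f n \<in> \<W> A"
    and E: "\<And>n. \<E> (f n) \<le> C"
    and I: "\<And>n. (\<integral>x. \<bar>f n x\<bar> powr p \<partial>lebesgue) \<le> C'"
    and lim: "AE x in lebesgue. (\<lambda>n. f n x) \<longlonglongrightarrow> g x"
  shows "g \<in> \<W> A" "\<E> g \<le> C" "(\<integral>x. \<bar>g x\<bar> powr p \<partial>lebesgue) \<le> C'"
proof -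
  note f' = frac_sobolev_zeroD[OF f]
  have g[measurable]: "g \<in> borel_measurable lebesgue"
    using f'(1) lim by (rule borel_measurable_lebesgue_LIMSEQ)
  have lim1: "AE x in lebesgue. (\<lambda>n. \<bar>f n x\<bar> powr p) \<longlonglongrightarrow> \<bar>g x\<bar> powr p"
    using lim by eventually_elim (rule tendsto_abs_powr[OF p_pos])
  have lim2: "AE z in \<mu>. (\<lambda>n. \<bar>increment (f n) z\<bar> powr p) \<longlonglongrightarrow> \<bar>increment g z\<bar> powr p"
  proof (rule AE_gagliardo_measureI)
    show "AE z in lebesgue. (\<lambda>n. \<bar>increment (f n) z\<bar> powr p) \<longlonglongrightarrow> \<bar>increment g z\<bar> powr p"
      using AE_lebesgue_fst[OF lim, where 'b='a] AE_lebesgue_snd[OF lim, where 'a='a]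
      by eventually_elim (auto simp: increment_def intro!: tendsto_abs_powr p_pos tendsto_diff)
  qed
  have 1: "integrable lebesgue (\<lambda>x. \<bar>g x\<bar> powr p)"
    by (rule integral_Fatou_AE(1)[OF f'(2) _ I _ lim1]) auto
  show "(\<integral>x. \<bar>g x\<bar> powr p \<partial>lebesgue) \<le> C'"
    by (rule integral_Fatou_AE(2)[OF f'(2) _ I _ lim1]) auto
  have 2: "integrable \<mu> (\<lambda>z. \<bar>increment g z\<bar> powr p)"
    by (rule integral_Fatou_AE(1)[OF f'(3) _ E[unfolded seminorm_powr_def] _ lim2]) auto
  show "\<E> g \<le> C" unfolding seminorm_powr_def
    by (rule integral_Fatou_AE(2)[OF f'(3) _ E[unfolded seminorm_powr_def] _ lim2]) auto
  have "AE x in lebesgue. \<forall>n. x \<notin> A \<longrightarrow> f n x = 0"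
    using f'(4) unfolding AE_all_countable by blast
  then have "AE x in lebesgue. x \<notin> A \<longrightarrow> g x = 0"
    using lim
  proof eventually_elim
    case (elim x)
    then show ?case using LIMSEQ_unique[of "\<lambda>n. f n x" "g x" 0] by auto
  qed
  then show "g \<in> \<W> A"
    using 1 2 g by (simp add: frac_sobolev_zero_iff)
qed

text \<open>The type argument selects the space over which the integral is taken;
  \<open>enn2real\<close> loses nothing, since the integral is finite.\<close>

definition kernel_mass :: "'a::euclidean_space itself \<Rightarrow> real" where
  "kernel_mass _ = enn2real (\<integral>\<^sup>+h. ennreal (min 1 (norm (h::'a)) powr p * frac_kernel s p h) \<partial>lborel)"

lemma kernel_mass:
  "(\<integral>\<^sup>+h. ennreal (min 1 (norm (h::'a::euclidean_space)) powr p * frac_kernel s p h) \<partial>lborel) = ennreal (kernel_mass TYPE('a))"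
  using nn_integral_frac_kernel_finite[OF s_pos s_less p_gt, where 'a='a] by (simp add: kernel_mass_def)

lemma kernel_mass_nonneg: "0 \<le> kernel_mass TYPE('a::euclidean_space)"
  by (simp add: kernel_mass_def)

definition cutoff :: "'a::euclidean_space \<times> 'a \<Rightarrow> real" where
  "cutoff z = min 1 (norm (fst z - snd z)) powr p"

lemma cutoff_measurable [measurable]:
  "cutoff \<in> borel_measurable (borel :: ('a::euclidean_space \<times> 'a) measure)"
  unfolding cutoff_def
  by (rule borel_measurable_continuous_onI) (intro continuous_intros continuous_on_powr', use p_pos in auto)

lemma cutoff_measurable_lebesgue [measurable]:
  "cutoff \<in> borel_measurable (lebesgue :: ('a::euclidean_space \<times> 'a) measure)"
  by (rule borel_imp_lebesgue_measurable) measurable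

lemma cutoff_nonneg [simp]: "0 \<le> cutoff z"
  by (simp add: cutoff_def)

text \<open>By Tonelli's theorem the kernel is integrated over the second point first; after the
  reflection \<open>y \<mapsto> x - y\<close> the result is the same constant for every
  \<open>x\<close>.\<close>

lemma integral_cutoff_fst:
  fixes f :: "'a::euclidean_space \<Rightarrow> real"
  assumes f: "integrable lebesgue f" and f0: "\<And>x. 0 \<le> f x"
  shows "integrable \<mu> (\<lambda>z. f (fst z) * cutoff z)"
    "(\<integral>z. f (fst z) * cutoff z \<partial>\<mu>) = kernel_mass TYPE('a) * (\<integral>x. f x \<partial>lebesgue)"
proof -
  have [measurable]: "f \<in> borel_measurable lebesgue" using f by auto
  let ?g = "\<lambda>z::'a\<times>'a. ennreal (cutoff z * frac_kernel s p (fst z - snd z))"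
  have g: "?g \<in> borel_measurable borel" by measurable
  have "(\<integral>\<^sup>+z. ennreal (f (fst z) * cutoff z) \<partial>\<mu>) = (\<integral>\<^sup>+z. ennreal (f (fst z)) * ?g z \<partial>lebesgue)"
    by (subst nn_integral_gagliardo_measure, measurable)
      (auto intro!: nn_integral_cong simp: f0 ennreal_mult mult.assoc)
  also have "\<dots> = (\<integral>\<^sup>+x. ennreal (f x) * (\<integral>\<^sup>+y. ?g (x, y) \<partial>lborel) \<partial>lebesgue)"
    by (rule nn_integral_lebesgue_fst_times[OF _ g]) measurable
  also have "(\<lambda>x. \<integral>\<^sup>+y. ?g (x, y) \<partial>lborel) = (\<lambda>x. ennreal (kernel_mass TYPE('a)))"
    using nn_integral_lborel_reflect[of "\<lambda>h::'a. ennreal (min 1 (norm h) powr p * frac_kernel s p h)"]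
    by (simp add: cutoff_def kernel_mass)
  also have "(\<integral>\<^sup>+x. ennreal (f x) * ennreal (kernel_mass TYPE('a)) \<partial>lebesgue) = ennreal (kernel_mass TYPE('a)) * (\<integral>\<^sup>+x. ennreal (f x) \<partial>lebesgue)"
    by (subst nn_integral_cmult[symmetric]) (auto simp: mult.commute)
  also have "\<dots> = ennreal (kernel_mass TYPE('a) * (\<integral>x. f x \<partial>lebesgue))"
    using f f0 by (simp add: nn_integral_eq_integral ennreal_mult' kernel_mass_nonneg)
  finally have eq: "(\<integral>\<^sup>+z. ennreal (f (fst z) * cutoff z) \<partial>\<mu>) = ennreal (kernel_mass TYPE('a) * (\<integral>x. f x \<partial>lebesgue))" .
  have *: "(\<lambda>z. f (fst z) * cutoff z) \<in> borel_measurable \<mu>" by simp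
  have "0 \<le> kernel_mass TYPE('a) * (\<integral>x. f x \<partial>lebesgue)"
    using f0 kernel_mass_nonneg by (intro mult_nonneg_nonneg integral_nonneg) auto
  then show "integrable \<mu> (\<lambda>z. f (fst z) * cutoff z)"
    "(\<integral>z. f (fst z) * cutoff z \<partial>\<mu>) = kernel_mass TYPE('a) * (\<integral>x. f x \<partial>lebesgue)"
    using nn_integral_eq_integrable[OF *, of "kernel_mass TYPE('a) * (\<integral>x. f x \<partial>lebesgue)"] eq f0 by auto
qed

lemma integral_cutoff_snd:
  fixes f :: "'a::euclidean_space \<Rightarrow> real"
  assumes f: "integrable lebesgue f" and f0: "\<And>x. 0 \<le> f x"
  shows "integrable \<mu> (\<lambda>z. f (snd z) * cutoff z)"
    "(\<integral>z. f (snd z) * cutoff z \<partial>\<mu>) = kernel_mass TYPE('a) * (\<integral>x. f x \<partial>lebesgue)"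
proof -
  have [measurable]: "f \<in> borel_measurable lebesgue" using f by auto
  let ?g = "\<lambda>z::'a\<times>'a. ennreal (cutoff z * frac_kernel s p (fst z - snd z))"
  have g: "?g \<in> borel_measurable borel" by measurable
  have "(\<integral>\<^sup>+z. ennreal (f (snd z) * cutoff z) \<partial>\<mu>) = (\<integral>\<^sup>+z. ennreal (f (snd z)) * ?g z \<partial>lebesgue)"
    by (subst nn_integral_gagliardo_measure, measurable)
      (auto intro!: nn_integral_cong simp: f0 ennreal_mult mult.assoc)
  also have "\<dots> = (\<integral>\<^sup>+y. ennreal (f y) * (\<integral>\<^sup>+x. ?g (x, y) \<partial>lborel) \<partial>lebesgue)"
    by (rule nn_integral_lebesgue_snd_times[OF _ g]) measurable
  also have "(\<lambda>y. \<integral>\<^sup>+x. ?g (x, y) \<partial>lborel) = (\<lambda>y. ennreal (kernel_mass TYPE('a)))"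
    using nn_integral_lborel_translate[of "\<lambda>h::'a. ennreal (min 1 (norm h) powr p * frac_kernel s p h)"]
    by (simp add: cutoff_def kernel_mass)
  also have "(\<integral>\<^sup>+x. ennreal (f x) * ennreal (kernel_mass TYPE('a)) \<partial>lebesgue) = ennreal (kernel_mass TYPE('a)) * (\<integral>\<^sup>+x. ennreal (f x) \<partial>lebesgue)"
    by (subst nn_integral_cmult[symmetric]) (auto simp: mult.commute)
  also have "\<dots> = ennreal (kernel_mass TYPE('a) * (\<integral>x. f x \<partial>lebesgue))"
    using f f0 by (simp add: nn_integral_eq_integral ennreal_mult' kernel_mass_nonneg)
  finally have eq: "(\<integral>\<^sup>+z. ennreal (f (snd z) * cutoff z) \<partial>\<mu>) = ennreal (kernel_mass TYPE('a) * (\<integral>x. f x \<partial>lebesgue))" .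
  have *: "(\<lambda>z. f (snd z) * cutoff z) \<in> borel_measurable \<mu>" by simp
  have "0 \<le> kernel_mass TYPE('a) * (\<integral>x. f x \<partial>lebesgue)"
    using f0 kernel_mass_nonneg by (intro mult_nonneg_nonneg integral_nonneg) auto
  then show "integrable \<mu> (\<lambda>z. f (snd z) * cutoff z)"
    "(\<integral>z. f (snd z) * cutoff z \<partial>\<mu>) = kernel_mass TYPE('a) * (\<integral>x. f x \<partial>lebesgue)"
    using nn_integral_eq_integrable[OF *, of "kernel_mass TYPE('a) * (\<integral>x. f x \<partial>lebesgue)"] eq f0 by auto
qed

end

text \<open>The pairs at which a function supported in \<open>A\<close> can have a nonzero
  increment. The form of \<open>u\<close> against such a function depends on the increments of
  \<open>u\<close> on this set only.\<close>

definition strip :: "'a set \<Rightarrow> ('a \<times> 'a) set" where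
  "strip A = {z. fst z \<in> A \<or> snd z \<in> A}"

lemma strip_measurable:
  fixes A :: "'a::euclidean_space set"
  assumes "A \<in> sets lebesgue"
  shows "strip A \<in> sets lebesgue"
proof -
  have "strip A = (fst -` A \<inter> space lebesgue) \<union> (snd -` A \<inter> space lebesgue)"
    by (auto simp: strip_def)
  then show ?thesis
    using measurable_sets[OF measurable_fst_lebesgue assms] measurable_sets[OF measurable_snd_lebesgue assms]
    by (metis sets.Un)
qed

lemma Times_lebesgue_measurable:
  fixes A :: "'a::euclidean_space set" and B :: "'b::euclidean_space set"
  assumes "A \<in> sets lebesgue" "B \<in> sets lebesgue"
  shows "A \<times> B \<in> sets lebesgue"
proof -
  have "A \<times> B = (fst -` A \<inter> space lebesgue) \<inter> (snd -` B \<inter> space lebesgue)" by auto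
  then show ?thesis
    using measurable_sets[OF measurable_fst_lebesgue assms(1)] measurable_sets[OF measurable_snd_lebesgue assms(2)]
    by (metis sets.Int)
qed

lemma increment_eq_0_off_strip:
  "(\<And>x. x \<notin> A \<Longrightarrow> \<phi> x = 0) \<Longrightarrow> z \<notin> strip A \<Longrightarrow> increment \<phi> z = 0"
  by (auto simp: strip_def increment_def)

section \<open>Localization of the energy, bump functions and translations\<close>

context frac_exponents
begin

text \<open>Away from the diagonal the kernel is integrable, so for separated \<open>A\<close> and \<open>- A'\<close> only the
  energy on \<open>A' \<times> A'\<close> matters for pairs meeting \<open>A\<close>.\<close>

lemma strip_energy:
  fixes A A' :: "'a::euclidean_space set"
  assumes A: "A \<in> sets lebesgue" "A' \<in> sets lebesgue"
    and \<rho>: "0 < \<rho>" "\<And>x y. x \<in> A \<Longrightarrow> y \<notin> A' \<Longrightarrow> \<rho> \<le> dist x y"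
  obtains C where "0 \<le> C"
    "\<And>u. u \<in> borel_measurable lebesgue \<Longrightarrow> integrable lebesgue (\<lambda>x. \<bar>u x\<bar> powr p) \<Longrightarrow>
      integrable \<mu> (\<lambda>z. indicator (A' \<times> A') z * \<bar>increment u z\<bar> powr p) \<Longrightarrow>
      integrable \<mu> (\<lambda>z. indicator (strip A) z * \<bar>increment u z\<bar> powr p) \<and>
      (\<integral>z. indicator (strip A) z * \<bar>increment u z\<bar> powr p \<partial>\<mu>)
        \<le> (\<integral>z. indicator (A' \<times> A') z * \<bar>increment u z\<bar> powr p \<partial>\<mu>) + C * (\<integral>x. \<bar>u x\<bar> powr p \<partial>lebesgue)"
proof -
  \<comment> \<open>\<open>2 powr p\<close> comes from separating the two values in
    \<open>\<bar>u x - u y\<bar> powr p\<close>; the denominator is a lower bound of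
    \<open>cutoff\<close> on pairs at distance at least \<open>\<rho>\<close>.\<close>
  define c where "c = 2 powr p / min 1 \<rho> powr p"
  have c: "0 \<le> c" by (simp add: c_def)
  show thesis
  proof (rule that[of "2 * (c * kernel_mass TYPE('a))"])
    show "0 \<le> 2 * (c * kernel_mass TYPE('a))" using c kernel_mass_nonneg[where 'a='a] by simp
    fix u :: "'a \<Rightarrow> real"
    assume u[measurable]: "u \<in> borel_measurable lebesgue" and I: "integrable lebesgue (\<lambda>x. \<bar>u x\<bar> powr p)"
      and loc: "integrable \<mu> (\<lambda>z. indicator (A' \<times> A') z * \<bar>increment u z\<bar> powr p)"
    note [measurable] = strip_measurable[OF A(1)]
    let ?f = "\<lambda>x. \<bar>u x\<bar> powr p"
    let ?R = "\<lambda>z. indicator (A' \<times> A') z * \<bar>increment u z\<bar> powr p + (c * (?f (fst z) * cutoff z) + c * (?f (snd z) * cutoff z))"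
    note f = integral_cutoff_fst[OF I] and g = integral_cutoff_snd[OF I]
    have f1: "integrable \<mu> (\<lambda>z. c * (?f (fst z) * cutoff z))"
      and g1: "integrable \<mu> (\<lambda>z. c * (?f (snd z) * cutoff z))"
      using f(1) g(1) by auto
    have R: "integrable \<mu> ?R"
      using loc f1 g1 by (intro Bochner_Integration.integrable_add)
    have le: "indicator (strip A) z * \<bar>increment u z\<bar> powr p \<le> ?R z" for z
    proof (cases "z \<in> strip A \<and> z \<notin> A' \<times> A'")
      case True
      \<comment> \<open>The instances with equal points express \<open>A \<subseteq> A'\<close>,
        since \<open>\<rho>\<close> is positive. The pair therefore has one point in
        \<open>A\<close> and the other outside \<open>A'\<close>.\<close>
      then have "\<rho> \<le> dist (fst z) (snd z)"
        using \<rho>(2)[of "fst z" "snd z"] \<rho>(2)[of "snd z" "fst z"] \<rho>(2)[of "fst z" "fst z"] \<rho>(2)[of "snd z" "snd z"] \<rho>(1)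
        by (auto simp: strip_def dist_commute mem_Times_iff)
      then have "min 1 \<rho> powr p \<le> cutoff z"
        unfolding cutoff_def dist_norm[symmetric] using \<rho>(1) p_pos by (intro powr_mono2) auto
      then have "2 powr p \<le> c * cutoff z"
        using \<rho>(1) by (simp add: c_def field_simps)
      then have "2 powr p * (?f (fst z) + ?f (snd z)) \<le> c * cutoff z * (?f (fst z) + ?f (snd z))"
        by (intro mult_right_mono) auto
      moreover have "\<bar>increment u z\<bar> powr p \<le> 2 powr p * (?f (fst z) + ?f (snd z))"
        using abs_add_powr_le[OF p_pos, of "u (fst z)" "- u (snd z)"] by (simp add: increment_def)
      ultimately show ?thesis using True by (simp add: algebra_simps)
    next
      case False
      have "0 \<le> c * (?f (fst z) * cutoff z)" "0 \<le> c * (?f (snd z) * cutoff z)" using c by auto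
      moreover have "indicator (strip A) z * \<bar>increment u z\<bar> powr p \<le> indicator (A' \<times> A') z * \<bar>increment u z\<bar> powr p"
        using False by (auto simp: indicator_def)
      ultimately show ?thesis by linarith
    qed
    have i: "integrable \<mu> (\<lambda>z. indicator (strip A) z * \<bar>increment u z\<bar> powr p)"
      by (rule Bochner_Integration.integrable_bound[OF R]) (use le in \<open>auto intro!: order_trans[OF _ abs_ge_self]\<close>)
    have "(\<integral>z. indicator (strip A) z * \<bar>increment u z\<bar> powr p \<partial>\<mu>) \<le> (\<integral>z. ?R z \<partial>\<mu>)"
      by (rule integral_mono[OF i R le])
    also have "\<dots> = (\<integral>z. indicator (A' \<times> A') z * \<bar>increment u z\<bar> powr p \<partial>\<mu>) +
        2 * (c * kernel_mass TYPE('a)) * (\<integral>x. \<bar>u x\<bar> powr p \<partial>lebesgue)"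
      using f(2) g(2) by (simp add: Bochner_Integration.integral_add[OF loc Bochner_Integration.integrable_add[OF f1 g1]]
          Bochner_Integration.integral_add[OF f1 g1])
    finally show "integrable \<mu> (\<lambda>z. indicator (strip A) z * \<bar>increment u z\<bar> powr p) \<and>
      (\<integral>z. indicator (strip A) z * \<bar>increment u z\<bar> powr p \<partial>\<mu>)
        \<le> (\<integral>z. indicator (A' \<times> A') z * \<bar>increment u z\<bar> powr p \<partial>\<mu>) + 2 * (c * kernel_mass TYPE('a)) * (\<integral>x. \<bar>u x\<bar> powr p \<partial>lebesgue)"
      using i by simp
  qed
qed

text \<open>All increments of a function supported in \<open>A\<close> lie over
  \<open>strip A\<close>, so local energy on a slightly larger set decides membership. Through this,
  comparison functions built from an arbitrary weak solution, whose energy is only locally finite,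
  become test functions.\<close>

lemma frac_sobolev_zero_localI:
  fixes A A' :: "'a::euclidean_space set"
  assumes A: "A \<in> sets lebesgue" "A' \<in> sets lebesgue"
    and \<rho>: "0 < \<rho>" "\<And>x y. x \<in> A \<Longrightarrow> y \<notin> A' \<Longrightarrow> \<rho> \<le> dist x y"
    and u: "u \<in> borel_measurable lebesgue" "integrable lebesgue (\<lambda>x. \<bar>u x\<bar> powr p)"
    and loc: "integrable \<mu> (\<lambda>z. indicator (A' \<times> A') z * \<bar>increment u z\<bar> powr p)"
    and off: "\<And>x. x \<notin> A \<Longrightarrow> u x = 0"
  shows "u \<in> \<W> A"
proof -
  have "integrable \<mu> (\<lambda>z. indicator (strip A) z * \<bar>increment u z\<bar> powr p)"
    using strip_energy[OF A \<rho>, where thesis="integrable \<mu> (\<lambda>z. indicator (strip A) z * \<bar>increment u z\<bar> powr p)"] u loc by blast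
  also have "(\<lambda>z. indicator (strip A) z * \<bar>increment u z\<bar> powr p) = (\<lambda>z. \<bar>increment u z\<bar> powr p)"
    using increment_eq_0_off_strip[of A u] off by (auto simp: indicator_def fun_eq_iff)
  finally show ?thesis using u off by (simp add: frac_sobolev_zero_iff)
qed

text \<open>The truncated distance \<open>max 0 (r - dist x0 x)\<close> is bounded by
  \<open>r\<close> and has Lipschitz constant \<open>1\<close>; the factor \<open>max 1 r\<close>
  covers both bounds, so its increments are dominated by \<open>cutoff\<close> on pairs meeting the
  ball.\<close>

lemma ex_bump:
  fixes x0 :: "'a::euclidean_space"
  assumes r: "0 < r"
  obtains \<phi> where "\<phi> \<in> \<W> (ball x0 r)" "\<And>x. 0 \<le> \<phi> x" "\<And>x. x \<in> ball x0 r \<Longrightarrow> 0 < \<phi> x"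
proof -
  define \<phi> where "\<phi> = (\<lambda>x. max 0 (r - dist x0 x))"
  let ?B = "ball x0 r"
  have [measurable]: "\<phi> \<in> borel_measurable lebesgue"
    unfolding \<phi>_def by (intro borel_imp_lebesgue_measurable borel_measurable_continuous_onI continuous_intros)
  have \<phi>0: "0 \<le> \<phi> x" "\<phi> x \<le> r" "x \<notin> ?B \<Longrightarrow> \<phi> x = 0" for x
    using r zero_le_dist[of x0 x] unfolding \<phi>_def by (auto simp: max_def)
  have lip: "\<bar>\<phi> x - \<phi> y\<bar> \<le> norm (x - y)" for x y
  proof -
    have "\<bar>\<phi> x - \<phi> y\<bar> \<le> \<bar>dist x0 x - dist x0 y\<bar>" unfolding \<phi>_def by linarith
    also have "\<dots> \<le> dist x y" by (metis abs_dist_diff_le dist_commute)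
    finally show ?thesis by (simp add: dist_norm)
  qed
  have iB: "integrable lebesgue (indicator ?B :: 'a \<Rightarrow> real)"
    by (rule integrable_real_indicator) (use emeasure_lborel_ball_finite[of x0 r] in auto)
  have 1: "integrable lebesgue (\<lambda>x. \<bar>\<phi> x\<bar> powr p)"
  proof (rule Bochner_Integration.integrable_bound[OF integrable_mult_right[OF iB, of "r powr p"]])
    show "AE x in lebesgue. norm (\<bar>\<phi> x\<bar> powr p) \<le> norm (r powr p * indicator ?B x)"
      using \<phi>0 p_pos by (intro AE_I2) (auto simp: indicator_def intro!: powr_mono2)
  qed measurable
  let ?R = "\<lambda>z. max 1 r powr p * (indicator ?B (fst z) * cutoff z + indicator ?B (snd z) * cutoff z)"
  have R: "integrable \<mu> ?R"
    using integral_cutoff_fst(1)[OF iB] integral_cutoff_snd(1)[OF iB] by auto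
  have le: "\<bar>increment \<phi> z\<bar> powr p \<le> ?R z" for z
  proof (cases "z \<in> strip ?B")
    case True
    have "\<bar>increment \<phi> z\<bar> \<le> r"
      using \<phi>0(1,2)[of "fst z"] \<phi>0(1,2)[of "snd z"] unfolding increment_def by linarith
    then have "\<bar>increment \<phi> z\<bar> \<le> max 1 r * min 1 (norm (fst z - snd z))"
      using lip[of "fst z" "snd z"] r mult_right_mono[of 1 "max 1 r" "norm (fst z - snd z)"]
      unfolding increment_def by (auto simp: min_def)
    then have "\<bar>increment \<phi> z\<bar> powr p \<le> (max 1 r * min 1 (norm (fst z - snd z))) powr p"
      using p_pos by (intro powr_mono2) auto
    also have "\<dots> = max 1 r powr p * (1 * cutoff z)" by (simp add: cutoff_def powr_mult)
    also have "\<dots> \<le> max 1 r powr p * ((indicator ?B (fst z) + indicator ?B (snd z)) * cutoff z)"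
      using True by (intro mult_left_mono mult_right_mono) (auto simp: strip_def indicator_def)
    finally show ?thesis by (simp add: distrib_right)
  next
    case False
    then show ?thesis
      using increment_eq_0_off_strip[of ?B \<phi>] \<phi>0(3) by (auto intro!: mult_nonneg_nonneg add_nonneg_nonneg)
  qed
  have 2: "integrable \<mu> (\<lambda>z. \<bar>increment \<phi> z\<bar> powr p)"
    by (rule Bochner_Integration.integrable_bound[OF R]) (use le in \<open>auto intro!: order_trans[OF _ abs_ge_self]\<close>)
  have "\<phi> \<in> \<W> ?B"
    using 1 2 \<phi>0(3) by (simp add: frac_sobolev_zero_iff)
  moreover have "0 < \<phi> x" if "x \<in> ?B" for x using that by (simp add: \<phi>_def)
  ultimately show thesis using that \<phi>0(1) by blast
qed

text \<open>The kernel depends on the difference of the two points only, so shifting both by the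
  same vector preserves the measure.\<close>

lemma gagliardo_measure_translate:
  fixes F :: "'a::euclidean_space \<times> 'a \<Rightarrow> real"
  assumes F[measurable]: "F \<in> borel_measurable lebesgue"
  shows "integrable \<mu> (\<lambda>z. F ((a, a) + z)) \<longleftrightarrow> integrable \<mu> F"
    "(\<integral>z. F ((a, a) + z) \<partial>\<mu>) = (\<integral>z. F z \<partial>\<mu>)"
proof -
  have F'[measurable]: "(\<lambda>z. F ((a, a) + z)) \<in> borel_measurable lebesgue"
    by (rule measurable_compose[OF measurable_plus_lebesgue F])
  let ?G = "\<lambda>z. frac_kernel s p (fst z - snd z) * F z"
  have G: "?G \<in> borel_measurable lebesgue" by measurable
  have eq: "?G ((a, a) + z) = frac_kernel s p (fst z - snd z) * F ((a, a) + z)" for z by simp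
  show "integrable \<mu> (\<lambda>z. F ((a, a) + z)) \<longleftrightarrow> integrable \<mu> F"
    using integrable_lebesgue_translate[OF G, of "(a, a)"] unfolding eq
    by (simp add: integrable_gagliardo_measure)
  show "(\<integral>z. F ((a, a) + z) \<partial>\<mu>) = (\<integral>z. F z \<partial>\<mu>)"
    using integral_lebesgue_translate[OF G, of "(a, a)"] unfolding eq
    by (simp add: integral_gagliardo_measure)
qed

lemma frac_sobolev_zero_translate:
  fixes u :: "'a::euclidean_space \<Rightarrow> real"
  assumes u: "u \<in> \<W> A" and B: "\<And>x. a + x \<in> A \<Longrightarrow> x \<in> B"
  shows "(\<lambda>x. u (a + x)) \<in> \<W> B"
proof -
  note u' = frac_sobolev_zeroD[OF u]
  note [measurable] = u'(1)
  have inc: "increment (\<lambda>x. u (a + x)) z = increment u ((a, a) + z)" for z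
    by (simp add: increment_def)
  have "(\<lambda>x. u (a + x)) \<in> borel_measurable lebesgue"
    by (rule measurable_compose[OF measurable_plus_lebesgue u'(1)])
  moreover have "integrable lebesgue (\<lambda>x. \<bar>u (a + x)\<bar> powr p)"
    using u'(2) by (subst integrable_lebesgue_translate[of "\<lambda>x. \<bar>u x\<bar> powr p"]) auto
  moreover have "integrable \<mu> (\<lambda>z. \<bar>increment (\<lambda>x. u (a + x)) z\<bar> powr p)"
    unfolding inc using u'(3) by (subst gagliardo_measure_translate(1)[of "\<lambda>z. \<bar>increment u z\<bar> powr p"]) auto
  moreover have "AE x in lebesgue. x \<notin> B \<longrightarrow> u (a + x) = 0"
    using AE_lebesgue_translate[OF u'(4), of a] by eventually_elim (use B in auto)
  ultimately show ?thesis by (simp add: frac_sobolev_zero_iff)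
qed

end

section \<open>Hardy and Poincare inequalities\<close>

text \<open>A Lipschitz boundary is uniformly accessible from outside: the exterior cone at a boundary
  point contains balls of radius proportional to their distance from the vertex.\<close>

lemma lipschitz_boundary_exterior_ball:
  fixes \<Omega> :: "'a::euclidean_space set"
  assumes "bounded_lipschitz_domain \<Omega>"
  obtains c \<rho>0 where "0 < c" "c \<le> 1" "0 < \<rho>0"
    "\<And>x \<rho>. x \<in> frontier \<Omega> \<Longrightarrow> 0 < \<rho> \<Longrightarrow> \<rho> \<le> \<rho>0 \<Longrightarrow> \<exists>z. dist x z = \<rho> \<and> ball z (c * \<rho>) \<inter> \<Omega> = {}"
proof -
  have op: "open \<Omega>" and bd: "bounded \<Omega>" and lip: "lipschitz_boundary \<Omega>"
    using assms by (auto simp: bounded_lipschitz_domain_def)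
  have "\<exists>r>0. \<exists>c>0. c \<le> 1 \<and> (\<forall>x\<in>frontier \<Omega> \<inter> ball x0 r. \<forall>\<rho>. 0 < \<rho> \<and> \<rho> \<le> r / 2 \<longrightarrow> (\<exists>z. dist x z = \<rho> \<and> ball z (c * \<rho>) \<inter> \<Omega> = {}))"
    if x0: "x0 \<in> frontier \<Omega>" for x0
  proof -
    obtain R e g L where R: "0 < R" and e: "norm e = 1" and g: "L-lipschitz_on {y. y \<bullet> e = 0} g"
      and chart: "\<Omega> \<inter> ball x0 R = {x \<in> ball x0 R. g ((x - x0) - ((x - x0) \<bullet> e) *\<^sub>R e) < (x - x0) \<bullet> e}"
      using bspec[OF lip[unfolded lipschitz_boundary_def] x0] by (elim exE conjE) (rule that)
    define \<pi> where "\<pi> = (\<lambda>x. x - (x \<bullet> e) *\<^sub>R e)"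
    have ee: "e \<bullet> e = 1" using e by (simp add: norm_eq_1)
    have \<pi>_perp: "\<pi> x \<bullet> e = 0" for x by (simp add: \<pi>_def inner_diff_left ee)
    have L: "0 \<le> L" using g by (rule lipschitz_on_nonneg)
    have chart': "x \<in> \<Omega> \<longleftrightarrow> g (\<pi> (x - x0)) < (x - x0) \<bullet> e" if "x \<in> ball x0 R" for x
      using chart that unfolding \<pi>_def by blast
    \<comment> \<open>A displacement \<open>w\<close> changes the height along \<open>e\<close> by
      at most \<open>norm w\<close> and the value of \<open>g\<close> by at most
      \<open>L * norm w\<close>. To reach \<open>\<Omega>\<close> from depth \<open>\<rho>\<close>
      below a boundary point, \<open>norm w\<close> must be at least
      \<open>c * \<rho>\<close>.\<close>
    define c where "c = 1 / (1 + L)"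
    have c: "0 < c" "c \<le> 1" "c * (1 + L) = 1" using L by (auto simp: c_def)
    \<comment> \<open>The centre is \<open>x - \<rho> *\<^sub>R e\<close>. Points \<open>y\<close>
      of the ball satisfy \<open>dist x y < 2 * \<rho>\<close>, so with \<open>x\<close> within
      \<open>R / 3\<close> of \<open>x0\<close> and \<open>\<rho> \<le> R / 6\<close> they stay
      inside the chart.\<close>
    have "\<exists>z. dist x z = \<rho> \<and> ball z (c * \<rho>) \<inter> \<Omega> = {}"
      if x: "x \<in> frontier \<Omega>" "x \<in> ball x0 (R / 3)" and \<rho>: "0 < \<rho>" "\<rho> \<le> R / 3 / 2" for x \<rho>
    proof (intro exI conjI)
      show "dist x (x - \<rho> *\<^sub>R e) = \<rho>" using \<rho> e by (simp add: dist_norm)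
      have xn: "x \<notin> \<Omega>" using x(1) op by (simp add: frontier_def interior_open)
      have xR: "x \<in> ball x0 R" using x(2) R by auto
      show "ball (x - \<rho> *\<^sub>R e) (c * \<rho>) \<inter> \<Omega> = {}"
      proof (rule ccontr)
        assume "ball (x - \<rho> *\<^sub>R e) (c * \<rho>) \<inter> \<Omega> \<noteq> {}"
        then obtain y where y: "y \<in> \<Omega>" "dist (x - \<rho> *\<^sub>R e) y < c * \<rho>" by auto
        define w where "w = y - (x - \<rho> *\<^sub>R e)"
        have w: "norm w < c * \<rho>" using y(2) by (simp add: w_def dist_norm norm_minus_commute)
        have yx: "y - x = w - \<rho> *\<^sub>R e" by (simp add: w_def)
        have "c * \<rho> \<le> \<rho>" using c \<rho> by simp
        moreover have "norm (y - x) \<le> norm w + \<rho>"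
          using norm_triangle_ineq4[of w "\<rho> *\<^sub>R e"] e \<rho> unfolding yx by simp
        ultimately have "norm (y - x) < 2 * \<rho>" using w by linarith
        then have "y \<in> ball x0 R"
          using x(2) \<rho> dist_triangle[of x0 y x] by (auto simp: dist_norm norm_minus_commute)
        then have gy: "g (\<pi> (y - x0)) < (y - x0) \<bullet> e" using chart' y(1) by blast
        have gx: "(x - x0) \<bullet> e \<le> g (\<pi> (x - x0))" using chart'[OF xR] xn by simp
        have "\<pi> (y - x0) - \<pi> (x - x0) = \<pi> w"
          by (simp add: \<pi>_def w_def inner_diff_left inner_add_left ee scaleR_left_diff_distrib scaleR_left_distrib)
        then have "dist (\<pi> (y - x0)) (\<pi> (x - x0)) = norm (\<pi> w)" by (simp add: dist_norm)
        also have "\<dots> \<le> norm w"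
        proof -
          have "norm w ^ 2 = norm (\<pi> w) ^ 2 + (w \<bullet> e) ^ 2"
            using norm_add_Pythagorean[of "\<pi> w" "(w \<bullet> e) *\<^sub>R e"] \<pi>_perp[of w] e
            by (simp add: orthogonal_def \<pi>_def)
          then have "norm (\<pi> w) ^ 2 \<le> norm w ^ 2" by (metis le_add_same_cancel1 zero_le_power2)
          then show ?thesis by (rule power2_le_imp_le) (rule norm_ge_zero)
        qed
        finally have "dist (g (\<pi> (y - x0))) (g (\<pi> (x - x0))) \<le> L * norm w"
          using lipschitz_onD[OF g, of "\<pi> (y - x0)" "\<pi> (x - x0)"] \<pi>_perp L
          by (smt (verit) mem_Collect_eq mult_left_mono)
        then have "g (\<pi> (x - x0)) - L * norm w \<le> g (\<pi> (y - x0))" by (simp add: dist_real_def)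
        moreover have "(y - x0) \<bullet> e = (x - x0) \<bullet> e + w \<bullet> e - \<rho>"
          by (simp add: w_def inner_diff_left inner_add_left ee)
        moreover have "w \<bullet> e \<le> norm w" using norm_cauchy_schwarz[of w e] e by simp
        ultimately have "\<rho> < (1 + L) * norm w" using gx gy by (simp add: algebra_simps)
        also have "\<dots> \<le> (1 + L) * (c * \<rho>)" using w L by (intro mult_left_mono) auto
        also have "\<dots> = (c * (1 + L)) * \<rho>" by (simp only: ac_simps)
        also have "\<dots> = \<rho>" unfolding c(3) by simp
        finally show False by simp
      qed
    qed
    then show ?thesis using R c by (intro exI[of _ "R / 3"] conjI exI[of _ c]) auto
  qed
  then obtain r c where rc: "\<And>x0. x0 \<in> frontier \<Omega> \<Longrightarrow> 0 < r x0 \<and> 0 < c x0 \<and> c x0 \<le> 1 \<and>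
     (\<forall>x\<in>frontier \<Omega> \<inter> ball x0 (r x0). \<forall>\<rho>. 0 < \<rho> \<and> \<rho> \<le> r x0 / 2 \<longrightarrow> (\<exists>z. dist x z = \<rho> \<and> ball z (c x0 * \<rho>) \<inter> \<Omega> = {}))"
    by metis
  have "compact (frontier \<Omega>)" using bd by (rule compact_frontier_bounded)
  then obtain T where T: "T \<subseteq> frontier \<Omega>" "finite T" "frontier \<Omega> \<subseteq> (\<Union>t\<in>T. ball t (r t))"
  proof (rule compactE_image[of _ "frontier \<Omega>" "\<lambda>t. ball t (r t)"])
    show "frontier \<Omega> \<subseteq> (\<Union>t\<in>frontier \<Omega>. ball t (r t))" using rc by force
  qed auto
  \<comment> \<open>Compactness of the boundary makes the constants uniform. The inserted
    \<open>1\<close> keeps the sets under \<open>Min\<close> nonempty and caps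
    \<open>c0\<close>.\<close>
  define c0 where "c0 = Min (insert 1 (c ` T))"
  define \<rho>0 where "\<rho>0 = Min (insert 1 ((\<lambda>t. r t / 2) ` T))"
  have "0 < c0" "c0 \<le> 1" "0 < \<rho>0" using T rc by (auto simp: c0_def \<rho>0_def)
  moreover have "\<exists>z. dist x z = \<rho> \<and> ball z (c0 * \<rho>) \<inter> \<Omega> = {}" if x: "x \<in> frontier \<Omega>" and \<rho>: "0 < \<rho>" "\<rho> \<le> \<rho>0" for x \<rho>
  proof -
    obtain t where t: "t \<in> T" "x \<in> ball t (r t)" using T x by blast
    have "\<rho>0 \<le> r t / 2" "c0 \<le> c t"
      unfolding \<rho>0_def c0_def by (rule Min_le; use t T in simp)+
    moreover have "\<forall>x\<in>frontier \<Omega> \<inter> ball t (r t). \<forall>\<rho>. 0 < \<rho> \<and> \<rho> \<le> r t / 2 \<longrightarrow> (\<exists>z. dist x z = \<rho> \<and> ball z (c t * \<rho>) \<inter> \<Omega> = {})"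
      using rc[of t] t(1) T(1) by blast
    ultimately obtain z where z: "dist x z = \<rho>" "ball z (c t * \<rho>) \<inter> \<Omega> = {}"
      using t(2) x \<rho> by (meson IntI order_trans)
    moreover have "ball z (c0 * \<rho>) \<subseteq> ball z (c t * \<rho>)"
      using \<open>c0 \<le> c t\<close> \<rho> by (intro subset_ball mult_right_mono) auto
    ultimately show ?thesis by (intro exI[of _ z]) auto
  qed
  ultimately show thesis by (rule that)
qed

locale frac_domain = frac_exponents +
  fixes \<Omega> :: "'a::euclidean_space set"
  assumes domain: "bounded_lipschitz_domain \<Omega>"
begin

lemma open_domain: "open \<Omega>" and bounded_domain: "bounded \<Omega>" and domain_nonempty: "\<Omega> \<noteq> {}"
  using domain by (auto simp: bounded_lipschitz_domain_def)

text \<open>A bounded nonempty set is not the whole space, hence not open and closed at once. Since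
  \<open>infdist\<close> to the empty set is \<open>0\<close>, positivity of \<open>d\<close> inside
  \<Omega> rests on this.\<close>

lemma frontier_nonempty: "frontier \<Omega> \<noteq> {}"
  using bounded_domain domain_nonempty not_bounded_UNIV by (auto simp: frontier_eq_empty)

lemma domain_measurable [measurable]: "\<Omega> \<in> sets lebesgue"
  using open_domain by auto

definition d :: "'a \<Rightarrow> real" where
  "d x = infdist x (frontier \<Omega>)"

lemma d_nonneg [simp]: "0 \<le> d x"
  by (simp add: d_def infdist_nonneg)

lemma d_pos: "x \<in> \<Omega> \<Longrightarrow> 0 < d x"
  using open_domain frontier_nonempty in_closed_iff_infdist_zero[OF frontier_closed frontier_nonempty, of x] d_nonneg[of x]
  unfolding d_def by (auto simp: frontier_def interior_open less_le)

lemma continuous_on_d: "continuous_on S d"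
  unfolding d_def by (intro continuous_intros)

lemma d_measurable [measurable]: "d \<in> borel_measurable borel"
  using continuous_on_d by (rule borel_measurable_continuous_onI)

lemma d_measurable_lebesgue [measurable]: "d \<in> borel_measurable lebesgue"
  by (rule borel_imp_lebesgue_measurable) measurable

lemma d_bound: obtains D where "1 \<le> D" "\<And>x. x \<in> \<Omega> \<Longrightarrow> d x \<le> D"
proof -
  obtain a where a: "a \<in> frontier \<Omega>" using frontier_nonempty by blast
  obtain B where B: "\<And>x. x \<in> \<Omega> \<Longrightarrow> dist a x \<le> B"
    using bounded_domain bounded_any_center[of \<Omega> a] by blast
  have "d x \<le> max 1 B" if "x \<in> \<Omega>" for x
    using infdist_le[OF a, of x] B[OF that] by (simp add: d_def dist_commute)
  then show thesis using that[of "max 1 B"] by simp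
qed

text \<open>At the scale \<open>t = d x\<close> the complement contains a ball of radius comparable
  to \<open>t\<close> at distance at most \<open>3 * t\<close>. The kernel there is at least of
  order \<open>t powr - (N + s * p)\<close>, and the volume is of order
  \<open>t powr N\<close>.\<close>

lemma kernel_mass_outside:
  obtains c where "0 < c"
    "\<And>x. x \<in> \<Omega> \<Longrightarrow> ennreal (c * d x powr - (s * p)) \<le> (\<integral>\<^sup>+y. ennreal (indicator (- \<Omega>) y * frac_kernel s p (x - y)) \<partial>lborel)"
proof -
  obtain c \<rho>0 where c: "0 < c" "c \<le> 1" "0 < \<rho>0"
    "\<And>x \<rho>. x \<in> frontier \<Omega> \<Longrightarrow> 0 < \<rho> \<Longrightarrow> \<rho> \<le> \<rho>0 \<Longrightarrow> \<exists>z. dist x z = \<rho> \<and> ball z (c * \<rho>) \<inter> \<Omega> = {}"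
    using lipschitz_boundary_exterior_ball[OF domain] by blast
  obtain D where D: "1 \<le> D" "\<And>x. x \<in> \<Omega> \<Longrightarrow> d x \<le> D" using d_bound by blast
  \<comment> \<open>Exterior balls are provided up to scale \<open>\<rho>0\<close> only; the factor
    \<open>b\<close> brings every \<open>t \<le> D\<close> into this range.\<close>
  define b where "b = min 1 (\<rho>0 / D)"
  have b: "0 < b" "b \<le> 1" "b * D \<le> \<rho>0" using c D(1) by (auto simp: b_def min_def field_simps)
  define N where "N = real DIM('a)"
  define V where "V = measure lborel (ball (0::'a) 1)"
  have V: "0 < V" unfolding V_def using content_ball_pos[of 1 "0::'a"] by simp
  define C where "C = V * (c * b) powr N / 3 powr (N + s * p)"
  have "0 < C" using V c b by (simp add: C_def)
  moreover have "ennreal (C * d x powr - (s * p)) \<le> (\<integral>\<^sup>+y. ennreal (indicator (- \<Omega>) y * frac_kernel s p (x - y)) \<partial>lborel)"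
    if x: "x \<in> \<Omega>" for x
  proof -
    define t where "t = d x"
    have t: "0 < t" "t \<le> D" using d_pos D(2) x by (auto simp: t_def)
    obtain x1 where x1: "x1 \<in> frontier \<Omega>" "d x = dist x x1"
      using infdist_attains_inf[OF frontier_closed frontier_nonempty, of x] unfolding d_def by blast
    have "b * t \<le> \<rho>0" using b t by (meson mult_left_mono order_trans less_imp_le)
    moreover have "0 < b * t" using b t by simp
    ultimately obtain z where z: "dist x1 z = b * t" "ball z (c * (b * t)) \<inter> \<Omega> = {}"
      using c(4)[OF x1(1), of "b * t"] by blast
    have bt: "b * t \<le> t" "c * (b * t) \<le> t"
      using b t c mult_right_mono[of b 1 t] mult_mono[of c 1 "b * t" t] by auto
    \<comment> \<open>At most \<open>t\<close> for each of the three segments: to the nearest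
      boundary point, from there to the centre \<open>z\<close>, and within the ball.\<close>
    have near: "norm (x - y) \<le> 3 * t" if "y \<in> ball z (c * (b * t))" for y
    proof -
      have "norm (x - y) \<le> dist x x1 + dist x1 z + dist z y"
        using dist_triangle[of x y x1] dist_triangle[of x1 y z] by (simp add: dist_norm)
      then show ?thesis using that z bt x1 by (simp add: t_def)
    qed
    have k: "1 / (3 * t) powr (N + s * p) \<le> frac_kernel s p (x - y)" if "y \<in> ball z (c * (b * t))" for y
    proof -
      have "y \<noteq> x" using that z(2) x by blast
      then show ?thesis
        unfolding frac_kernel_def N_def[symmetric] using near[OF that] sp_pos
        by (intro divide_left_mono powr_mono2) (auto simp: N_def t(1) mult_pos_pos less_imp_neq[OF t(1), symmetric])
    qed
    have "C * d x powr - (s * p) = 1 / (3 * t) powr (N + s * p) * ((c * (b * t)) powr N * V)"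
    proof -
      have "(3 * t) powr (N + s * p) = 3 powr (N + s * p) * (t powr N * t powr (s * p))"
        by (simp add: powr_mult powr_add mult_ac)
      moreover have "(c * (b * t)) powr N = (c * b) powr N * t powr N" by (simp add: powr_mult)
      moreover have "t powr N \<noteq> 0" using t by simp
      ultimately show ?thesis
        unfolding C_def t_def[symmetric] powr_minus_divide by (simp add: field_simps)
    qed
    also have "ennreal \<dots> = ennreal (1 / (3 * t) powr (N + s * p)) * emeasure lborel (ball z (c * (b * t)))"
    proof -
      have "emeasure lborel (ball z (c * (b * t))) = ennreal ((c * (b * t)) powr N * V)"
        using content_ball_conv_unit_ball[of "c * (b * t)" z] emeasure_lborel_ball_finite[of z "c * (b * t)"] c b t
        by (simp add: V_def emeasure_eq_ennreal_measure N_def powr_realpow)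
      then show ?thesis using V by (simp only:) (subst ennreal_mult[symmetric], auto)
    qed
    also have "\<dots> = (\<integral>\<^sup>+y. ennreal (1 / (3 * t) powr (N + s * p)) * indicator (ball z (c * (b * t))) y \<partial>lborel)"
      by (simp add: nn_integral_cmult_indicator)
    also have "\<dots> \<le> (\<integral>\<^sup>+y. ennreal (indicator (- \<Omega>) y * frac_kernel s p (x - y)) \<partial>lborel)"
    proof (rule nn_integral_mono)
      fix y show "ennreal (1 / (3 * t) powr (N + s * p)) * indicator (ball z (c * (b * t))) y \<le> ennreal (indicator (- \<Omega>) y * frac_kernel s p (x - y))"
      proof (cases "y \<in> ball z (c * (b * t))")
        case True
        then have "y \<notin> \<Omega>" using z(2) by blast
        then show ?thesis using True k[OF True] by (simp add: ennreal_leI)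
      qed simp
    qed
    finally show ?thesis .
  qed
  ultimately show thesis by (rule that)
qed

text \<open>Hardy's inequality needs no condition on \<open>s * p\<close> here, since the seminorm also sees the pairs
  with one point outside the domain, where the function vanishes.\<close>

lemma Hardy:
  obtains H where "0 < H"
    "\<And>u. u \<in> \<W> \<Omega> \<Longrightarrow>
       integrable lebesgue (\<lambda>x. indicator \<Omega> x * (\<bar>u x\<bar> powr p * d x powr - (s * p))) \<and>
       (\<integral>x. indicator \<Omega> x * (\<bar>u x\<bar> powr p * d x powr - (s * p)) \<partial>lebesgue) \<le> H * \<E> u"
proof -
  obtain c where c: "0 < c"
    "\<And>x. x \<in> \<Omega> \<Longrightarrow> ennreal (c * d x powr - (s * p)) \<le> (\<integral>\<^sup>+y. ennreal (indicator (- \<Omega>) y * frac_kernel s p (x - y)) \<partial>lborel)"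
    using kernel_mass_outside by blast
  have "integrable lebesgue (\<lambda>x. indicator \<Omega> x * (\<bar>u x\<bar> powr p * d x powr - (s * p))) \<and>
       (\<integral>x. indicator \<Omega> x * (\<bar>u x\<bar> powr p * d x powr - (s * p)) \<partial>lebesgue) \<le> 1 / c * \<E> u"
    if u: "u \<in> \<W> \<Omega>" for u
  proof -
    note u' = frac_sobolev_zeroD[OF u]
    note [measurable] = u'(1)
    let ?h = "\<lambda>x. indicator \<Omega> x * (\<bar>u x\<bar> powr p * d x powr - (s * p))"
    let ?f = "\<lambda>x. ennreal (indicator \<Omega> x * \<bar>u x\<bar> powr p)"
    let ?g = "\<lambda>z::'a\<times>'a. ennreal (indicator (- \<Omega>) (snd z) * frac_kernel s p (fst z - snd z))"
    have "- \<Omega> \<in> sets borel" using open_domain by auto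
    then have "(\<lambda>z::'a\<times>'a. indicator (- \<Omega>) (snd z) :: real) \<in> borel_measurable borel"
      using measurable_compose[of snd borel borel "indicator (- \<Omega>) :: 'a \<Rightarrow> real" borel]
        borel_measurable_continuous_onI[of "snd :: 'a\<times>'a \<Rightarrow> 'a"] by (auto simp: continuous_on_snd)
    then have g: "?g \<in> borel_measurable borel" by measurable
    have "ennreal c * (\<integral>\<^sup>+x. ennreal (?h x) \<partial>lebesgue) = (\<integral>\<^sup>+x. ?f x * ennreal (c * d x powr - (s * p)) \<partial>lebesgue)"
      using c(1) by (subst nn_integral_cmult[symmetric])
        (auto intro!: nn_integral_cong simp: mult_ac simp flip: ennreal_mult')
    also have "\<dots> \<le> (\<integral>\<^sup>+x. ?f x * (\<integral>\<^sup>+y. ?g (x, y) \<partial>lborel) \<partial>lebesgue)"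
      by (intro nn_integral_mono) (use c(2) in \<open>auto simp: indicator_def intro!: mult_left_mono\<close>)
    also have "\<dots> = (\<integral>\<^sup>+z. ?f (fst z) * ?g z \<partial>lebesgue)"
      by (rule nn_integral_lebesgue_fst_times[OF _ g, symmetric]) measurable
    also have "\<dots> \<le> (\<integral>\<^sup>+z. ennreal (\<bar>increment u z\<bar> powr p) * ennreal (frac_kernel s p (fst z - snd z)) \<partial>lebesgue)"
    proof (rule nn_integral_mono_AE)
      show "AE z in lebesgue. ?f (fst z) * ?g z \<le> ennreal (\<bar>increment u z\<bar> powr p) * ennreal (frac_kernel s p (fst z - snd z))"
        using AE_lebesgue_snd[OF u'(4), where 'a='a]
        by eventually_elim (auto simp: indicator_def increment_def)
    qed
    also have "\<dots> = (\<integral>\<^sup>+z. ennreal (\<bar>increment u z\<bar> powr p) \<partial>\<mu>)"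
      by (subst nn_integral_gagliardo_measure) auto
    also have "\<dots> = ennreal (\<E> u)"
      using u'(3) by (simp add: nn_integral_eq_integral seminorm_powr_def)
    finally have le: "ennreal c * (\<integral>\<^sup>+x. ennreal (?h x) \<partial>lebesgue) \<le> ennreal (\<E> u)" .
    have fin: "(\<integral>\<^sup>+x. ennreal (?h x) \<partial>lebesgue) < \<infinity>"
    proof (rule ccontr)
      assume "\<not> ?thesis"
      then have "(\<integral>\<^sup>+x. ennreal (?h x) \<partial>lebesgue) = \<infinity>" by (simp add: less_top[symmetric])
      then show False using le c(1) by (simp add: ennreal_mult_top top_unique)
    qed
    have i: "integrable lebesgue ?h"
      by (rule integrableI_nonneg[OF _ _ fin]) auto
    have "ennreal c * ennreal (\<integral>x. ?h x \<partial>lebesgue) \<le> ennreal (\<E> u)"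
      using le nn_integral_eq_integral[OF i] by simp
    then have "c * (\<integral>x. ?h x \<partial>lebesgue) \<le> \<E> u"
      using c(1) by (simp add: seminorm_powr_def flip: ennreal_mult')
    then show ?thesis using i c(1) by (simp add: field_simps)
  qed
  then show thesis using that[of "1 / c"] c(1) by simp
qed

text \<open>Hardy's inequality, with the weight bounded below because \<open>d \<le> D\<close> on
  the bounded set \<Omega>.\<close>

lemma Poincare:
  obtains P where "0 < P"
    "\<And>u. u \<in> \<W> \<Omega> \<Longrightarrow> (\<integral>x. \<bar>u x\<bar> powr p \<partial>lebesgue) \<le> P * \<E> u"
proof -
  obtain H where H: "0 < H" "\<And>u. u \<in> \<W> \<Omega> \<Longrightarrow>
       integrable lebesgue (\<lambda>x. indicator \<Omega> x * (\<bar>u x\<bar> powr p * d x powr - (s * p))) \<and>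
       (\<integral>x. indicator \<Omega> x * (\<bar>u x\<bar> powr p * d x powr - (s * p)) \<partial>lebesgue) \<le> H * \<E> u"
    using Hardy by blast
  obtain D where D: "1 \<le> D" "\<And>x. x \<in> \<Omega> \<Longrightarrow> d x \<le> D" using d_bound by blast
  have "(\<integral>x. \<bar>u x\<bar> powr p \<partial>lebesgue) \<le> D powr (s * p) * H * \<E> u"
    if u: "u \<in> \<W> \<Omega>" for u
  proof -
    note u' = frac_sobolev_zeroD[OF u]
    let ?h = "\<lambda>x. indicator \<Omega> x * (\<bar>u x\<bar> powr p * d x powr - (s * p))"
    have "(\<integral>x. \<bar>u x\<bar> powr p \<partial>lebesgue) \<le> (\<integral>x. D powr (s * p) * ?h x \<partial>lebesgue)"
    proof (rule integral_mono_AE)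
      show "AE x in lebesgue. \<bar>u x\<bar> powr p \<le> D powr (s * p) * ?h x"
        using u'(4)
      proof eventually_elim
        case (elim x)
        show ?case
        proof (cases "x \<in> \<Omega>")
          case True
          have "d x powr (s * p) \<le> D powr (s * p)"
            using D(2)[OF True] sp_pos by (intro powr_mono2) auto
          then have "1 \<le> D powr (s * p) * d x powr - (s * p)"
            using d_pos[OF True] by (simp add: powr_minus_divide field_simps)
          then have "\<bar>u x\<bar> powr p * 1 \<le> \<bar>u x\<bar> powr p * (D powr (s * p) * d x powr - (s * p))"
            by (rule mult_left_mono) simp
          then show ?thesis using True by (simp add: mult_ac)
        qed (use elim in simp)
      qed
    qed (use u'(2) H(2)[OF u] in auto)
    also have "\<dots> = D powr (s * p) * (\<integral>x. ?h x \<partial>lebesgue)" by simp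
    also have "\<dots> \<le> D powr (s * p) * (H * \<E> u)"
      using H(2)[OF u] by (intro mult_left_mono) auto
    finally show ?thesis by (simp add: mult.assoc)
  qed
  then show thesis using that[of "D powr (s * p) * H"] D H(1) by simp
qed

text \<open>Poincare's inequality supplies the L^p bound in \<open>frac_sobolev_zero_Fatou\<close>,
  so only the seminorms have to be estimated.\<close>

lemma frac_sobolev_zero_limit:
  assumes "A \<subseteq> \<Omega>" and f: "\<And>n. f n \<in> \<W> A" and E: "\<And>n. \<E> (f n) \<le> C"
    and lim: "AE x in lebesgue. (\<lambda>n. f n x) \<longlonglongrightarrow> g x"
  shows "g \<in> \<W> A" "\<E> g \<le> C"
proof -
  obtain P where P: "0 < P" "\<And>u. u \<in> \<W> \<Omega> \<Longrightarrow> (\<integral>x. \<bar>u x\<bar> powr p \<partial>lebesgue) \<le> P * \<E> u"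
    using Poincare by blast
  have "(\<integral>x. \<bar>f n x\<bar> powr p \<partial>lebesgue) \<le> P * C" for n
    using P(2)[OF frac_sobolev_zero_mono[OF f assms(1)], of n] mult_left_mono[OF E[of n], of P] P(1) by linarith
  from frac_sobolev_zero_Fatou[OF f E this lim]
  show "g \<in> \<W> A" "\<E> g \<le> C" by auto
qed

text \<open>Strict monotonicity of \<open>signed_power p\<close> makes the integrand below nonnegative, with equality
  only where the increment of the positive part vanishes.\<close>

lemma weak_comparison:
  fixes u v \<phi> :: "'a \<Rightarrow> real"
  assumes \<phi>: "\<phi> \<in> \<W> \<Omega>" and eq: "AE x in lebesgue. \<phi> x = max (u x - v x) 0"
    and iu: "integrable \<mu> (\<lambda>z. signed_power p (increment u z) * increment \<phi> z)"
    and iv: "integrable \<mu> (\<lambda>z. signed_power p (increment v z) * increment \<phi> z)"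
    and le: "form u \<phi>
      \<le> form v \<phi>"
  shows "AE x in lebesgue. u x \<le> v x"
proof -
  let ?g = "\<lambda>z. signed_power p (increment u z) * increment \<phi> z - signed_power p (increment v z) * increment \<phi> z"
  have pt: "0 \<le> ?g z \<and> (?g z = 0 \<longrightarrow> increment \<phi> z = 0)"
    if inc: "increment \<phi> z = increment (\<lambda>x. max (u x - v x) 0) z" for z
  proof -
    have g: "?g z = (signed_power p (increment u z) - signed_power p (increment v z)) * increment \<phi> z"
      by (simp add: algebra_simps)
    consider (1) "increment \<phi> z = 0" | (2) "0 < increment \<phi> z" "increment v z < increment u z"
      | (3) "increment \<phi> z < 0" "increment u z < increment v z"
    proof -
      \<comment> \<open>The positive part is a nondecreasing function, so a nonzero increment of it
        has the same sign as the increment of \<open>u - v\<close>.\<close>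
      have "max a 0 - max b 0 = 0 \<or> 0 < max a 0 - max b 0 \<and> b < a \<or> max a 0 - max b 0 < 0 \<and> a < b" for a b :: real
        by (auto simp: max_def)
      from this[of "u (fst z) - v (fst z)" "u (snd z) - v (snd z)"] show ?thesis
        using inc that unfolding increment_def by (elim disjE conjE) auto
    qed
    then show ?thesis
    proof cases
      case 2
      then have "0 < ?g z" unfolding g using signed_power_strict_mono[OF p_gt 2(2)] by simp
      then show ?thesis by (intro conjI impI) linarith+
    next
      case 3
      then have "0 < ?g z" unfolding g using signed_power_strict_mono[OF p_gt 3(2)] by (simp add: mult_neg_neg)
      then show ?thesis by (intro conjI impI) linarith+
    qed simp
  qed
  have AEg: "AE z in \<mu>. 0 \<le> ?g z \<and> (?g z = 0 \<longrightarrow> increment \<phi> z = 0)"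
    using AE_increment_cong[OF eq] by eventually_elim (rule pt)
  have ig: "integrable \<mu> ?g" using iu iv by auto
  have "(\<integral>z. ?g z \<partial>\<mu>) \<le> 0" using le by (simp add: iu iv)
  moreover have "0 \<le> (\<integral>z. ?g z \<partial>\<mu>)"
    using AEg by (intro integral_nonneg_AE) auto
  ultimately have "(\<integral>z. ?g z \<partial>\<mu>) = 0" by simp
  then have "AE z in \<mu>. ?g z = 0"
    using integral_nonneg_eq_0_iff_AE[OF ig] AEg by auto
  then have "AE z in \<mu>. \<bar>increment \<phi> z\<bar> powr p = 0"
    using AEg by eventually_elim auto
  then have E: "\<E> \<phi> = 0"
    unfolding seminorm_powr_def by (subst integral_cong_AE[where g="\<lambda>_. 0"]) (use frac_sobolev_zeroD(1)[OF \<phi>] in auto)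
  \<comment> \<open>Vanishing energy by itself suggests a constant function; Poincare's inequality
    leaves only the constant \<open>0\<close>.\<close>
  obtain P where P: "0 < P" "\<And>u. u \<in> \<W> \<Omega> \<Longrightarrow> (\<integral>x. \<bar>u x\<bar> powr p \<partial>lebesgue) \<le> P * \<E> u"
    using Poincare by blast
  have "(\<integral>x. \<bar>\<phi> x\<bar> powr p \<partial>lebesgue) \<le> 0" using P(2)[OF \<phi>] E by simp
  then have "(\<integral>x. \<bar>\<phi> x\<bar> powr p \<partial>lebesgue) = 0"
    by (intro antisym Bochner_Integration.integral_nonneg) auto
  then have "AE x in lebesgue. \<phi> x = 0"
    using integral_nonneg_eq_0_iff_AE[OF frac_sobolev_zeroD(2)[OF \<phi>]] by auto
  then show ?thesis using eq by eventually_elim (auto simp: max_def split: if_splits)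
qed

end

section \<open>The regularized problem\<close>

lemma ex_antiderivative:
  fixes g :: "real \<Rightarrow> real"
  assumes "continuous_on UNIV g"
  obtains G where "G 0 = 0" "\<And>t. (G has_real_derivative g t) (at t)"
proof (rule that[of "\<lambda>u::real. LBINT y=ereal 0..ereal u. g y"])
  let ?G = "\<lambda>u::real. LBINT y=ereal 0..ereal u. g y"
  show "?G 0 = 0" by simp
  fix t :: real
  \<comment> \<open>The margin of \<open>1\<close> places both \<open>0\<close> and \<open>t\<close>
    in the interior, so that the one-sided derivative on \<open>{a..b}\<close> is a full derivative
    at \<open>t\<close>.\<close>
  define a b where "a = min 0 t - 1" and "b = max 0 t + 1"
  have ab: "a < 0" "0 < b" "a < t" "t < b" by (auto simp: a_def b_def min_def max_def)
  have "((\<lambda>u. LBINT y=ereal 0..u. g y) has_vector_derivative g t) (at t within {a..b})"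
    using ab by (intro interval_integral_FTC2[of a 0 b] continuous_on_subset[OF assms]) auto
  then show "(?G has_real_derivative g t) (at t)"
    using ab by (simp add: at_within_Icc_at has_real_derivative_iff_has_vector_derivative zero_ereal_def)
qed

text \<open>Difference quotients of a convex function increase in the step, so for steps in
  \<open>(0, 1]\<close> they lie between \<open>F a - F (a - b)\<close> and
  \<open>F (a + b) - F a\<close>. The bound does not depend on \<open>t\<close> and serves as a
  dominating function.\<close>

lemma convex_difference_quotient:
  fixes F :: "real \<Rightarrow> real"
  assumes F: "convex_on UNIV F" and F0: "\<And>t. 0 \<le> F t" and t: "0 < t" "t \<le> 1"
  shows "\<bar>(F (a + t * b) - F a) / t\<bar> \<le> F a + F (a + b) + F (a - b)"
proof -
  have "F ((1 - t) *\<^sub>R a + t *\<^sub>R (a + b)) \<le> (1 - t) * F a + t * F (a + b)"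
    using t by (intro convex_onD[OF F]) auto
  then have "F (a + t * b) - F a \<le> t * (F (a + b) - F a)"
    by (simp add: algebra_simps)
  then have up: "(F (a + t * b) - F a) / t \<le> F (a + b) - F a"
    using t by (simp add: field_simps)
  \<comment> \<open>The weight for which \<open>a\<close> is the convex combination of
    \<open>a + t * b\<close> and \<open>a - b\<close>.\<close>
  define l where "l = t / (1 + t)"
  have l: "0 \<le> l" "l \<le> 1" "(1 + t) * l = t" "(1 + t) * (1 - l) = 1"
    using t by (auto simp: l_def field_simps)
  have "(1 + t) * ((1 - l) * (a + t * b) + l * (a - b)) = (1 + t) * a"
  proof -
    have "(1 + t) * ((1 - l) * (a + t * b) + l * (a - b)) = ((1 + t) * (1 - l)) * (a + t * b) + ((1 + t) * l) * (a - b)"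
      by (simp add: algebra_simps)
    also have "\<dots> = (1 + t) * a" unfolding l by (simp add: algebra_simps)
    finally show ?thesis .
  qed
  then have eq: "(1 - l) *\<^sub>R (a + t * b) + l *\<^sub>R (a - b) = a" using t by simp
  have "F a \<le> (1 - l) * F (a + t * b) + l * F (a - b)"
    using convex_onD[OF F, of l "a + t * b" "a - b"] l eq by simp
  then have "(1 + t) * F a \<le> (1 + t) * ((1 - l) * F (a + t * b) + l * F (a - b))"
    using t by (intro mult_left_mono) auto
  also have "\<dots> = ((1 + t) * (1 - l)) * F (a + t * b) + ((1 + t) * l) * F (a - b)"
    by (simp add: algebra_simps)
  also have "\<dots> = F (a + t * b) + t * F (a - b)" unfolding l by simp
  finally have "F a - F (a - b) \<le> (F (a + t * b) - F a) / t"
    using t by (simp add: field_simps)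
  with up F0[of a] F0[of "a + b"] F0[of "a - b"] show ?thesis by linarith
qed

lemma DERIV_sequence_at_0:
  assumes "(f has_real_derivative D) (at a)"
  shows "(\<lambda>n. (f (a + (1 / real (Suc n)) * b) - f a) / (1 / real (Suc n))) \<longlonglongrightarrow> D * b"
proof -
  have "((\<lambda>t. f (a + t * b)) has_real_derivative D * b) (at 0)"
  proof (rule DERIV_chain2[of f D "\<lambda>t. a + t * b" 0 b])
    show "((\<lambda>t. a + t * b) has_real_derivative b) (at 0)"
      by (auto intro!: derivative_eq_intros)
  qed (use assms in simp)
  then have "((\<lambda>t. (f (a + t * b) - f a) / t) \<longlongrightarrow> D * b) (at 0)"
    by (simp add: has_field_derivative_iff)
  moreover have "filterlim (\<lambda>n. 1 / real (Suc n)) (at 0) sequentially"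
    unfolding filterlim_at using LIMSEQ_inverse_real_of_nat by (auto simp: inverse_eq_divide)
  ultimately show ?thesis by (rule filterlim_compose)
qed

context frac_exponents
begin

lemma integrable_form:
  assumes "u \<in> \<W> A" "\<phi> \<in> \<W> B"
  shows "integrable \<mu> (\<lambda>z. signed_power p (increment u z) * increment \<phi> z)"
proof -
  note u = frac_sobolev_zeroD[OF assms(1)] and \<phi> = frac_sobolev_zeroD[OF assms(2)]
  note [measurable] = u(1) \<phi>(1)
  show ?thesis
    by (rule Bochner_Integration.integrable_bound[OF Bochner_Integration.integrable_add[OF u(3) \<phi>(3)]])
      (use abs_signed_power_mult_le[OF p_gt] in auto)
qed

lemma zero_in_frac_sobolev_zero: "(\<lambda>_. 0) \<in> \<W> A"
  using p_pos by (simp add: frac_sobolev_zero_iff increment_def)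

lemma seminorm_powr_nonneg [simp]: "0 \<le> \<E> u"
  by (simp add: seminorm_powr_def)

lemma frac_sobolev_zero_abs:
  assumes "u \<in> \<W> A"
  shows "(\<lambda>x. \<bar>u x\<bar>) \<in> \<W> A" "\<E> (\<lambda>x. \<bar>u x\<bar>) \<le> \<E> u"
proof -
  note u = frac_sobolev_zeroD[OF assms]
  have le: "\<bar>increment (\<lambda>x. \<bar>u x\<bar>) z\<bar> \<le> \<bar>increment u z\<bar>" for z
    by (simp add: increment_def)
  show *: "(\<lambda>x. \<bar>u x\<bar>) \<in> \<W> A"
    by (rule frac_sobolev_zero_contract[OF assms, of _ 1]) (use le u(1) in auto)
  show "\<E> (\<lambda>x. \<bar>u x\<bar>) \<le> \<E> u"
    unfolding seminorm_powr_def
    by (rule integral_mono[OF frac_sobolev_zeroD(3)[OF *] u(3)]) (use le p_pos in \<open>auto intro: powr_mono2\<close>)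
qed

end

context frac_domain
begin

lemma measure_domain_finite: "emeasure lebesgue \<Omega> < \<infinity>"
proof -
  obtain r where "\<Omega> \<subseteq> ball 0 r" using bounded_domain bounded_subset_ballD by blast
  then have "emeasure lebesgue \<Omega> \<le> emeasure lebesgue (ball (0::'a) r)"
    by (intro emeasure_mono) auto
  also have "\<dots> < \<infinity>" using emeasure_lborel_ball_finite[of "0::'a" r] by simp
  finally show ?thesis .
qed

lemma integrable_indicator_domain: "integrable lebesgue (indicator \<Omega> :: 'a \<Rightarrow> real)"
  using measure_domain_finite by (intro integrable_real_indicator) auto

text \<open>The constant \<open>c'\<close> is paid on \<Omega> only, which has finite measure. The
  two following lemmas choose the constants in opposite ways: \<open>c\<close> small for coercivity,
  \<open>c'\<close> small for continuity at \<open>0\<close>.\<close>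

lemma integral_abs_le:
  assumes u: "u \<in> \<W> \<Omega>" and c: "0 \<le> c" "0 \<le> c'" "\<And>t. 0 \<le> t \<Longrightarrow> t \<le> c * t powr p + c'"
  shows "integrable lebesgue u" "(\<integral>x. \<bar>u x\<bar> \<partial>lebesgue) \<le> c * (\<integral>x. \<bar>u x\<bar> powr p \<partial>lebesgue) + c' * measure lebesgue \<Omega>"
proof -
  note u' = frac_sobolev_zeroD[OF u]
  let ?R = "\<lambda>x. c * \<bar>u x\<bar> powr p + c' * indicator \<Omega> x"
  have R: "integrable lebesgue ?R"
    using u'(2) integrable_indicator_domain by auto
  have le: "AE x in lebesgue. \<bar>u x\<bar> \<le> ?R x"
    using u'(4)
  proof eventually_elim
    case (elim x)
    then show ?case using c(3)[of "\<bar>u x\<bar>"] c(1) by (cases "x \<in> \<Omega>") auto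
  qed
  show i: "integrable lebesgue u"
    by (rule Bochner_Integration.integrable_bound[OF R]) (use u'(1) le in \<open>auto elim!: eventually_mono\<close>)
  have "(\<integral>x. \<bar>u x\<bar> \<partial>lebesgue) \<le> (\<integral>x. ?R x \<partial>lebesgue)"
    by (rule integral_mono_AE[OF _ R le]) (use i in auto)
  also have "\<dots> = c * (\<integral>x. \<bar>u x\<bar> powr p \<partial>lebesgue) + c' * measure lebesgue \<Omega>"
    using u'(2) integrable_indicator_domain by (subst Bochner_Integration.integral_add) auto
  finally show "(\<integral>x. \<bar>u x\<bar> \<partial>lebesgue) \<le> c * (\<integral>x. \<bar>u x\<bar> powr p \<partial>lebesgue) + c' * measure lebesgue \<Omega>" .
qed

lemma integral_abs_le_seminorm:
  assumes e: "0 < e"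
  obtains C where "0 \<le> C" "\<And>u. u \<in> \<W> \<Omega> \<Longrightarrow> (\<integral>x. \<bar>u x\<bar> \<partial>lebesgue) \<le> e * \<E> u + C"
proof -
  obtain P where P: "0 < P" "\<And>u. u \<in> \<W> \<Omega> \<Longrightarrow> (\<integral>x. \<bar>u x\<bar> powr p \<partial>lebesgue) \<le> P * \<E> u"
    using Poincare by blast
  obtain C where C: "0 \<le> C" "\<And>t. 0 \<le> t \<Longrightarrow> t powr 1 \<le> e / P * t powr p + C"
    using powr_less_exponent_le[of 1 p "e / P"] p_gt e P by auto
  have "(\<integral>x. \<bar>u x\<bar> \<partial>lebesgue) \<le> e * \<E> u + C * measure lebesgue \<Omega>" if "u \<in> \<W> \<Omega>" for u
  proof -
    have "(\<integral>x. \<bar>u x\<bar> \<partial>lebesgue) \<le> e / P * (\<integral>x. \<bar>u x\<bar> powr p \<partial>lebesgue) + C * measure lebesgue \<Omega>"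
      using C e P by (intro integral_abs_le(2)[OF that]) auto
    also have "\<dots> \<le> e / P * (P * \<E> u) + C * measure lebesgue \<Omega>"
      using e P P(2)[OF that] by (intro add_right_mono mult_left_mono) auto
    finally show ?thesis using P(1) by simp
  qed
  then show thesis using that[of "C * measure lebesgue \<Omega>"] C(1) by simp
qed

lemma integral_abs_small:
  assumes e: "0 < e"
  obtains \<delta> where "0 < \<delta>" "\<And>u. u \<in> \<W> \<Omega> \<Longrightarrow> \<E> u < \<delta> \<Longrightarrow> (\<integral>x. \<bar>u x\<bar> \<partial>lebesgue) < e"
proof -
  obtain P where P: "0 < P" "\<And>u. u \<in> \<W> \<Omega> \<Longrightarrow> (\<integral>x. \<bar>u x\<bar> powr p \<partial>lebesgue) \<le> P * \<E> u"
    using Poincare by blast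
  define \<eta> where "\<eta> = e / (2 * (measure lebesgue \<Omega> + 1))"
  have \<eta>: "0 < \<eta>" "\<eta> * measure lebesgue \<Omega> \<le> e / 2"
  proof -
    show "0 < \<eta>" using e by (simp add: \<eta>_def add_nonneg_pos)
    have "\<eta> * measure lebesgue \<Omega> \<le> \<eta> * (measure lebesgue \<Omega> + 1)" using \<open>0 < \<eta>\<close> by simp
    also have "\<dots> = e / 2"
    proof -
      have "measure lebesgue \<Omega> + 1 \<noteq> 0" using measure_nonneg[of lebesgue \<Omega>] by linarith
      then have "e / 2 / (measure lebesgue \<Omega> + 1) * (measure lebesgue \<Omega> + 1) = e / 2"
        by (rule nonzero_eq_divide_eq[THEN iffD1, OF _ refl])
      then show ?thesis by (simp only: \<eta>_def divide_divide_eq_left)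
    qed
    finally show "\<eta> * measure lebesgue \<Omega> \<le> e / 2" .
  qed
  define c where "c = \<eta> powr (1 - p)"
  have c: "0 < c" using \<eta> by (simp add: c_def)
  have le: "t \<le> c * t powr p + \<eta>" if "0 \<le> t" for t
  proof (cases "t \<le> \<eta>")
    case False
    then have t: "0 < t" "\<eta> < t" using \<eta> by auto
    have "t = t powr (1 - p) * t powr p" using t by (simp flip: powr_add)
    also have "\<dots> \<le> c * t powr p"
      unfolding c_def using t \<eta> p_gt by (intro mult_right_mono powr_mono2') auto
    finally show ?thesis using \<eta> by simp
  qed (use c in \<open>simp add: add_increasing\<close>)
  have "(\<integral>x. \<bar>u x\<bar> \<partial>lebesgue) < e" if u: "u \<in> \<W> \<Omega>" and E: "\<E> u < e / (2 * c * P)" for u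
  proof -
    have "(\<integral>x. \<bar>u x\<bar> \<partial>lebesgue) \<le> c * (\<integral>x. \<bar>u x\<bar> powr p \<partial>lebesgue) + \<eta> * measure lebesgue \<Omega>"
      using c \<eta> le by (intro integral_abs_le(2)[OF u]) auto
    also have "\<dots> \<le> c * (P * \<E> u) + e / 2"
      using c P(2)[OF u] \<eta> by (intro add_mono mult_left_mono) auto
    also have "c * (P * \<E> u) < e / 2"
      using E c P(1) by (simp add: field_simps)
    finally show ?thesis by simp
  qed
  then show thesis using that[of "e / (2 * c * P)"] e c P(1) by simp
qed

text \<open>Cauchy in the seminorm implies Cauchy in L^1 by \<open>integral_abs_small\<close>, and a
  subsequence then converges almost everywhere. Convergence in L^1 is kept in the conclusion because
  the lower-order term of the energy is Lipschitz for it.\<close>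

lemma minimizing_sequence_limit:
  fixes w :: "nat \<Rightarrow> 'a \<Rightarrow> real"
  assumes A: "A \<subseteq> \<Omega>" and w: "\<And>n. w n \<in> \<W> A"
    and cauchy: "\<And>e. 0 < e \<Longrightarrow> \<exists>N. \<forall>i\<ge>N. \<forall>j\<ge>N. \<E> (\<lambda>x. w i x - w j x) < e"
  obtains r u where "strict_mono r" "u \<in> borel_measurable lebesgue" "AE x in lebesgue. (\<lambda>n. w (r n) x) \<longlonglongrightarrow> u x"
    "(\<lambda>n. \<integral>x. \<bar>w (r n) x - u x\<bar> \<partial>lebesgue) \<longlonglongrightarrow> 0" "\<And>n. integrable lebesgue (\<lambda>x. w (r n) x - u x)"
proof -
  have wW: "w n \<in> \<W> \<Omega>" for n using frac_sobolev_zero_mono[OF w A] .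
  have diff: "(\<lambda>x. w i x - w j x) \<in> \<W> \<Omega>" for i j
    using frac_sobolev_zero_diff[OF wW wW] .
  have int: "integrable lebesgue u" if "u \<in> \<W> \<Omega>" for u
  proof -
    obtain c where "0 \<le> c" "\<And>t. 0 \<le> t \<Longrightarrow> t powr 1 \<le> 1 * t powr p + c"
      using powr_less_exponent_le[of 1 p 1] p_gt by auto
    then show ?thesis by (intro integral_abs_le(1)[OF that, of 1 c]) auto
  qed
  have L1: "\<exists>N. \<forall>i\<ge>N. \<forall>j\<ge>N. (\<integral>x. \<bar>w i x - w j x\<bar> \<partial>lebesgue) < e" if e: "0 < e" for e
  proof -
    obtain \<delta> where \<delta>: "0 < \<delta>" "\<And>u. u \<in> \<W> \<Omega> \<Longrightarrow> \<E> u < \<delta> \<Longrightarrow> (\<integral>x. \<bar>u x\<bar> \<partial>lebesgue) < e"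
      using integral_abs_small[OF e] by blast
    then show ?thesis using cauchy[OF \<delta>(1)] \<delta>(2)[OF diff] by blast
  qed
  obtain r where r: "strict_mono r" "AE x in lebesgue. Cauchy (\<lambda>i. w (r i) x)"
    using cauchy_L1_AE_cauchy_subseq[of lebesgue w] int[OF wW] L1 by auto
  define u where "u = (\<lambda>x. lim (\<lambda>n. w (r n) x))"
  have lim: "AE x in lebesgue. (\<lambda>n. w (r n) x) \<longlonglongrightarrow> u x"
    using r(2) by eventually_elim (simp add: u_def Cauchy_convergent_iff convergent_LIMSEQ_iff)
  have u[measurable]: "u \<in> borel_measurable lebesgue"
    by (rule borel_measurable_lebesgue_LIMSEQ[OF _ lim]) (rule frac_sobolev_zeroD(1)[OF w])
  \<comment> \<open>Fatou's lemma in the second index turns the Cauchy estimate into an estimate of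
    the distance to the limit.\<close>
  have *: "integrable lebesgue (\<lambda>x. \<bar>w (r n) x - u x\<bar>) \<and> (\<integral>x. \<bar>w (r n) x - u x\<bar> \<partial>lebesgue) \<le> e"
    if N: "\<forall>i\<ge>N. \<forall>j\<ge>N. (\<integral>x. \<bar>w i x - w j x\<bar> \<partial>lebesgue) < e" and n: "N \<le> n" for n N e
  proof -
    have rn: "m \<le> r m" for m using r(1) by (rule seq_suble)
    let ?g = "\<lambda>j x. \<bar>w (r n) x - w (r (j + N)) x\<bar>"
    have g: "integrable lebesgue (?g j)" "(\<integral>x. ?g j x \<partial>lebesgue) \<le> e" for j
      using int[OF diff] N rn[of n] rn[of "j + N"] n by (auto simp: less_imp_le)
    have l: "AE x in lebesgue. (\<lambda>j. ?g j x) \<longlonglongrightarrow> \<bar>w (r n) x - u x\<bar>"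
      using lim by eventually_elim (intro tendsto_rabs tendsto_diff tendsto_const LIMSEQ_ignore_initial_segment)
    have m: "(\<lambda>x. \<bar>w (r n) x - u x\<bar>) \<in> borel_measurable lebesgue"
      using frac_sobolev_zeroD(1)[OF w] by measurable
    show ?thesis
      using integral_Fatou_AE[OF g(1) _ g(2) m l] by auto
  qed
  show thesis
  proof (rule that[OF r(1) u lim])
    show "(\<lambda>n. \<integral>x. \<bar>w (r n) x - u x\<bar> \<partial>lebesgue) \<longlonglongrightarrow> 0"
    proof (rule LIMSEQ_I)
      fix e :: real assume "0 < e"
      then obtain N where "\<forall>i\<ge>N. \<forall>j\<ge>N. (\<integral>x. \<bar>w i x - w j x\<bar> \<partial>lebesgue) < e / 2" using L1[of "e / 2"] by auto
      then have "\<forall>n\<ge>N. norm ((\<integral>x. \<bar>w (r n) x - u x\<bar> \<partial>lebesgue) - 0) < e"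
        using *[of N "e / 2"] \<open>0 < e\<close> by fastforce
      then show "\<exists>N. \<forall>n\<ge>N. norm ((\<integral>x. \<bar>w (r n) x - u x\<bar> \<partial>lebesgue) - 0) < e" by blast
    qed
    obtain N where N: "\<forall>i\<ge>N. \<forall>j\<ge>N. (\<integral>x. \<bar>w i x - w j x\<bar> \<partial>lebesgue) < 1" using L1[of 1] by auto
    fix n
    have 1: "integrable lebesgue (\<lambda>x. w (r N) x - u x)"
      using *[OF N, of N] frac_sobolev_zeroD(1)[OF w] by (subst integrable_abs_iff[symmetric]) auto
    have "integrable lebesgue (\<lambda>x. (w (r n) x - w (r N) x) + (w (r N) x - u x))"
      by (rule Bochner_Integration.integrable_add[OF int[OF diff] 1])
    then show "integrable lebesgue (\<lambda>x. w (r n) x - u x)" by simp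
  qed
qed

text \<open>Direct method for the energy \<open>\<E> w / p - \<integral> h G(w)\<close>, which is convex because the
  antiderivative \<open>G\<close> of the decreasing nonlinearity is concave. Uniform convexity makes minimizing
  sequences Cauchy in the seminorm, so no weak compactness is needed.\<close>

lemma ex_regularized_solution:
  fixes h :: "'a \<Rightarrow> real" and a \<gamma> :: real
  assumes A: "A \<subseteq> \<Omega>" and h[measurable]: "h \<in> borel_measurable lebesgue"
    and h0: "\<And>x. 0 \<le> h x" and hB: "\<And>x. h x \<le> B"
    and a: "0 < a" and \<gamma>: "0 < \<gamma>"
  obtains u where "u \<in> \<W> A" "\<And>x. 0 \<le> u x"
    "\<And>\<phi>. \<phi> \<in> \<W> A \<Longrightarrow>
      integrable lebesgue (\<lambda>x. h x * (u x + a) powr (- \<gamma>) * \<phi> x) \<and>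
      form u \<phi> =
      (\<integral>x. h x * (u x + a) powr (- \<gamma>) * \<phi> x \<partial>lebesgue)"
proof -
  define W where "W = (\<W> A :: ('a \<Rightarrow> real) set)"
  have WD: "u \<in> \<W> \<Omega>" if "u \<in> W" for u
    using that frac_sobolev_zero_mono[OF _ A] by (simp add: W_def)
  have B0: "0 \<le> B" using h0[of undefined] hB[of undefined] by linarith
  \<comment> \<open>For negative arguments the nonlinearity is continued by its value at
    \<open>0\<close>, so it is bounded, continuous and decreasing on the whole line. The minimizer
    is nonnegative and does not see the extension.\<close>
  define g where "g = (\<lambda>t. (max t 0 + a) powr (- \<gamma>))"
  define K where "K = a powr (- \<gamma>)"
  have gK: "0 < g t" "g t \<le> K" for t
    unfolding g_def K_def using a \<gamma> by (auto intro!: powr_mono2')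
  have gmono: "g t' \<le> g t" if "t \<le> t'" for t t'
    unfolding g_def using a \<gamma> that by (intro powr_mono2') auto
  have "continuous_on UNIV g"
    unfolding g_def using a by (intro continuous_intros) (auto simp: max_def)
  then obtain G where G0: "G 0 = 0" and G: "\<And>t. (G has_real_derivative g t) (at t)"
    using ex_antiderivative by blast
  have contG: "continuous_on UNIV G"
    using G DERIV_isCont by (auto simp: continuous_on_eq_continuous_at)
  have [measurable]: "G \<in> borel_measurable borel" "g \<in> borel_measurable borel"
    using borel_measurable_continuous_onI[OF contG] by (auto simp: g_def)
  have Gdiff: "G y - G x \<le> K * (y - x) \<and> G x \<le> G y" if "x \<le> y" for x y
  proof (cases "x < y")
    case True
    obtain z where "G y - G x = (y - x) * g z" using MVT2[OF True, of G g] G by blast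
    moreover have "(y - x) * g z \<le> (y - x) * K" "0 \<le> (y - x) * g z"
      using gK[of z] that by (auto intro!: mult_left_mono)
    ultimately show ?thesis by (simp add: mult.commute)
  qed (use that in simp)
  have Glip: "\<bar>G y - G x\<bar> \<le> K * \<bar>y - x\<bar>" for x y
    using Gdiff[of x y] Gdiff[of y x] by (cases "x \<le> y") auto
  have Gconc: "(G x + G y) / 2 \<le> G ((x + y) / 2)" for x y
  proof -
    have "convex_on UNIV (\<lambda>t. - G t)"
    proof (rule convex_on_realI[where f' = "\<lambda>t. - g t"])
      show "((\<lambda>t. - G t) has_real_derivative - g x) (at x)" for x using G by (rule DERIV_minus)
    qed (use gmono in auto)
    from convex_onD[OF this, of "1/2" x y] show ?thesis by (simp add: field_simps)
  qed
  have wint: "integrable lebesgue u" if "u \<in> W" for u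
  proof -
    obtain c where "0 \<le> c" "\<And>t. 0 \<le> t \<Longrightarrow> t powr 1 \<le> 1 * t powr p + c"
      using powr_less_exponent_le[of 1 p 1] p_gt by auto
    then show ?thesis by (intro integral_abs_le(1)[OF WD[OF that], of 1 c]) auto
  qed
  have hG: "\<bar>h x * (G t - G t')\<bar> \<le> B * K * \<bar>t - t'\<bar>" for x t t'
  proof -
    have "\<bar>h x * (G t - G t')\<bar> \<le> B * (K * \<bar>t - t'\<bar>)"
      unfolding abs_mult using h0[of x] hB[of x] Glip[of t t'] by (intro mult_mono) auto
    then show ?thesis by (simp add: mult.assoc)
  qed
  have Wmeas: "u \<in> borel_measurable lebesgue" if "u \<in> W" for u
    using that frac_sobolev_zeroD(1) by (auto simp: W_def)
  have hGi: "integrable lebesgue (\<lambda>x. h x * G (u x))" if "u \<in> W" for u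
  proof (rule Bochner_Integration.integrable_bound)
    show "integrable lebesgue (\<lambda>x. B * K * \<bar>u x\<bar>)" using wint[OF that] by auto
    show "AE x in lebesgue. norm (h x * G (u x)) \<le> norm (B * K * \<bar>u x\<bar>)"
      using hG[of _ "u _" 0] by (auto simp: G0 intro!: order_trans[OF _ abs_ge_self])
  qed (use Wmeas[OF that] in measurable)
  define I where "I = (\<lambda>u::'a\<Rightarrow>real. \<integral>x. h x * G (u x) \<partial>lebesgue)"
  define J where "J = (\<lambda>u. \<E> u / p - I u)"
  obtain C0 where C0: "0 \<le> C0" "\<And>u. u \<in> W \<Longrightarrow> \<E> u \<le> 2 * p * (J u + C0)"
  proof -
    \<comment> \<open>Chosen so that \<open>B * K * e\<close> is at most \<open>1 / (2 * p)\<close>,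
      half the coefficient of the leading term; the lower-order term is then absorbed. The added
      \<open>1\<close> covers \<open>B = 0\<close>.\<close>
    define e where "e = 1 / (2 * p * (B * K + 1))"
    have BK: "0 \<le> B * K" using B0 by (simp add: K_def)
    then have b1: "0 < B * K + 1" by linarith
    have e: "0 < e" "B * K * e \<le> 1 / (2 * p)"
    proof -
      show "0 < e" unfolding e_def using b1 p_pos by (intro divide_pos_pos mult_pos_pos) auto
      have "B * K * e = B * K / (B * K + 1) * (1 / (2 * p))" by (simp only: e_def times_divide_eq_left times_divide_eq_right divide_divide_eq_left mult_1_right mult.commute)
      also have "\<dots> \<le> 1 * (1 / (2 * p))"
        using b1 p_pos by (intro mult_right_mono) auto
      finally show "B * K * e \<le> 1 / (2 * p)" by simp
    qed
    obtain C where C: "0 \<le> C" "\<And>u. u \<in> \<W> \<Omega> \<Longrightarrow> (\<integral>x. \<bar>u x\<bar> \<partial>lebesgue) \<le> e * \<E> u + C"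
      using integral_abs_le_seminorm[OF e(1)] by blast
    have "\<E> u \<le> 2 * p * (J u + B * K * C)" if u: "u \<in> W" for u
    proof -
      have "I u \<le> (\<integral>x. B * K * \<bar>u x\<bar> \<partial>lebesgue)"
        unfolding I_def using hG[of _ "u _" 0] wint[OF u]
        by (intro integral_mono hGi[OF u]) (auto simp: G0 intro: order_trans[OF abs_ge_self])
      also have "\<dots> \<le> B * K * (e * \<E> u + C)"
        using C(2)[OF WD[OF u]] BK by (auto intro!: mult_left_mono)
      also have "\<dots> = (B * K * e) * \<E> u + B * K * C" by (simp add: algebra_simps)
      also have "\<dots> \<le> 1 / (2 * p) * \<E> u + B * K * C"
        using e by (intro add_right_mono mult_right_mono) auto
      finally have "I u \<le> \<E> u / (2 * p) + B * K * C" by simp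
      moreover have "\<E> u / p = 2 * (\<E> u / (2 * p))" by simp
      ultimately have "\<E> u / (2 * p) \<le> J u + B * K * C" unfolding J_def by linarith
      then show ?thesis using p_pos by (simp add: pos_divide_le_eq mult.commute)
    qed
    then show thesis using that[of "B * K * C"] BK C(1) by simp
  qed
  define m where "m = Inf (J ` W)"
  have Wne: "J ` W \<noteq> {}" using zero_in_frac_sobolev_zero by (auto simp: W_def)
  have bdd: "bdd_below (J ` W)"
  proof (rule bdd_belowI2[of _ "- C0"])
    fix u assume "u \<in> W"
    then have "0 \<le> 2 * p * (J u + C0)" using C0(2) seminorm_powr_nonneg order_trans by blast
    then show "- C0 \<le> J u" using p_pos by (simp add: zero_le_mult_iff)
  qed
  have mJ: "m \<le> J u" if "u \<in> W" for u
    unfolding m_def using bdd that by (intro cInf_lower) auto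
  \<comment> \<open>Passing to the absolute value does not raise the energy, because increments
    shrink and \<open>G\<close> is increasing; the minimizing sequence can be taken
    nonnegative.\<close>
  have "\<exists>u\<in>W. (\<forall>x. 0 \<le> u x) \<and> J u < m + 1 / real (Suc n)" for n
  proof -
    have "m < m + 1 / real (Suc n)" by simp
    then obtain u where u: "u \<in> W" "J u < m + 1 / real (Suc n)"
      using cInf_lessD[OF Wne, of "m + 1 / real (Suc n)"] unfolding m_def by blast
    have v: "(\<lambda>x. \<bar>u x\<bar>) \<in> W" "\<E> (\<lambda>x. \<bar>u x\<bar>) \<le> \<E> u"
      using u(1) frac_sobolev_zero_abs unfolding W_def by auto
    have "I u \<le> I (\<lambda>x. \<bar>u x\<bar>)"
      unfolding I_def using hGi u(1) v(1) h0 Gdiff[OF abs_ge_self]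
      by (intro integral_mono) (auto intro!: mult_left_mono)
    then have "J (\<lambda>x. \<bar>u x\<bar>) \<le> J u"
      using v(2) p_pos unfolding J_def by (intro diff_mono divide_right_mono) auto
    then show ?thesis using v(1) u(2) by (intro bexI[of _ "\<lambda>x. \<bar>u x\<bar>"]) auto
  qed
  then obtain w where w: "\<And>n. w n \<in> W" "\<And>n x. 0 \<le> w n x" "\<And>n. J (w n) < m + 1 / real (Suc n)"
    by metis
  define M where "M = 2 * p * (m + 1 + C0)"
  have wM: "\<E> (w n) \<le> M" for n
  proof -
    have "1 / real (Suc n) \<le> 1" by simp
    then have "J (w n) + C0 \<le> m + 1 + C0" using w(3)[of n] by linarith
    then have "2 * p * (J (w n) + C0) \<le> M" unfolding M_def using p_pos by (intro mult_left_mono) auto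
    then show ?thesis using C0(2)[OF w(1)[of n]] by linarith
  qed
  have M0: "0 \<le> M" using wM[of 0] seminorm_powr_nonneg[of "w 0"] by linarith
  \<comment> \<open>\<open>I\<close> is concave, so the convexity gap of the leading term alone is
    at most \<open>p\<close> times the mean distance of \<open>J u\<close> and \<open>J v\<close>
    from the infimum.\<close>
  have gap: "(\<E> u + \<E> v) / 2 - \<E> (\<lambda>x. (u x + v x) / 2) \<le> p * ((J u + J v) / 2 - m)"
    and midW: "(\<lambda>x. (u x + v x) / 2) \<in> W" if uv: "u \<in> W" "v \<in> W" for u v
  proof -
    show mid: "(\<lambda>x. (u x + v x) / 2) \<in> W"
      using frac_sobolev_zero_cmult[OF frac_sobolev_zero_add[of u A v], of "1/2"] uv by (simp add: W_def)
    have i2: "integrable lebesgue (\<lambda>x. h x * G (u x) / 2)" "integrable lebesgue (\<lambda>x. h x * G (v x) / 2)"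
      using hGi[OF uv(1)] hGi[OF uv(2)] by auto
    have "(I u + I v) / 2 = (\<integral>x. h x * G (u x) / 2 \<partial>lebesgue) + (\<integral>x. h x * G (v x) / 2 \<partial>lebesgue)"
      by (simp add: I_def add_divide_distrib)
    also have "\<dots> = (\<integral>x. h x * G (u x) / 2 + h x * G (v x) / 2 \<partial>lebesgue)"
      by (rule Bochner_Integration.integral_add[OF i2, symmetric])
    also have "\<dots> \<le> I (\<lambda>x. (u x + v x) / 2)"
      unfolding I_def
    proof (rule integral_mono[OF Bochner_Integration.integrable_add[OF i2] hGi[OF mid]])
      fix x
      have "h x * G (u x) / 2 + h x * G (v x) / 2 = h x * ((G (u x) + G (v x)) / 2)"
        by (simp add: distrib_left add_divide_distrib)
      also have "\<dots> \<le> h x * G ((u x + v x) / 2)"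
        using h0 Gconc by (rule mult_left_mono[rotated])
      finally show "h x * G (u x) / 2 + h x * G (v x) / 2 \<le> h x * G ((u x + v x) / 2)" .
    qed
    finally have "(I u + I v) / 2 \<le> I (\<lambda>x. (u x + v x) / 2)" .
    moreover have "m \<le> \<E> (\<lambda>x. (u x + v x) / 2) / p - I (\<lambda>x. (u x + v x) / 2)"
      using mJ[OF mid] by (simp only: J_def)
    ultimately have "(\<E> u / p + \<E> v / p) / 2 - \<E> (\<lambda>x. (u x + v x) / 2) / p \<le> (J u + J v) / 2 - m"
    proof -
      have *: "(a + b) / 2 - c \<le> (a - Iu + (b - Iv)) / 2 - m'" if "(Iu + Iv) / 2 \<le> Iw" "m' \<le> c - Iw"
        for a b c Iu Iv Iw m' :: real
        using that by (simp add: field_simps)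
      show "(I u + I v) / 2 \<le> I (\<lambda>x. (u x + v x) / 2) \<Longrightarrow>
        m \<le> \<E> (\<lambda>x. (u x + v x) / 2) / p - I (\<lambda>x. (u x + v x) / 2) \<Longrightarrow> ?thesis"
        unfolding J_def by (rule *)
    qed
    then have "p * ((\<E> u / p + \<E> v / p) / 2 - \<E> (\<lambda>x. (u x + v x) / 2) / p) \<le> p * ((J u + J v) / 2 - m)"
      using p_pos by (intro mult_left_mono) auto
    then show "(\<E> u + \<E> v) / 2 - \<E> (\<lambda>x. (u x + v x) / 2) \<le> p * ((J u + J v) / 2 - m)"
    proof -
      have "p * ((b1 / p + b2 / p) / 2 - b3 / p) = (b1 + b2) / 2 - b3" for b1 b2 b3 :: real
        using p_pos by (simp add: field_simps)
      then show "p * ((\<E> u / p + \<E> v / p) / 2 - \<E> (\<lambda>x. (u x + v x) / 2) / p) \<le> p * ((J u + J v) / 2 - m) \<Longrightarrow> ?thesis"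
        by (simp only:)
    qed
  qed
  have unif: "\<exists>C\<ge>0. \<forall>u\<in>W. \<forall>v\<in>W. \<E> (\<lambda>x. u x - v x) \<le> e * (\<E> u + \<E> v) +
      C * ((\<E> u + \<E> v) / 2 - \<E> (\<lambda>x. (u x + v x) / 2))" if e: "0 < e" for e
  proof -
    obtain C where C: "0 \<le> C" "\<And>a b::real. \<bar>a - b\<bar> powr p \<le> e * (\<bar>a\<bar> powr p + \<bar>b\<bar> powr p) +
       C * ((\<bar>a\<bar> powr p + \<bar>b\<bar> powr p) / 2 - \<bar>(a + b) / 2\<bar> powr p)"
      using abs_powr_uniformly_convex[OF p_gt e] by blast
    have "\<E> (\<lambda>x. u x - v x) \<le> e * (\<E> u + \<E> v) +
      C * ((\<E> u + \<E> v) / 2 - \<E> (\<lambda>x. (u x + v x) / 2))"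
      if uv: "u \<in> W" "v \<in> W" for u v
    proof -
      let ?F = "\<lambda>u z. \<bar>increment u z\<bar> powr p"
      let ?m = "\<lambda>x. (u x + v x) / 2"
      have iu: "integrable \<mu> (?F u)" and iv: "integrable \<mu> (?F v)"
        and im: "integrable \<mu> (?F ?m)"
        and id: "integrable \<mu> (?F (\<lambda>x. u x - v x))"
        using uv midW[OF uv] frac_sobolev_zero_diff[of u A v] frac_sobolev_zeroD(3) unfolding W_def by blast+
      have "\<E> (\<lambda>x. u x - v x) \<le> (\<integral>z. e * (?F u z + ?F v z) + C * ((?F u z + ?F v z) / 2 - ?F ?m z) \<partial>\<mu>)"
        unfolding seminorm_powr_def
      proof (rule integral_mono[OF id])
        show "integrable \<mu> (\<lambda>z. e * (?F u z + ?F v z) + C * ((?F u z + ?F v z) / 2 - ?F ?m z))"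
          using iu iv im by auto
        fix z
        have "increment ?m z = (increment u z + increment v z) / 2" "increment (\<lambda>x. u x - v x) z = increment u z - increment v z"
          by (simp_all add: increment_def field_simps)
        then show "?F (\<lambda>x. u x - v x) z \<le> e * (?F u z + ?F v z) + C * ((?F u z + ?F v z) / 2 - ?F ?m z)"
          using C(2)[of "increment u z" "increment v z"] by (simp only:)
      qed
      also have "\<dots> = e * (\<E> u + \<E> v) + C * ((\<E> u + \<E> v) / 2 - \<E> ?m)"
        unfolding seminorm_powr_def using iu iv im by simp
      finally show ?thesis .
    qed
    then show ?thesis using C(1) by blast
  qed
  have cauchy: "\<exists>N. \<forall>i\<ge>N. \<forall>j\<ge>N. \<E> (\<lambda>x. w i x - w j x) < e" if e: "0 < e" for e
  proof -
    \<comment> \<open>With energies at most \<open>M\<close>, the first term of the uniform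
      convexity estimate stays below \<open>3 / 4 * e\<close>; the choice of \<open>N\<close> leaves
      at most \<open>e / 4\<close> for the gap.\<close>
    define e' where "e' = e / (4 * (M + 1))"
    have e': "0 < e'" "e' * (M + M) < e / 2 + e / 4"
      using e M0 by (auto simp: e'_def field_simps add_pos_nonneg)
    obtain C where C: "0 \<le> C" "\<And>u v. u \<in> W \<Longrightarrow> v \<in> W \<Longrightarrow> \<E> (\<lambda>x. u x - v x) \<le> e' * (\<E> u + \<E> v) +
      C * ((\<E> u + \<E> v) / 2 - \<E> (\<lambda>x. (u x + v x) / 2))"
      using unif[OF e'(1)] by blast
    obtain N where N: "C * p * (1 / real (Suc N)) < e / 4"
    proof -
      have "(\<lambda>n. C * p * (1 / real (Suc n))) \<longlonglongrightarrow> C * p * 0"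
        using LIMSEQ_inverse_real_of_nat by (intro tendsto_intros) (simp add: inverse_eq_divide)
      then have "\<forall>\<^sub>F n in sequentially. C * p * (1 / real (Suc n)) < e / 4"
        using e by (intro order_tendstoD(2)) auto
      then show thesis using that by (auto simp: eventually_sequentially)
    qed
    have "\<E> (\<lambda>x. w i x - w j x) < e" if ij: "N \<le> i" "N \<le> j" for i j
    proof -
      have "1 / real (Suc i) \<le> 1 / real (Suc N)" "1 / real (Suc j) \<le> 1 / real (Suc N)"
        using ij by (auto intro!: divide_left_mono)
      then have "(J (w i) + J (w j)) / 2 - m \<le> 1 / real (Suc N)"
      proof -
        have half: "(b1 + b2) / 2 - m \<le> c" if "b1 \<le> m + c" "b2 \<le> m + c" for b1 b2 c :: real
          using that by (simp add: field_simps)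
        show "1 / real (Suc i) \<le> 1 / real (Suc N) \<Longrightarrow> 1 / real (Suc j) \<le> 1 / real (Suc N) \<Longrightarrow> ?thesis"
          using w(3)[of i] w(3)[of j] by (intro half) linarith+
      qed
      then have "p * ((J (w i) + J (w j)) / 2 - m) \<le> p * (1 / real (Suc N))"
        using p_pos by (intro mult_left_mono) auto
      then have "C * ((\<E> (w i) + \<E> (w j)) / 2 - \<E> (\<lambda>x. (w i x + w j x) / 2)) \<le> C * (p * (1 / real (Suc N)))"
        using gap[OF w(1)[of i] w(1)[of j]] C(1) by (intro mult_left_mono) auto
      moreover have "e' * (\<E> (w i) + \<E> (w j)) \<le> e' * (M + M)"
        using wM[of i] wM[of j] e' by (intro mult_left_mono) auto
      ultimately show ?thesis using C(2)[OF w(1)[of i] w(1)[of j]] N e'(2) by (simp only: mult.assoc)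
    qed
    then show ?thesis by blast
  qed
  obtain r u0 where r: "strict_mono r" and u0[measurable]: "u0 \<in> borel_measurable lebesgue"
    and lim: "AE x in lebesgue. (\<lambda>n. w (r n) x) \<longlonglongrightarrow> u0 x"
    and L1: "(\<lambda>n. \<integral>x. \<bar>w (r n) x - u0 x\<bar> \<partial>lebesgue) \<longlonglongrightarrow> 0" and wu: "\<And>n. integrable lebesgue (\<lambda>x. w (r n) x - u0 x)"
    using minimizing_sequence_limit[OF A w(1)[unfolded W_def] cauchy] by blast
  \<comment> \<open>The limit is nonnegative almost everywhere; the absolute value is a
    representative that is nonnegative at every point.\<close>
  define u where "u = (\<lambda>x. \<bar>u0 x\<bar>)"
  have u_pos: "0 \<le> u x" for x by (simp add: u_def)
  have u0W: "u0 \<in> W"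
    unfolding W_def by (rule frac_sobolev_zero_limit(1)[OF A _ _ lim, of M]) (use w(1) wM in \<open>auto simp: W_def\<close>)
  have "AE x in lebesgue. 0 \<le> u0 x"
    using lim by eventually_elim (auto intro: LIMSEQ_le_const w(2))
  then have uu0: "AE x in lebesgue. u0 x = u x" by eventually_elim (simp add: u_def)
  have uW: "u \<in> W" using frac_sobolev_zero_cong[OF _ uu0] u0W by (simp add: W_def)
  have Ilim: "(\<lambda>n. I (w (r n))) \<longlonglongrightarrow> I u0"
  proof (rule LIMSEQ_I)
    fix e :: real assume e: "0 < e"
    have "(\<lambda>n. B * K * (\<integral>x. \<bar>w (r n) x - u0 x\<bar> \<partial>lebesgue)) \<longlonglongrightarrow> B * K * 0"
      using L1 by (intro tendsto_intros)
    then obtain N where N: "\<And>n. N \<le> n \<Longrightarrow> B * K * (\<integral>x. \<bar>w (r n) x - u0 x\<bar> \<partial>lebesgue) < e"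
      using order_tendstoD(2)[of _ "B * K * 0" sequentially e] e by (auto simp: eventually_sequentially)
    have "norm (I (w (r n)) - I u0) \<le> B * K * (\<integral>x. \<bar>w (r n) x - u0 x\<bar> \<partial>lebesgue)" for n
    proof -
      have "I (w (r n)) - I u0 = (\<integral>x. h x * (G (w (r n) x) - G (u0 x)) \<partial>lebesgue)"
        unfolding I_def using hGi w(1) u0W by (subst Bochner_Integration.integral_diff[symmetric]) (auto simp: right_diff_distrib)
      also have "norm \<dots> \<le> (\<integral>x. norm (h x * (G (w (r n) x) - G (u0 x))) \<partial>lebesgue)"
        by (rule integral_norm_bound)
      also have "\<dots> \<le> (\<integral>x. B * K * \<bar>w (r n) x - u0 x\<bar> \<partial>lebesgue)"
      proof (rule integral_mono)
        have "integrable lebesgue (\<lambda>x. h x * G (w (r n) x) - h x * G (u0 x))"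
          using hGi w(1) u0W by auto
        then show "integrable lebesgue (\<lambda>x. norm (h x * (G (w (r n) x) - G (u0 x))))"
          by (intro integrable_norm) (simp add: right_diff_distrib)
      qed (use wu hG in auto)
      finally show ?thesis by simp
    qed
    then show "\<exists>N. \<forall>n\<ge>N. norm (I (w (r n)) - I u0) < e" using N by (meson le_less_trans)
  qed
  \<comment> \<open>\<open>I\<close> converges along the subsequence, while the energy is only lower
    semicontinuous: Fatou's lemma is applied to a tail whose energies exceed the limiting bound by
    at most \<open>e\<close>.\<close>
  have "J u0 \<le> m"
  proof -
    have "(\<lambda>n. p * (m + 1 / real (Suc (r n)) + I (w (r n)))) \<longlonglongrightarrow> p * (m + 0 + I u0)"
      using LIMSEQ_subseq_LIMSEQ[OF LIMSEQ_inverse_real_of_nat r]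
      by (intro tendsto_intros Ilim) (simp add: inverse_eq_divide o_def)
    then have EV: "\<forall>\<^sub>F n in sequentially. p * (m + 1 / real (Suc (r n)) + I (w (r n))) < p * (m + I u0) + e" if "0 < e" for e
      using that by (intro order_tendstoD(2)) auto
    have "\<E> u0 \<le> p * (m + I u0)"
    proof (rule field_le_epsilon)
      fix e :: real assume "0 < e"
      then obtain N where N: "\<And>n. N \<le> n \<Longrightarrow> p * (m + 1 / real (Suc (r n)) + I (w (r n))) < p * (m + I u0) + e"
        using EV by (auto simp: eventually_sequentially)
      have le: "\<E> (w (r (n + N))) \<le> p * (m + I u0) + e" for n
      proof -
        have "\<E> (w (r (n + N))) / p \<le> m + 1 / real (Suc (r (n + N))) + I (w (r (n + N)))"
          using w(3)[of "r (n + N)"] unfolding J_def by linarith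
        then have "\<E> (w (r (n + N))) \<le> p * (m + 1 / real (Suc (r (n + N))) + I (w (r (n + N))))"
          using p_pos by (simp add: pos_divide_le_eq mult.commute)
        then show ?thesis using N[of "n + N"] by simp
      qed
      have lim': "AE x in lebesgue. (\<lambda>n. w (r (n + N)) x) \<longlonglongrightarrow> u0 x"
        using lim by eventually_elim (rule LIMSEQ_ignore_initial_segment)
      have "w (r (n + N)) \<in> \<W> A" for n using w(1) by (simp add: W_def)
      from frac_sobolev_zero_limit(2)[OF A this le lim']
      show "\<E> u0 \<le> p * (m + I u0) + e" .
    qed
    then show ?thesis unfolding J_def using p_pos by (simp add: pos_divide_le_eq mult.commute diff_le_eq)
  qed
  moreover have "J u = J u0"
  proof -
    have "I u = I u0" unfolding I_def
      by (rule integral_cong_AE) (use uu0 Wmeas[OF uW] in \<open>auto elim!: eventually_mono\<close>)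
    moreover have "\<E> u = \<E> u0"
      unfolding seminorm_powr_def
      by (rule integral_cong_AE) (use AE_increment_cong[OF uu0, of s p] Wmeas[OF uW] in \<open>auto elim!: eventually_mono\<close>)
    ultimately show ?thesis by (simp add: J_def)
  qed
  ultimately have Ju: "J u \<le> J v" if "v \<in> W" for v using mJ[OF that] by linarith
  have um[measurable]: "u \<in> borel_measurable lebesgue" using Wmeas[OF uW] .
  have hgi: "integrable lebesgue (\<lambda>x. h x * g (u x) * \<phi> x)" if "\<phi> \<in> W" for \<phi>
  proof (rule Bochner_Integration.integrable_bound)
    show "integrable lebesgue (\<lambda>x. B * K * \<bar>\<phi> x\<bar>)" using wint[OF that] by auto
    show "AE x in lebesgue. norm (h x * g (u x) * \<phi> x) \<le> norm (B * K * \<bar>\<phi> x\<bar>)"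
    proof (rule AE_I2)
      fix x
      have "h x * g (u x) \<le> B * K" "0 \<le> h x * g (u x)"
        using h0[of x] hB[of x] gK[of "u x"] B0 by (auto intro!: mult_mono mult_nonneg_nonneg less_imp_le[OF gK(1)])
      then show "norm (h x * g (u x) * \<phi> x) \<le> norm (B * K * \<bar>\<phi> x\<bar>)"
        unfolding real_norm_def abs_mult[of _ "\<phi> x"] abs_mult[of _ "\<bar>\<phi> x\<bar>"] abs_abs
        by (intro mult_right_mono) auto
    qed
  qed (use Wmeas[OF that] in measurable)
  \<comment> \<open>Minimality against \<open>u + t * \<phi>\<close> with \<open>t\<close>
    decreasing to \<open>0\<close> yields an inequality; applying it to \<open>- \<phi>\<close> as
    well gives the equation.\<close>
  have EL: "(\<integral>x. h x * g (u x) * \<phi> x \<partial>lebesgue) \<le> form u \<phi>"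
    if \<phi>: "\<phi> \<in> W" for \<phi>
  proof -
    define t where "t = (\<lambda>n. 1 / real (Suc n))"
    have t: "0 < t n" "t n \<le> 1" for n by (auto simp: t_def)
    have [measurable]: "\<phi> \<in> borel_measurable lebesgue" using Wmeas[OF \<phi>] .
    define v where "v = (\<lambda>n x. u x + t n * \<phi> x)"
    have vW: "v n \<in> W" for n
      using frac_sobolev_zero_add[OF _ frac_sobolev_zero_cmult, of u A \<phi> "t n"] uW \<phi> by (simp add: W_def v_def)
    let ?Q = "\<lambda>n z. (\<bar>increment u z + t n * increment \<phi> z\<bar> powr p - \<bar>increment u z\<bar> powr p) / t n"
    let ?R = "\<lambda>n x. h x * ((G (u x + t n * \<phi> x) - G (u x)) / t n)"
    have incv: "increment (v n) z = increment u z + t n * increment \<phi> z" for n z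
      by (simp add: v_def increment_def algebra_simps)
    have F3: "integrable \<mu> (\<lambda>z. \<bar>increment u z\<bar> powr p)"
        "integrable \<mu> (\<lambda>z. \<bar>increment (v n) z\<bar> powr p)" for n
      using uW vW frac_sobolev_zeroD(3) unfolding W_def by blast+
    have Fsum: "integrable \<mu> (\<lambda>z. \<bar>increment u z\<bar> powr p + \<bar>increment u z + increment \<phi> z\<bar> powr p + \<bar>increment u z - increment \<phi> z\<bar> powr p)"
    proof -
      have "(\<lambda>x. u x + \<phi> x) \<in> W" "(\<lambda>x. u x - \<phi> x) \<in> W"
        using uW \<phi> frac_sobolev_zero_add frac_sobolev_zero_diff unfolding W_def by blast+
      then have "integrable \<mu> (\<lambda>z. \<bar>increment (\<lambda>x. u x + \<phi> x) z\<bar> powr p)"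
        "integrable \<mu> (\<lambda>z. \<bar>increment (\<lambda>x. u x - \<phi> x) z\<bar> powr p)"
        using frac_sobolev_zeroD(3) unfolding W_def by blast+
      moreover have "increment (\<lambda>x. u x + \<phi> x) z = increment u z + increment \<phi> z"
        "increment (\<lambda>x. u x - \<phi> x) z = increment u z - increment \<phi> z" for z
        by (simp_all add: increment_def)
      ultimately show ?thesis using F3(1) by auto
    qed
    have limE: "(\<lambda>n. \<integral>z. ?Q n z \<partial>\<mu>) \<longlonglongrightarrow> (\<integral>z. p * signed_power p (increment u z) * increment \<phi> z \<partial>\<mu>)"
    proof (rule integral_dominated_convergence[OF _ _ Fsum])
      show "AE z in \<mu>. (\<lambda>n. ?Q n z) \<longlonglongrightarrow> p * signed_power p (increment u z) * increment \<phi> z"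
        using DERIV_sequence_at_0[OF has_real_derivative_abs_powr[OF p_gt]] by (simp add: t_def)
      show "AE z in \<mu>. norm (?Q n z) \<le> \<bar>increment u z\<bar> powr p + \<bar>increment u z + increment \<phi> z\<bar> powr p + \<bar>increment u z - increment \<phi> z\<bar> powr p" for n
        using convex_difference_quotient[OF convex_abs_powr[OF p_gt] _ t] by (simp only: real_norm_def powr_ge_zero) auto
    qed auto
    have limI: "(\<lambda>n. \<integral>x. ?R n x \<partial>lebesgue) \<longlonglongrightarrow> (\<integral>x. h x * (g (u x) * \<phi> x) \<partial>lebesgue)"
    proof (rule integral_dominated_convergence)
      show "integrable lebesgue (\<lambda>x. B * K * \<bar>\<phi> x\<bar>)" using wint[OF \<phi>] by auto
      show "AE x in lebesgue. (\<lambda>n. ?R n x) \<longlonglongrightarrow> h x * (g (u x) * \<phi> x)"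
        using DERIV_sequence_at_0[OF G] by (auto simp: t_def intro!: tendsto_mult_left)
      show "AE x in lebesgue. norm (?R n x) \<le> B * K * \<bar>\<phi> x\<bar>" for n
      proof (rule AE_I2)
        fix x
        have "norm (?R n x) = \<bar>h x * (G (u x + t n * \<phi> x) - G (u x))\<bar> / t n"
          using t(1)[of n] by (simp add: abs_mult)
        also have "\<dots> \<le> (B * K * \<bar>t n * \<phi> x\<bar>) / t n"
          using hG[of x "u x + t n * \<phi> x" "u x"] t(1)[of n] by (intro divide_right_mono) auto
        finally show "norm (?R n x) \<le> B * K * \<bar>\<phi> x\<bar>" using t(1)[of n] by (simp add: abs_mult)
      qed
    qed measurable
    have "0 \<le> (\<integral>z. ?Q n z \<partial>\<mu>) / p - (\<integral>x. ?R n x \<partial>lebesgue)" for n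
    proof -
      have "(\<integral>z. ?Q n z \<partial>\<mu>) = (\<E> (v n) - \<E> u) / t n"
        unfolding seminorm_powr_def incv[symmetric] using F3 by (simp add: Bochner_Integration.integral_diff)
      moreover have "(\<integral>x. ?R n x \<partial>lebesgue) = (I (v n) - I u) / t n"
      proof -
        have "(\<integral>x. ?R n x \<partial>lebesgue) = (\<integral>x. (h x * G (v n x) - h x * G (u x)) / t n \<partial>lebesgue)"
          by (simp add: v_def right_diff_distrib)
        then show ?thesis unfolding I_def using hGi[OF vW] hGi[OF uW] by (simp add: Bochner_Integration.integral_diff)
      qed
      ultimately have "(\<integral>z. ?Q n z \<partial>\<mu>) / p - (\<integral>x. ?R n x \<partial>lebesgue) = (J (v n) - J u) / t n"
        unfolding J_def by (simp add: diff_divide_distrib mult.commute)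
      also have "0 \<le> \<dots>" using Ju[OF vW, of n] t(1)[of n] by simp
      finally show ?thesis .
    qed
    moreover have "(\<lambda>n. (\<integral>z. ?Q n z \<partial>\<mu>) / p - (\<integral>x. ?R n x \<partial>lebesgue)) \<longlonglongrightarrow>
      (\<integral>z. p * signed_power p (increment u z) * increment \<phi> z \<partial>\<mu>) / p - (\<integral>x. h x * (g (u x) * \<phi> x) \<partial>lebesgue)"
      using p_pos by (intro tendsto_intros limE limI) auto
    ultimately have "0 \<le> (\<integral>z. p * signed_power p (increment u z) * increment \<phi> z \<partial>\<mu>) / p - (\<integral>x. h x * (g (u x) * \<phi> x) \<partial>lebesgue)"
      by (intro LIMSEQ_le_const) auto
    then show ?thesis using p_pos by (simp add: mult.assoc)
  qed
  show thesis
  proof (rule that[of u])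
    show "u \<in> \<W> A" using uW by (simp add: W_def)
    show "0 \<le> u x" for x by (rule u_pos)
    fix \<phi> assume "\<phi> \<in> \<W> A"
    then have \<phi>: "\<phi> \<in> W" by (simp add: W_def)
    have m\<phi>: "(\<lambda>x. - \<phi> x) \<in> W"
      using frac_sobolev_zero_cmult[of \<phi> A "-1"] \<phi> by (simp add: W_def)
    have "increment (\<lambda>x. - \<phi> x) z = - increment \<phi> z" for z by (simp add: increment_def)
    then have "form u \<phi> = (\<integral>x. h x * g (u x) * \<phi> x \<partial>lebesgue)"
      using EL[OF \<phi>] EL[OF m\<phi>] by simp
    moreover have "g (u x) = (u x + a) powr (- \<gamma>)" for x
      using u_pos[of x] by (simp add: g_def max_def)
    ultimately show "integrable lebesgue (\<lambda>x. h x * (u x + a) powr (- \<gamma>) * \<phi> x) \<and>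
      form u \<phi> =
      (\<integral>x. h x * (u x + a) powr (- \<gamma>) * \<phi> x \<partial>lebesgue)"
      using hgi[OF \<phi>] by simp
  qed
qed

end

context frac_exponents
begin

text \<open>On \<open>[0, M]\<close> the power is Lipschitz with constant
  \<open>\<theta> * M powr (\<theta> - 1)\<close>. Truncation makes powers of \<open>u\<close>
  admissible although no bound on \<open>u\<close> has been established.\<close>

lemma truncated_powr_in_frac_sobolev_zero:
  assumes u: "u \<in> \<W> A" and u0: "\<And>x. 0 \<le> u x" and M: "0 \<le> M" and \<theta>: "1 \<le> \<theta>"
  shows "(\<lambda>x. min (u x) M powr \<theta>) \<in> \<W> A"
proof (rule frac_sobolev_zero_contract[OF u])
  show "(\<lambda>x. min (u x) M powr \<theta>) \<in> borel_measurable lebesgue"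
    using frac_sobolev_zeroD(1)[OF u] by measurable
  show "0 \<le> \<theta> * M powr (\<theta> - 1)" using \<theta> by simp
  have *: "\<bar>min a M powr \<theta> - min b M powr \<theta>\<bar> \<le> \<theta> * M powr (\<theta> - 1) * \<bar>a - b\<bar>"
    if "0 \<le> b" "b \<le> a" for a b
  proof -
    have mono: "min b M powr \<theta> \<le> min a M powr \<theta>" using that M \<theta> by (intro powr_mono2) auto
    have "min a M powr \<theta> - min b M powr \<theta> \<le> \<theta> * min a M powr (\<theta> - 1) * (min a M - min b M)"
      using that M \<theta> by (intro powr_diff_le) auto
    also have "\<dots> \<le> \<theta> * M powr (\<theta> - 1) * (a - b)"
      using that M \<theta> by (intro mult_mono powr_mono2) auto
    finally show ?thesis using mono that by simp
  qed
  have **: "\<bar>min a M powr \<theta> - min b M powr \<theta>\<bar> \<le> \<theta> * M powr (\<theta> - 1) * \<bar>a - b\<bar>" if "0 \<le> a" "0 \<le> b" for a b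
    using *[of a b] *[of b a] that by (cases "a \<le> b") (auto simp: abs_minus_commute)
  show "AE z in \<mu>. \<bar>increment (\<lambda>x. min (u x) M powr \<theta>) z\<bar> \<le> \<theta> * M powr (\<theta> - 1) * \<bar>increment u z\<bar>"
    unfolding increment_def using ** u0 by simp
  show "AE x in lebesgue. \<bar>min (u x) M powr \<theta>\<bar> \<le> \<theta> * M powr (\<theta> - 1) * \<bar>u x\<bar>"
    using **[OF u0, of 0] M by simp
qed

end

section \<open>Comparison, translation and nontriviality of regularized solutions\<close>

context frac_domain
begin

text \<open>Domain, weight and shift are parameters, so that one comparison statement covers both
  the monotonicity of the approximations and the barrier on a small ball.\<close>

definition regularized_solution :: "'a set \<Rightarrow> ('a \<Rightarrow> real) \<Rightarrow> real \<Rightarrow> real \<Rightarrow> ('a \<Rightarrow> real) \<Rightarrow> bool" where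
  "regularized_solution A h a \<gamma> u \<longleftrightarrow> u \<in> \<W> A \<and> (\<forall>x. 0 \<le> u x) \<and>
     (\<forall>\<phi>\<in>\<W> A.
      integrable lebesgue (\<lambda>x. h x * (u x + a) powr (- \<gamma>) * \<phi> x) \<and>
      form u \<phi> =
      (\<integral>x. h x * (u x + a) powr (- \<gamma>) * \<phi> x \<partial>lebesgue))"

text \<open>Where \<open>u > v\<close> the right-hand side for \<open>u\<close> is the smaller one,
  so the positive part of \<open>u - v\<close>, tested in both equations, fulfils the hypothesis of
  \<open>weak_comparison\<close>. It is admissible on the smaller set \<open>A\<close>, since
  \<open>v \<ge> 0\<close> makes it vanish wherever \<open>u\<close> does.\<close>

lemma regularized_comparison:
  assumes u: "regularized_solution A h a \<gamma> u" and v: "regularized_solution A' h' a' \<gamma> v"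
    and A: "A \<subseteq> A'" "A' \<subseteq> \<Omega>" and h: "\<And>x. x \<in> A \<Longrightarrow> 0 \<le> h x \<and> h x \<le> h' x"
    and a: "0 < a'" "a' \<le> a" and \<gamma>: "0 < \<gamma>"
  shows "AE x in lebesgue. u x \<le> v x"
proof -
  have uW: "u \<in> \<W> A" and vW: "v \<in> \<W> A'"
    and u0: "0 \<le> u x" and v0: "0 \<le> v x" for x
    using u v by (auto simp: regularized_solution_def)
  define \<phi> where "\<phi> = (\<lambda>x. max (u x - v x) 0)"
  have \<phi>': "\<phi> \<in> \<W> A'"
    unfolding \<phi>_def using frac_sobolev_zero_mono[OF uW A(1)] vW
    by (intro frac_sobolev_zero_max0 frac_sobolev_zero_diff)
  have off: "AE x in lebesgue. x \<notin> A \<longrightarrow> \<phi> x = 0"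
    using frac_sobolev_zeroD(4)[OF uW] by eventually_elim (use v0 in \<open>auto simp: \<phi>_def\<close>)
  have \<phi>: "\<phi> \<in> \<W> A"
    using \<phi>' off by (simp add: frac_sobolev_zero_iff)
  have eu: "integrable lebesgue (\<lambda>x. h x * (u x + a) powr (- \<gamma>) * \<phi> x)"
      "form u \<phi> = (\<integral>x. h x * (u x + a) powr (- \<gamma>) * \<phi> x \<partial>lebesgue)"
    using u \<phi> by (auto simp: regularized_solution_def)
  have ev: "integrable lebesgue (\<lambda>x. h' x * (v x + a') powr (- \<gamma>) * \<phi> x)"
      "form v \<phi> = (\<integral>x. h' x * (v x + a') powr (- \<gamma>) * \<phi> x \<partial>lebesgue)"
    using v \<phi>' by (auto simp: regularized_solution_def)
  have "(\<integral>x. h x * (u x + a) powr (- \<gamma>) * \<phi> x \<partial>lebesgue) \<le> (\<integral>x. h' x * (v x + a') powr (- \<gamma>) * \<phi> x \<partial>lebesgue)"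
  proof (rule integral_mono_AE[OF eu(1) ev(1)])
    show "AE x in lebesgue. h x * (u x + a) powr (- \<gamma>) * \<phi> x \<le> h' x * (v x + a') powr (- \<gamma>) * \<phi> x"
      using off
    proof eventually_elim
      case (elim x)
      show ?case
      proof (cases "x \<in> A \<and> v x < u x")
        case True
        then have "(u x + a) powr (- \<gamma>) \<le> (v x + a') powr (- \<gamma>)"
          using a \<gamma> v0[of x] by (intro powr_mono2') auto
        then show ?thesis using True h[of x] by (intro mult_right_mono mult_mono) (auto simp: \<phi>_def)
      next
        case False
        then have "\<phi> x = 0" using elim by (auto simp: \<phi>_def)
        then show ?thesis by simp
      qed
    qed
  qed
  then show ?thesis
    using eu(2) ev(2)
    by (intro weak_comparison[OF frac_sobolev_zero_mono[OF \<phi>' A(2)] _ integrable_form[OF uW \<phi>] integrable_form[OF vW \<phi>]]) (auto simp: \<phi>_def)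
qed

lemma regularized_solution_translate:
  assumes u: "regularized_solution (ball x0 r) (\<lambda>_. c) a \<gamma> u"
  shows "regularized_solution (ball (x0 + t) r) (\<lambda>_. c) a \<gamma> (\<lambda>x. u (- t + x))"
  unfolding regularized_solution_def
proof (intro conjI allI ballI)
  have uW: "u \<in> \<W> (ball x0 r)" using u by (simp add: regularized_solution_def)
  show v: "(\<lambda>x. u (- t + x)) \<in> \<W> (ball (x0 + t) r)"
    by (rule frac_sobolev_zero_translate[OF uW]) (simp add: dist_norm algebra_simps)
  show "0 \<le> u (- t + x)" for x using u by (simp add: regularized_solution_def)
  fix \<phi> :: "'a \<Rightarrow> real" assume \<phi>: "\<phi> \<in> \<W> (ball (x0 + t) r)"
  let ?\<psi> = "\<lambda>x. \<phi> (t + x)"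
  have \<psi>: "?\<psi> \<in> \<W> (ball x0 r)"
    by (rule frac_sobolev_zero_translate[OF \<phi>]) (simp add: dist_norm algebra_simps)
  have *: "integrable lebesgue (\<lambda>x. c * (u x + a) powr (- \<gamma>) * ?\<psi> x)"
    "form u ?\<psi> =
      (\<integral>x. c * (u x + a) powr (- \<gamma>) * ?\<psi> x \<partial>lebesgue)"
    using u \<psi> by (auto simp: regularized_solution_def)
  note [measurable] = frac_sobolev_zeroD(1)[OF uW] frac_sobolev_zeroD(1)[OF v] frac_sobolev_zeroD(1)[OF \<phi>]
  let ?F = "\<lambda>x. c * (u (- t + x) + a) powr (- \<gamma>) * \<phi> x"
  have F: "?F \<in> borel_measurable lebesgue" by measurable
  show "integrable lebesgue ?F"
    using *(1) integrable_lebesgue_translate[OF F, of t] by simp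
  let ?E = "\<lambda>z. signed_power p (increment (\<lambda>x. u (- t + x)) z) * increment \<phi> z"
  have E: "?E \<in> borel_measurable lebesgue" by measurable
  have "?E ((t, t) + z) = signed_power p (increment u z) * increment ?\<psi> z" for z
    by (simp add: increment_def)
  then have "(\<integral>z. ?E z \<partial>\<mu>) = form u ?\<psi>"
    using gagliardo_measure_translate(2)[OF E, of t] by simp
  also have "\<dots> = (\<integral>x. ?F x \<partial>lebesgue)"
    using *(2) integral_lebesgue_translate[OF F, of t] by simp
  finally show "(\<integral>z. ?E z \<partial>\<mu>) = (\<integral>x. ?F x \<partial>lebesgue)" .
qed

text \<open>For a function vanishing almost everywhere the form is \<open>0\<close>, while the
  right-hand side tested with a bump positive on the ball is not, because the shift \<open>a\<close>
  keeps the nonlinearity finite and positive.\<close>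

lemma regularized_solution_nontrivial:
  assumes u: "regularized_solution (ball x0 r) (\<lambda>_. c) a \<gamma> u" and "0 < c" "0 < a" "0 < r"
  shows "\<not> (AE x in lebesgue. u x = 0)"
proof
  assume 0: "AE x in lebesgue. u x = 0"
  obtain \<phi> where \<phi>: "\<phi> \<in> \<W> (ball x0 r)" "\<And>x. 0 \<le> \<phi> x" "\<And>x. x \<in> ball x0 r \<Longrightarrow> 0 < \<phi> x"
    using ex_bump[OF \<open>0 < r\<close>] by blast
  have u0: "0 \<le> u x" for x using u by (auto simp: regularized_solution_def)
  have *: "integrable lebesgue (\<lambda>x. c * (u x + a) powr (- \<gamma>) * \<phi> x)"
    "form u \<phi> =
      (\<integral>x. c * (u x + a) powr (- \<gamma>) * \<phi> x \<partial>lebesgue)"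
    using u \<phi>(1) by (auto simp: regularized_solution_def)
  have "AE z in \<mu>. signed_power p (increment u z) * increment \<phi> z = 0"
    using AE_increment_cong[OF 0, of s p] by eventually_elim (simp add: increment_def)
  then have "(\<integral>x. c * (u x + a) powr (- \<gamma>) * \<phi> x \<partial>lebesgue) = 0"
    unfolding *(2)[symmetric] by (rule integral_eq_zero_AE)
  then have "AE x in lebesgue. c * (u x + a) powr (- \<gamma>) * \<phi> x = 0"
    using integral_nonneg_eq_0_iff_AE[OF *(1)] \<phi>(2) \<open>0 < c\<close> by auto
  then have "AE x in lebesgue. x \<notin> ball x0 r"
  proof eventually_elim
    case (elim x)
    have "0 < (u x + a) powr (- \<gamma>)" using u0[of x] \<open>0 < a\<close> by simp
    then show ?case using elim \<phi>(3)[of x] \<open>0 < c\<close> by auto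
  qed
  then have "ball x0 r \<in> null_sets lebesgue" using AE_iff_null_sets[of "ball x0 r" lebesgue] by auto
  then have "measure lborel (ball x0 r) = 0"
    by (simp add: null_sets_def measure_def)
  then show False using content_ball_pos[OF \<open>0 < r\<close>, of x0] by simp
qed

text \<open>A function that dominates all small translates of \<open>w\<close> dominates the essential supremum of \<open>w\<close>
  over nearby balls.\<close>

lemma lower_bound_from_translates:
  fixes w :: "'a \<Rightarrow> real"
  assumes w: "w \<in> borel_measurable lebesgue" and w0: "\<And>x. 0 \<le> w x" "AE x in lebesgue. x \<notin> ball x0 r \<longrightarrow> w x = 0"
    and nz: "\<not> (AE x in lebesgue. w x = 0)"
  obtains c where "0 < c" "\<And>u. u \<in> borel_measurable lebesgue \<Longrightarrow>
    (\<And>t. norm t < 2 * r \<Longrightarrow> AE x in lebesgue. w (- t + x) \<le> u x) \<Longrightarrow> AE x in lebesgue. x \<in> ball x0 r \<longrightarrow> c \<le> u x"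
proof -
  obtain w' where w'[measurable]: "w' \<in> borel_measurable borel" and ww': "AE x in lborel. w x = w' x"
    using completion_ex_borel_measurable_real[OF w] by auto
  have ww: "AE x in lebesgue. w x = w' x" using ww' by (simp add: AE_completion_iff)
  \<comment> \<open>These sets exhaust the part of the ball where \<open>w'\<close> is positive, so
    one of them has positive measure; its level \<open>1 / Suc n\<close> becomes the lower
    bound.\<close>
  define S where "S = (\<lambda>n::nat. {x \<in> ball x0 r. 1 / real (Suc n) < w' x})"
  have S[measurable]: "S n \<in> sets borel" for n unfolding S_def by measurable
  have "\<exists>n. emeasure lborel (S n) \<noteq> 0"
  proof (rule ccontr)
    assume "\<not> ?thesis"
    then have "AE x in lborel. x \<notin> S n" for n by (intro AE_not_in) (auto simp: null_sets_def)
    then have "AE x in lborel. \<forall>n. x \<notin> S n" by (simp add: AE_all_countable)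
    then have "AE x in lebesgue. \<forall>n. x \<notin> S n" by (rule AE_completion)
    then have "AE x in lebesgue. w x = 0" using ww w0(2)
    proof eventually_elim
      case (elim x)
      show ?case
      proof (rule ccontr)
        assume "w x \<noteq> 0"
        then have "x \<in> ball x0 r" "0 < w' x" using elim w0(1)[of x] by (auto simp: less_le)
        moreover obtain n where "1 / real (Suc n) < w' x"
          using reals_Archimedean[OF \<open>0 < w' x\<close>] by (auto simp: inverse_eq_divide)
        ultimately show False using elim(1) by (auto simp: S_def)
      qed
    qed
    with nz show False by simp
  qed
  then obtain n where n: "emeasure lborel (S n) \<noteq> 0" by blast
  show thesis
  proof (rule that[of "1 / real (Suc n)"])
    fix u assume u: "u \<in> borel_measurable lebesgue" and le: "\<And>t. norm t < 2 * r \<Longrightarrow> AE x in lebesgue. w (- t + x) \<le> u x"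
    obtain u' where u'[measurable]: "u' \<in> borel_measurable borel" and uu': "AE x in lborel. u x = u' x"
      using completion_ex_borel_measurable_real[OF u] by auto
    have "AE x in lborel. norm t < 2 * r \<longrightarrow> w' (x - t) \<le> u' x" for t
    proof (cases "norm t < 2 * r")
      case True
      have "AE x in lborel. w (- t + x) \<le> u x" using le[OF True] by (simp add: AE_completion_iff)
      moreover have "AE x in lborel. w (- t + x) = w' (- t + x)"
        using AE_lebesgue_translate[OF ww, of "- t"] by (simp add: AE_completion_iff)
      ultimately show ?thesis using uu' by eventually_elim simp
    qed simp
    \<comment> \<open>The exceptional set in \<open>x\<close> depends on \<open>t\<close>. Fubini's
      theorem, for which the Borel representatives were taken, exchanges the quantifiers: for almost
      every \<open>x\<close> the inequality holds for almost all \<open>t\<close>.\<close>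
    then have "AE t in lborel. AE x in lborel. norm t < 2 * r \<longrightarrow> w' (x - t) \<le> u' x" by simp
    then have "AE x in lborel. AE t in lborel. norm t < 2 * r \<longrightarrow> w' (x - t) \<le> u' x"
    proof (subst (asm) lborel_pair.AE_commute)
      have "(\<lambda>z::'a\<times>'a. snd z - fst z) \<in> borel_measurable borel"
        by (rule borel_measurable_continuous_onI) (intro continuous_intros)
      then have m: "(\<lambda>z::'a\<times>'a. snd z - fst z) \<in> borel_measurable (lborel \<Otimes>\<^sub>M lborel)"
        by (simp add: lborel_prod)
      then have [measurable]: "(\<lambda>z::'a\<times>'a. w' (snd z - fst z)) \<in> borel_measurable (lborel \<Otimes>\<^sub>M lborel)"
        by (rule measurable_compose[OF _ w'])
      show "{x \<in> space (lborel \<Otimes>\<^sub>M lborel). norm (fst x) < 2 * r \<longrightarrow> w' (snd x - fst x) \<le> u' (snd x)} \<in> sets (lborel \<Otimes>\<^sub>M lborel)"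
        by measurable
    qed
    then have "AE x in lborel. x \<in> ball x0 r \<longrightarrow> 1 / real (Suc n) \<le> u x"
      using uu'
    proof eventually_elim
      case (elim x)
      show ?case
      proof
        assume x: "x \<in> ball x0 r"
        obtain N where N: "{t. \<not> (norm t < 2 * r \<longrightarrow> w' (x - t) \<le> u' x)} \<subseteq> N" "N \<in> null_sets lborel"
          using elim(1) by (auto elim!: AE_E simp: null_sets_def)
        \<comment> \<open>The set of \<open>t\<close> with \<open>x - t\<close> in
          \<open>S n\<close> is a reflected and shifted copy of \<open>S n\<close>; having positive
          measure, it is not contained in a null set.\<close>
        have "\<not> (\<lambda>t. x - t) -` S n \<subseteq> N"
        proof
          assume sub: "(\<lambda>t. x - t) -` S n \<subseteq> N"
          have "emeasure lborel (S n) = (\<integral>\<^sup>+y. indicator (S n) (x - y) \<partial>lborel)"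
            using nn_integral_lborel_reflect[of "indicator (S n)" x] by simp
          also have "\<dots> \<le> (\<integral>\<^sup>+y. indicator N y \<partial>lborel)"
            by (intro nn_integral_mono) (use sub in \<open>auto simp: indicator_def\<close>)
          also have "\<dots> = 0" using N(2) by (simp add: null_sets_def)
          finally show False using n by simp
        qed
        then obtain t where t: "x - t \<in> S n" "t \<notin> N" by auto
        have "norm t \<le> dist x x0 + dist x0 (x - t)"
          using dist_triangle[of x "x - t" x0] by (simp add: dist_norm)
        \<comment> \<open>Both \<open>x\<close> and \<open>x - t\<close> lie in
          \<open>ball x0 r\<close>, which explains the range of translations in the
          statement.\<close>
        then have "norm t < 2 * r" using x t(1) by (auto simp: S_def dist_commute)
        then have "w' (x - t) \<le> u' x" using t(2) N(1) by blast
        then show "1 / real (Suc n) \<le> u x" using t(1) elim(2) by (auto simp: S_def)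
      qed
    qed
    then show "AE x in lebesgue. x \<in> ball x0 r \<longrightarrow> 1 / real (Suc n) \<le> u x" by (rule AE_completion)
  qed simp
qed

end

lemma powr_abs_eq [simp]: "\<bar>a\<bar> powr q = a powr q" for a q :: real
  by (simp add: abs_if uminus_powr_eq)

lemma (in frac_domain) regularized_solution_exists:
  assumes "A \<subseteq> \<Omega>" "h \<in> borel_measurable lebesgue" "\<And>x. 0 \<le> h x" "\<And>x. h x \<le> B" "0 < a" "0 < \<gamma>"
  shows "\<exists>u. regularized_solution A h a \<gamma> u"
  by (rule ex_regularized_solution[OF assms]) (auto simp: regularized_solution_def)

section \<open>Uniform estimates\<close>

locale frac_problem = frac_domain s p \<Omega> for s p :: real and \<Omega> :: "'a::euclidean_space set" +
  fixes \<gamma> \<delta> C1 C2 :: real and K :: "'a \<Rightarrow> real"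
  assumes \<gamma>_pos: "0 < \<gamma>" and \<delta>_pos: "0 < \<delta>" and \<delta>_less: "\<delta> < s * p"
    and K_measurable: "K \<in> borel_measurable (lebesgue_on \<Omega>)"
    and C1_pos: "0 < C1" and C2_pos: "0 < C2"
    and K_lower: "\<And>x. x \<in> \<Omega> \<Longrightarrow> C1 * d x powr (- \<delta>) \<le> K x"
    and K_upper: "\<And>x. x \<in> \<Omega> \<Longrightarrow> K x \<le> C2 * d x powr (- \<delta>)"
begin

lemma K_pos: "x \<in> \<Omega> \<Longrightarrow> 0 < K x"
  using K_lower[of x] C1_pos d_pos[of x] by (smt (verit) mult_pos_pos powr_gt_zero)

section \<open>The exhaustion by interior sets and the approximate solutions\<close>

definition core :: "nat \<Rightarrow> 'a set" where
  "core n = {x \<in> \<Omega>. 1 / real (Suc n) < d x}"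

lemma core_subset: "core n \<subseteq> \<Omega>"
  by (auto simp: core_def)

lemma core_mono: "m \<le> n \<Longrightarrow> core m \<subseteq> core n"
proof -
  assume "m \<le> n"
  then have "1 / real (Suc n) \<le> 1 / real (Suc m)" by (intro divide_left_mono) auto
  then show ?thesis by (auto simp: core_def)
qed

lemma open_core: "open (core n)"
proof -
  have "open {x. 1 / real (Suc n) < d x}"
    using continuous_on_d by (intro open_Collect_less) (auto intro!: continuous_intros)
  then have "open (\<Omega> \<inter> {x. 1 / real (Suc n) < d x})" using open_domain by blast
  also have "\<Omega> \<inter> {x. 1 / real (Suc n) < d x} = core n" by (auto simp: core_def)
  finally show ?thesis .
qed

lemma core_measurable [measurable]: "core n \<in> sets lebesgue"
  using open_core by auto

lemma core_compactly_contained: "core n \<Subset> \<Omega>"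
  unfolding compactly_contained_def
proof
  show "compact (closure (core n))"
    using bounded_subset[OF bounded_domain core_subset] by simp
  have "closed {x. 1 / real (Suc n) \<le> d x}"
    using continuous_on_d by (intro closed_Collect_le) (auto intro!: continuous_intros)
  then have "closure (core n) \<subseteq> {x. 1 / real (Suc n) \<le> d x}"
    by (intro closure_minimal) (auto simp: core_def)
  moreover have "closure (core n) \<subseteq> \<Omega> \<union> frontier \<Omega>"
    using closure_mono[OF core_subset[of n]] closure_Un_frontier[of \<Omega>] by blast
  moreover have "d x = 0" if "x \<in> frontier \<Omega>" for x
    using that by (simp add: d_def)
  ultimately show "closure (core n) \<subseteq> \<Omega>" by fastforce
qed

lemma compact_subset_core:
  assumes "compact C" "C \<subseteq> \<Omega>"
  obtains m where "C \<subseteq> core m"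
proof (cases "C = {}")
  case False
  obtain x where x: "x \<in> C" "\<And>y. y \<in> C \<Longrightarrow> d x \<le> d y"
    using continuous_attains_inf[OF assms(1) False continuous_on_d] by blast
  then have "0 < d x" using assms d_pos by blast
  then obtain m where "1 / real (Suc m) < d x"
    using reals_Archimedean by (auto simp: inverse_eq_divide)
  then have "C \<subseteq> core m" using x assms(2) by (force simp: core_def)
  then show thesis by (rule that)
qed (use that in auto)

text \<open>Provides the positive distance required by \<open>strip_energy\<close>, between a
  compact set and the closed complement of an open \<open>core m\<close> containing it.\<close>

lemma compactly_contained_separated:
  assumes "A \<Subset> \<Omega>"
  obtains m \<rho> where "closure A \<subseteq> core m" "0 < \<rho>" "\<And>x y. x \<in> A \<Longrightarrow> y \<notin> core m \<Longrightarrow> \<rho> \<le> dist x y"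
proof -
  have c: "compact (closure A)" "closure A \<subseteq> \<Omega>" using assms by (auto simp: compactly_contained_def)
  obtain m where m: "closure A \<subseteq> core m" using compact_subset_core[OF c] by blast
  have "closed (- core m)" using open_core by (simp add: closed_Compl)
  then obtain \<rho> where "0 < \<rho>" "\<And>x y. x \<in> closure A \<Longrightarrow> y \<in> - core m \<Longrightarrow> \<rho> \<le> dist x y"
    using separate_compact_closed[OF c(1), of "- core m"] m by blast
  then show thesis using that[OF m, of \<rho>] closure_subset by blast
qed

definition source :: "nat \<Rightarrow> 'a \<Rightarrow> real" where
  "source n x = indicator (core n) x * K x"

lemma source_measurable [measurable]: "source n \<in> borel_measurable lebesgue"
proof -
  have [measurable]: "(\<lambda>x. indicator \<Omega> x * K x) \<in> borel_measurable lebesgue"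
    using K_measurable by (subst (asm) borel_measurable_restrict_space_iff) auto
  have "source n = (\<lambda>x. indicator (core n) x * (indicator \<Omega> x * K x))"
    using core_subset by (fastforce simp: source_def indicator_def)
  then show ?thesis by simp
qed

lemma source_nonneg: "0 \<le> source n x"
  using K_pos core_subset by (force simp: source_def indicator_def intro: less_imp_le)

lemma K_core_le: "x \<in> core n \<Longrightarrow> K x \<le> C2 * real (Suc n) powr \<delta>"
proof -
  assume x: "x \<in> core n"
  have "d x powr (- \<delta>) \<le> (1 / real (Suc n)) powr (- \<delta>)"
    using x \<delta>_pos by (intro powr_mono2') (auto simp: core_def)
  also have "\<dots> = real (Suc n) powr \<delta>" by (simp add: powr_divide powr_minus_divide)
  finally show ?thesis using K_upper[of x] x core_subset C2_pos
    by (meson mult_left_mono less_imp_le order_trans subsetD)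
qed

lemma source_le: "source n x \<le> C2 * real (Suc n) powr \<delta>"
  using K_core_le[of x n] C2_pos by (auto simp: source_def indicator_def)

definition sol :: "nat \<Rightarrow> 'a \<Rightarrow> real" where
  "sol n = (SOME u. regularized_solution (core n) (source n) (1 / real (Suc n)) \<gamma> u)"

lemma sol: "regularized_solution (core n) (source n) (1 / real (Suc n)) \<gamma> (sol n)"
proof -
  have "0 < 1 / real (Suc n)" by simp
  from regularized_solution_exists[OF core_subset[of n] source_measurable[of n] source_nonneg[of n] source_le[of n] this \<gamma>_pos]
  show ?thesis unfolding sol_def by (rule someI_ex)
qed

lemma sol_mem: "sol n \<in> \<W> (core n)"
  and sol_nonneg: "0 \<le> sol n x"
  and sol_integrable: "\<phi> \<in> \<W> (core n) \<Longrightarrow>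
      integrable lebesgue (\<lambda>x. source n x * (sol n x + 1 / real (Suc n)) powr (- \<gamma>) * \<phi> x)"
  and sol_eq: "\<phi> \<in> \<W> (core n) \<Longrightarrow>
      form (sol n) \<phi> =
      (\<integral>x. source n x * (sol n x + 1 / real (Suc n)) powr (- \<gamma>) * \<phi> x \<partial>lebesgue)"
  using sol[of n] by (auto simp: regularized_solution_def)

lemma sol_measurable [measurable]: "sol n \<in> borel_measurable lebesgue"
  using frac_sobolev_zeroD(1)[OF sol_mem] .

lemma sol_mem_domain: "sol n \<in> \<W> \<Omega>"
  using frac_sobolev_zero_mono[OF sol_mem core_subset] .

lemma sol_Suc_le: "AE x in lebesgue. sol n x \<le> sol (Suc n) x"
proof (rule regularized_comparison[OF sol sol _ core_subset])
  show "core n \<subseteq> core (Suc n)" by (rule core_mono) simp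
  then show "0 \<le> source n x \<and> source n x \<le> source (Suc n) x" if "x \<in> core n" for x
    using that source_nonneg[of n x] by (auto simp: source_def)
qed (use \<gamma>_pos in \<open>auto simp: field_simps\<close>)

lemma incseq_sol: "AE x in lebesgue. incseq (\<lambda>n. sol n x)"
  using sol_Suc_le unfolding incseq_Suc_iff AE_all_countable by blast

text \<open>The barrier \<open>w\<close> has constant weight \<open>\<kappa>\<close>, a lower bound
  of \<open>K\<close>, and shift \<open>1\<close>, an upper bound of all shifts
  \<open>1 / Suc n\<close>. One and the same barrier therefore lies below every \<open>sol n\<close>
  whose \<open>core n\<close> contains the ball, and the constant is independent of
  \<open>n\<close>.\<close>

lemma sol_lower_bound_near:
  assumes "x0 \<in> \<Omega>"
  obtains r c n0 where "0 < r" "0 < c" "\<And>n. n0 \<le> n \<Longrightarrow> AE x in lebesgue. x \<in> ball x0 r \<longrightarrow> c \<le> sol n x"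
proof -
  obtain e where e: "0 < e" "cball x0 e \<subseteq> \<Omega>"
    using open_contains_cball_eq[OF open_domain] assms by blast
  \<comment> \<open>A ball of radius \<open>r\<close> whose centre is moved by less than
    \<open>2 * r\<close> stays inside \<open>cball x0 e\<close>.\<close>
  define r where "r = e / 3"
  have r: "0 < r" using e by (simp add: r_def)
  obtain m where m: "cball x0 e \<subseteq> core m" using compact_subset_core[OF compact_cball e(2)] by blast
  obtain D where D: "1 \<le> D" "\<And>x. x \<in> \<Omega> \<Longrightarrow> d x \<le> D" using d_bound by blast
  define \<kappa> where "\<kappa> = C1 * D powr (- \<delta>)"
  have \<kappa>: "0 < \<kappa>" using C1_pos D by (simp add: \<kappa>_def)
  have \<kappa>K: "\<kappa> \<le> K x" if "x \<in> \<Omega>" for x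
  proof -
    have "D powr (- \<delta>) \<le> d x powr (- \<delta>)" using D(2)[OF that] d_pos[OF that] \<delta>_pos by (intro powr_mono2') auto
    then have "\<kappa> \<le> C1 * d x powr (- \<delta>)" unfolding \<kappa>_def using C1_pos by simp
    also have "\<dots> \<le> K x" by (rule K_lower[OF that])
    finally show ?thesis .
  qed
  have ball_r: "ball x0 r \<subseteq> \<Omega>" using e by (auto simp: r_def)
  obtain w where w: "regularized_solution (ball x0 r) (\<lambda>_. \<kappa>) 1 \<gamma> w"
    using regularized_solution_exists[OF ball_r, of "\<lambda>_. \<kappa>" \<kappa> 1 \<gamma>] \<kappa> \<gamma>_pos by auto
  have wW: "w \<in> \<W> (ball x0 r)" and w0: "\<And>x. 0 \<le> w x"
    using w by (auto simp: regularized_solution_def)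
  obtain c where c: "0 < c" "\<And>u. u \<in> borel_measurable lebesgue \<Longrightarrow>
    (\<And>t. norm t < 2 * r \<Longrightarrow> AE x in lebesgue. w (- t + x) \<le> u x) \<Longrightarrow> AE x in lebesgue. x \<in> ball x0 r \<longrightarrow> c \<le> u x"
    using lower_bound_from_translates[OF frac_sobolev_zeroD(1)[OF wW] w0 frac_sobolev_zeroD(4)[OF wW]
        regularized_solution_nontrivial[OF w \<kappa> _ r]] by auto
  have "AE x in lebesgue. x \<in> ball x0 r \<longrightarrow> c \<le> sol n x" if n: "m \<le> n" for n
  proof (rule c(2)[OF sol_measurable])
    fix t :: 'a assume t: "norm t < 2 * r"
    have sub: "ball (x0 + t) r \<subseteq> core n"
    proof
      fix y assume "y \<in> ball (x0 + t) r"
      then have "dist x0 y < e"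
        using t dist_triangle[of x0 y "x0 + t"] by (simp add: r_def dist_norm)
      then have "y \<in> cball x0 e" by simp
      then show "y \<in> core n" using m core_mono[OF n] by blast
    qed
    show "AE x in lebesgue. w (- t + x) \<le> sol n x"
    proof (rule regularized_comparison[OF regularized_solution_translate[OF w] sol sub core_subset])
      show "0 \<le> \<kappa> \<and> \<kappa> \<le> source n x" if "x \<in> ball (x0 + t) r" for x
      proof -
        have "x \<in> core n" "x \<in> \<Omega>" using that sub core_subset by blast+
        then show ?thesis using \<kappa> \<kappa>K[of x] by (simp add: source_def)
      qed
    qed (use \<gamma>_pos in auto)
  qed
  then show thesis using that[OF r c(1)] by blast
qed

lemma sol_lower_bound:
  assumes "compact C" "C \<subseteq> \<Omega>"
  obtains c n0 where "0 < c" "\<And>n. n0 \<le> n \<Longrightarrow> AE x in lebesgue. x \<in> C \<longrightarrow> c \<le> sol n x"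
proof -
  have "\<exists>r c n0. 0 < r \<and> 0 < c \<and> (\<forall>n\<ge>n0. AE x in lebesgue. x \<in> ball x0 r \<longrightarrow> c \<le> sol n x)" if "x0 \<in> C" for x0
    using sol_lower_bound_near[of x0] assms(2) that by (metis subsetD)
  then obtain r c n0 where *: "\<And>x0. x0 \<in> C \<Longrightarrow> 0 < r x0 \<and> 0 < c x0 \<and> (\<forall>n\<ge>n0 x0. AE x in lebesgue. x \<in> ball x0 (r x0) \<longrightarrow> c x0 \<le> sol n x)"
    by metis
  obtain T where T: "T \<subseteq> C" "finite T" "C \<subseteq> (\<Union>t\<in>T. ball t (r t))"
  proof (rule compactE_image[OF assms(1), of C "\<lambda>t. ball t (r t)"])
    show "C \<subseteq> (\<Union>t\<in>C. ball t (r t))" using * by force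
  qed auto
  define c0 where "c0 = Min (insert 1 (c ` T))"
  define N where "N = Max (insert 0 (n0 ` T))"
  have "0 < c0" using T * by (auto simp: c0_def)
  moreover have "AE x in lebesgue. x \<in> C \<longrightarrow> c0 \<le> sol n x" if "N \<le> n" for n
  proof -
    have "AE x in lebesgue. x \<in> ball t (r t) \<longrightarrow> c0 \<le> sol n x" if t: "t \<in> T" for t
    proof -
      have "c0 \<le> c t" unfolding c0_def by (rule Min_le) (use t T in auto)
      moreover have "n0 t \<le> N" unfolding N_def by (rule Max_ge) (use t T in auto)
      moreover have "AE x in lebesgue. x \<in> ball t (r t) \<longrightarrow> c t \<le> sol n x"
        using *[of t] t T(1) \<open>n0 t \<le> N\<close> \<open>N \<le> n\<close> by (meson order_trans subsetD)
      ultimately show ?thesis by (auto elim!: eventually_mono)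
    qed
    then have "AE x in lebesgue. \<forall>t\<in>T. x \<in> ball t (r t) \<longrightarrow> c0 \<le> sol n x"
      unfolding AE_finite_all[OF T(2)] by blast
    then show ?thesis by eventually_elim (use T(3) in blast)
  qed
  ultimately show thesis by (rule that)
qed

text \<open>The power \<open>q = p - (p - 1 + \<gamma>) / \<theta>\<close> with which \<open>V = u powr \<theta>\<close> enters the right-hand side stays
  below \<open>p\<close>, so Young's inequality and Hardy's inequality absorb it as soon as \<open>s * q \<ge> \<delta>\<close>.\<close>

lemma truncated_energy_bound:
  assumes \<theta>: "1 \<le> \<theta>" and adm: "\<delta> \<le> s * (p - (p - 1 + \<gamma>) / \<theta>)"
  obtains C where "\<And>n M. 0 \<le> M \<Longrightarrow> \<E> (\<lambda>x. min (sol n x) M powr \<theta>) \<le> C"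
proof -
  define q where "q = p - (p - 1 + \<gamma>) / \<theta>"
  define \<beta> where "\<beta> = p * \<theta> - p + 1"
  have \<beta>: "1 \<le> \<beta>" using p_gt \<theta> mult_left_mono[of 1 \<theta> p] by (simp add: \<beta>_def)
  \<comment> \<open>The truncated solution to the power \<open>\<beta> - \<gamma>\<close>, the
    product of the test function and the nonlinearity, is thus \<open>V powr q\<close>.\<close>
  have q\<theta>: "\<theta> * q = \<beta> - \<gamma>" using \<theta> by (simp add: q_def \<beta>_def field_simps)
  have "0 < (p - 1 + \<gamma>) / \<theta>" using p_gt \<gamma>_pos \<theta> by (intro divide_pos_pos) auto
  then have q: "q < p" "\<delta> \<le> s * q" using adm by (auto simp: q_def)
  then have q0: "0 < q" using \<delta>_pos s_pos by (smt (verit) mult_nonneg_nonpos2 mult.commute)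
  obtain H where H: "0 < H" "\<And>u. u \<in> \<W> \<Omega> \<Longrightarrow>
       integrable lebesgue (\<lambda>x. indicator \<Omega> x * (\<bar>u x\<bar> powr p * d x powr - (s * p))) \<and>
       (\<integral>x. indicator \<Omega> x * (\<bar>u x\<bar> powr p * d x powr - (s * p)) \<partial>lebesgue) \<le> H * \<E> u"
    using Hardy by blast
  obtain D where D: "1 \<le> D" "\<And>x. x \<in> \<Omega> \<Longrightarrow> d x \<le> D" using d_bound by blast
  define c where "c = \<theta> powr p * C2 * D powr (s * q - \<delta>)"
  have c: "0 < c" using \<theta> C2_pos D by (simp add: c_def)
  \<comment> \<open>The factor \<open>1 / (2 * c * H)\<close> is chosen so that, after
    multiplication by \<open>c\<close> and by Hardy's constant \<open>H\<close>, exactly half of the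
    energy comes back.\<close>
  obtain C where C: "0 \<le> C" "\<And>t. 0 \<le> t \<Longrightarrow> t powr q \<le> 1 / (2 * c * H) * t powr p + C"
    using powr_less_exponent_le[OF q0 q(1), of "1 / (2 * c * H)"] c H(1) by auto
  have "\<E> (\<lambda>x. min (sol n x) M powr \<theta>) \<le> 2 * (c * C * measure lebesgue \<Omega>)" if M: "0 \<le> M" for n M
  proof -
    let ?T = "\<lambda>x. min (sol n x) M"
    let ?V = "\<lambda>x. ?T x powr \<theta>" and ?\<phi> = "\<lambda>x. ?T x powr \<beta>"
    have T0: "0 \<le> ?T x" for x using sol_nonneg M by simp
    have V: "?V \<in> \<W> (core n)" and \<phi>: "?\<phi> \<in> \<W> (core n)"
      using truncated_powr_in_frac_sobolev_zero[OF sol_mem sol_nonneg M] \<theta> \<beta> by auto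
    note V\<Omega> = frac_sobolev_zero_mono[OF V core_subset]
    note HV = H(2)[OF V\<Omega>]
    let ?h = "\<lambda>x. indicator \<Omega> x * (\<bar>?V x\<bar> powr p * d x powr - (s * p))"
    have "\<E> ?V \<le> (\<integral>z. \<theta> powr p * (signed_power p (increment (sol n) z) * increment ?\<phi> z) \<partial>\<mu>)"
      unfolding seminorm_powr_def
    proof (rule integral_mono[OF frac_sobolev_zeroD(3)[OF V]])
      show "integrable \<mu> (\<lambda>z. \<theta> powr p * (signed_power p (increment (sol n) z) * increment ?\<phi> z))"
        using integrable_form[OF sol_mem \<phi>] by auto
      show "\<bar>increment ?V z\<bar> powr p \<le> \<theta> powr p * (signed_power p (increment (sol n) z) * increment ?\<phi> z)" for z
        unfolding increment_def \<beta>_def using powr_test_inequality[OF p_gt \<theta> sol_nonneg sol_nonneg M] by simp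
    qed
    also have "\<dots> = (\<integral>x. \<theta> powr p * (source n x * (sol n x + 1 / real (Suc n)) powr (- \<gamma>) * ?\<phi> x) \<partial>lebesgue)"
      using sol_eq[OF \<phi>] by simp
    also have "\<dots> \<le> (\<integral>x. c * (1 / (2 * c * H) * ?h x + C * indicator \<Omega> x) \<partial>lebesgue)"
    proof (rule integral_mono)
      show "integrable lebesgue (\<lambda>x. \<theta> powr p * (source n x * (sol n x + 1 / real (Suc n)) powr (- \<gamma>) * ?\<phi> x))"
        using sol_integrable[OF \<phi>] by auto
      show "integrable lebesgue (\<lambda>x. c * (1 / (2 * c * H) * ?h x + C * indicator \<Omega> x))"
        using HV integrable_indicator_domain by auto
      fix x
      show "\<theta> powr p * (source n x * (sol n x + 1 / real (Suc n)) powr (- \<gamma>) * ?\<phi> x) \<le> c * (1 / (2 * c * H) * ?h x + C * indicator \<Omega> x)"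
      proof (cases "x \<in> core n \<and> 0 < ?T x")
        case True
        then have x: "x \<in> \<Omega>" "x \<in> core n" and Tx: "0 < ?T x" using core_subset by auto
        have dx: "0 < d x" by (rule d_pos[OF x(1)])
        have "(sol n x + 1 / real (Suc n)) powr (- \<gamma>) \<le> ?T x powr (- \<gamma>)"
        proof -
          have "?T x \<le> sol n x + 1 / real (Suc n)" by (intro min.coboundedI1) simp
          then show ?thesis using Tx \<gamma>_pos by (intro powr_mono2') auto
        qed
        then have "(sol n x + 1 / real (Suc n)) powr (- \<gamma>) * ?\<phi> x \<le> ?T x powr (- \<gamma>) * ?\<phi> x"
          by (intro mult_right_mono) auto
        also have "\<dots> = ?V x powr q"
          by (simp add: powr_powr q\<theta> flip: powr_add)
        finally have 1: "(sol n x + 1 / real (Suc n)) powr (- \<gamma>) * ?\<phi> x \<le> ?V x powr q" .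
        \<comment> \<open>The weight is split so that Hardy's quotient \<open>V / d powr s\<close>
          appears; the remaining power of \<open>d\<close> has a nonnegative exponent and is bounded
          by that of \<open>D\<close>.\<close>
        have "d x powr (- \<delta>) * ?V x powr q = d x powr (s * q - \<delta>) * (?V x * d x powr (- s)) powr q"
          by (simp add: powr_mult powr_powr mult_ac flip: powr_add)
        also have "\<dots> \<le> D powr (s * q - \<delta>) * (1 / (2 * c * H) * (?V x * d x powr (- s)) powr p + C)"
          using C(2)[of "?V x * d x powr (- s)"] D(2)[OF x(1)] q by (intro mult_mono powr_mono2) auto
        also have "(?V x * d x powr (- s)) powr p = ?h x"
          using x by (simp add: powr_mult powr_powr)
        finally have 2: "d x powr (- \<delta>) * ?V x powr q \<le> D powr (s * q - \<delta>) * (1 / (2 * c * H) * ?h x + C)" .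
        have "source n x * ((sol n x + 1 / real (Suc n)) powr (- \<gamma>) * ?\<phi> x) \<le> C2 * d x powr (- \<delta>) * ?V x powr q"
          using 1 K_upper[OF x(1)] K_pos[OF x(1)] x(2) C2_pos by (intro mult_mono) (auto simp: source_def)
        also have "\<dots> \<le> C2 * (D powr (s * q - \<delta>) * (1 / (2 * c * H) * ?h x + C))"
          unfolding mult.assoc using 2 C2_pos by (intro mult_left_mono) (simp_all add: mult.assoc)
        finally have "\<theta> powr p * (source n x * ((sol n x + 1 / real (Suc n)) powr (- \<gamma>) * ?\<phi> x))
          \<le> \<theta> powr p * (C2 * (D powr (s * q - \<delta>) * (1 / (2 * c * H) * ?h x + C)))"
          by (intro mult_left_mono) auto
        then show ?thesis using x(1) unfolding c_def[symmetric] by (simp add: c_def mult.assoc)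
      next
        case False
        have "0 \<le> c * (1 / (2 * c * H) * ?h x + C * indicator \<Omega> x)"
          using c H(1) C(1) by (intro mult_nonneg_nonneg add_nonneg_nonneg) (auto simp: indicator_def)
        moreover have "source n x * (sol n x + 1 / real (Suc n)) powr (- \<gamma>) * ?\<phi> x = 0"
        proof (cases "x \<in> core n")
          case True
          then have "?T x = 0" using False T0[of x] by auto
          then show ?thesis by simp
        qed (simp add: source_def)
        ultimately show ?thesis by (simp only: mult_zero_right)
      qed
    qed
    also have "\<dots> = c * (1 / (2 * c * H) * (\<integral>x. ?h x \<partial>lebesgue) + C * measure lebesgue \<Omega>)"
    proof -
      have "integrable lebesgue (\<lambda>x. 1 / (2 * c * H) * ?h x)" "integrable lebesgue (\<lambda>x. C * indicator \<Omega> x :: real)"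
        using HV integrable_indicator_domain by auto
      from Bochner_Integration.integral_add[OF this] show ?thesis
        by (simp only: integral_mult_right_zero) simp
    qed
    also have "\<dots> \<le> c * (1 / (2 * c * H) * (H * \<E> ?V) + C * measure lebesgue \<Omega>)"
      using HV c H(1) by (intro mult_left_mono add_right_mono) auto
    \<comment> \<open>The truncated power belongs to the space, so its energy is finite and half of
      it may be subtracted from both sides.\<close>
    also have "\<dots> = \<E> ?V / 2 + c * C * measure lebesgue \<Omega>"
      using c H(1) by (simp add: field_simps)
    finally show ?thesis by linarith
  qed
  then show thesis by (rule that)
qed

text \<open>The bound is uniform in the truncation level, and for each \<open>x\<close> the
  truncation is eventually inactive, so \<open>frac_sobolev_zero_limit\<close> removes it.\<close>

lemma energy_bound:
  assumes \<theta>: "1 \<le> \<theta>" and adm: "\<delta> \<le> s * (p - (p - 1 + \<gamma>) / \<theta>)"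
  obtains C where "\<And>n. (\<lambda>x. sol n x powr \<theta>) \<in> \<W> (core n)"
    "\<And>n. \<E> (\<lambda>x. sol n x powr \<theta>) \<le> C"
proof -
  obtain C where C: "\<And>n M. 0 \<le> M \<Longrightarrow> \<E> (\<lambda>x. min (sol n x) M powr \<theta>) \<le> C"
    using truncated_energy_bound[OF assms] by blast
  have "(\<lambda>x. sol n x powr \<theta>) \<in> \<W> (core n) \<and> \<E> (\<lambda>x. sol n x powr \<theta>) \<le> C" for n
  proof -
    have "(\<lambda>m. min (sol n x) (real m) powr \<theta>) \<longlonglongrightarrow> sol n x powr \<theta>" for x
    proof (rule tendsto_eventually)
      obtain M where "sol n x \<le> real M" using real_arch_simple by blast
      then show "\<forall>\<^sub>F m in sequentially. min (sol n x) (real m) powr \<theta> = sol n x powr \<theta>"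
        unfolding eventually_sequentially by (intro exI[of _ M]) (auto simp: min_def)
    qed
    then have lim: "AE x in lebesgue. (\<lambda>m. min (sol n x) (real m) powr \<theta>) \<longlonglongrightarrow> sol n x powr \<theta>" by simp
    have mem: "(\<lambda>x. min (sol n x) (real m) powr \<theta>) \<in> \<W> (core n)" for m
      using truncated_powr_in_frac_sobolev_zero[OF sol_mem sol_nonneg _ \<theta>] by simp
    have le: "\<E> (\<lambda>x. min (sol n x) (real m) powr \<theta>) \<le> C" for m by (rule C) simp
    show ?thesis
      using frac_sobolev_zero_limit[where f = "\<lambda>m x. min (sol n x) (real m) powr \<theta>", OF core_subset mem le lim] by simp
  qed
  then show thesis using that by blast
qed

end

section \<open>The minimal solution\<close>

text \<open>Where the clamp is active, \<open>\<bar>b\<bar>\<close> is below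
  \<open>\<bar>t\<bar> / R\<close>, which makes the error at most
  \<open>\<bar>t\<bar> powr p / R\<close>; elsewhere there is no error.\<close>

lemma signed_power_clamp_bounds:
  fixes t b p R :: real
  assumes p: "1 < p" and R: "0 < R"
  defines "c \<equiv> max (- (R * \<bar>b\<bar>)) (min (R * \<bar>b\<bar>) t)"
  shows "\<bar>signed_power p t * b - signed_power p c * b\<bar> \<le> \<bar>t\<bar> powr p / R"
    and "\<bar>signed_power p c * b\<bar> \<le> R powr (p - 1) * \<bar>b\<bar> powr p"
proof -
  have Rb: "0 \<le> R * \<bar>b\<bar>" using R by simp
  have *: "\<bar>signed_power p t * b - signed_power p (R * \<bar>b\<bar>) * b\<bar> \<le> \<bar>t\<bar> powr p / R" if t: "R * \<bar>b\<bar> < t" for t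
  proof -
    have "0 \<le> signed_power p (R * \<bar>b\<bar>)" "signed_power p (R * \<bar>b\<bar>) \<le> signed_power p t"
      using signed_power_mono[OF p, of 0 "R * \<bar>b\<bar>"] signed_power_mono[OF p, of "R * \<bar>b\<bar>" t] Rb t by auto
    then have "\<bar>signed_power p t - signed_power p (R * \<bar>b\<bar>)\<bar> * \<bar>b\<bar> \<le> signed_power p t * (t / R)"
      using t Rb R by (intro mult_mono) (auto simp: field_simps)
    also have "\<dots> = \<bar>t\<bar> powr p / R"
      using signed_power_mult_self[of p t] p by simp
    finally show ?thesis by (simp add: abs_mult flip: left_diff_distrib)
  qed
  consider "\<bar>t\<bar> \<le> R * \<bar>b\<bar>" | "R * \<bar>b\<bar> < t" | "R * \<bar>b\<bar> < - t" by linarith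
  then show "\<bar>signed_power p t * b - signed_power p c * b\<bar> \<le> \<bar>t\<bar> powr p / R"
  proof cases
    case 1
    then have "c = t" by (auto simp: c_def)
    then show ?thesis using R by simp
  next
    case 2
    then have "c = R * \<bar>b\<bar>" using Rb by (auto simp: c_def)
    then show ?thesis using *[OF 2] by simp
  next
    case 3
    then have "c = - (R * \<bar>b\<bar>)" using Rb by (auto simp: c_def)
    then show ?thesis using *[OF 3] by (simp add: signed_power_minus abs_minus_commute)
  qed
  have "\<bar>c\<bar> \<le> R * \<bar>b\<bar>" using Rb unfolding c_def by (smt (verit))
  then have "\<bar>signed_power p c\<bar> * \<bar>b\<bar> \<le> (R * \<bar>b\<bar>) powr (p - 1) * \<bar>b\<bar>"
    unfolding abs_signed_power using p by (intro mult_right_mono powr_mono2) auto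
  also have "\<dots> = R powr (p - 1) * (\<bar>b\<bar> powr (p - 1) * \<bar>b\<bar>)" by (simp add: powr_mult)
  also have "\<bar>b\<bar> powr (p - 1) * \<bar>b\<bar> = \<bar>b\<bar> powr p"
    using powr_mult_base[of "\<bar>b\<bar>" "p - 1"] by (simp add: mult.commute)
  finally show "\<bar>signed_power p c * b\<bar> \<le> R powr (p - 1) * \<bar>b\<bar> powr p" by (simp add: abs_mult)
qed

text \<open>A bounded, almost everywhere convergent sequence converges weakly in the dual space: clamping
  \<open>a n\<close> at a multiple of \<open>b\<close> gives a dominated sequence with a uniformly small error.\<close>

lemma signed_power_weak_limit:
  fixes a :: "nat \<Rightarrow> 'b \<Rightarrow> real" and a0 b :: "'b \<Rightarrow> real"
  assumes p: "1 < p" and a[measurable]: "\<And>n. a n \<in> borel_measurable M" and a0[measurable]: "a0 \<in> borel_measurable M"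
    and b[measurable]: "b \<in> borel_measurable M"
    and ia: "\<And>n. integrable M (\<lambda>z. \<bar>a n z\<bar> powr p)" and C: "\<And>n. (\<integral>z. \<bar>a n z\<bar> powr p \<partial>M) \<le> C"
    and lim: "AE z in M. (\<lambda>n. a n z) \<longlonglongrightarrow> a0 z" and ib: "integrable M (\<lambda>z. \<bar>b z\<bar> powr p)"
  shows "integrable M (\<lambda>z. signed_power p (a0 z) * b z)"
    "(\<lambda>n. \<integral>z. signed_power p (a n z) * b z \<partial>M) \<longlonglongrightarrow> (\<integral>z. signed_power p (a0 z) * b z \<partial>M)"
proof -
  have "AE z in M. (\<lambda>n. \<bar>a n z\<bar> powr p) \<longlonglongrightarrow> \<bar>a0 z\<bar> powr p"
    using lim by eventually_elim (rule tendsto_abs_powr, use p in auto)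
  note fat = integral_Fatou_AE[OF ia _ C _ this]
  have ia0: "integrable M (\<lambda>z. \<bar>a0 z\<bar> powr p)" and C0: "(\<integral>z. \<bar>a0 z\<bar> powr p \<partial>M) \<le> C"
    using fat by auto
  have int: "integrable M (\<lambda>z. signed_power p (f z) * b z)" if "f \<in> borel_measurable M" "integrable M (\<lambda>z. \<bar>f z\<bar> powr p)" for f
  proof (rule Bochner_Integration.integrable_bound[OF Bochner_Integration.integrable_add[OF that(2) ib]])
    show "(\<lambda>z. signed_power p (f z) * b z) \<in> borel_measurable M"
      using that(1) by measurable
    show "AE x in M. norm (signed_power p (f x) * b x) \<le> norm (\<bar>f x\<bar> powr p + \<bar>b x\<bar> powr p)"
      using abs_signed_power_mult_le[OF p] by (intro AE_I2) (auto intro: order_trans[OF _ abs_ge_self])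
  qed
  show i0: "integrable M (\<lambda>z. signed_power p (a0 z) * b z)" by (rule int[OF a0 ia0])
  have Cnn: "0 \<le> C" using C[of 0] by (meson Bochner_Integration.integral_nonneg order_trans powr_ge_zero)
  show "(\<lambda>n. \<integral>z. signed_power p (a n z) * b z \<partial>M) \<longlonglongrightarrow> (\<integral>z. signed_power p (a0 z) * b z \<partial>M)"
  proof (rule LIMSEQ_I)
    fix e :: real assume e: "0 < e"
    \<comment> \<open>The clamping error is then at most \<open>e / 4\<close>, for every
      \<open>a n\<close> as well as for the limit \<open>a0\<close>.\<close>
    define R where "R = (4 * C + 1) / e"
    have R: "0 < R" using e Cnn by (simp add: R_def)
    have CR: "C / R \<le> e / 4" using e Cnn by (simp add: R_def field_simps)
    define cl where "cl = (\<lambda>t z. max (- (R * \<bar>b z\<bar>)) (min (R * \<bar>b z\<bar>) t))"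
    have icl: "integrable M (\<lambda>z. signed_power p (cl (f z) z) * b z)"
      and diff: "\<bar>(\<integral>z. signed_power p (f z) * b z \<partial>M) - (\<integral>z. signed_power p (cl (f z) z) * b z \<partial>M)\<bar> \<le> e / 4"
      if f[measurable]: "f \<in> borel_measurable M" and i: "integrable M (\<lambda>z. \<bar>f z\<bar> powr p)" and le: "(\<integral>z. \<bar>f z\<bar> powr p \<partial>M) \<le> C" for f
    proof -
      show icl: "integrable M (\<lambda>z. signed_power p (cl (f z) z) * b z)"
      proof (rule Bochner_Integration.integrable_bound)
        show "integrable M (\<lambda>z. R powr (p - 1) * \<bar>b z\<bar> powr p)" using ib by auto
        show "AE z in M. norm (signed_power p (cl (f z) z) * b z) \<le> norm (R powr (p - 1) * \<bar>b z\<bar> powr p)"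
          using signed_power_clamp_bounds(2)[OF p R] unfolding cl_def by (intro AE_I2) (auto intro: order_trans[OF _ abs_ge_self])
      qed (simp add: cl_def)
      have "\<bar>(\<integral>z. signed_power p (f z) * b z \<partial>M) - (\<integral>z. signed_power p (cl (f z) z) * b z \<partial>M)\<bar>
        = \<bar>\<integral>z. signed_power p (f z) * b z - signed_power p (cl (f z) z) * b z \<partial>M\<bar>"
        using int[OF f i] icl by simp
      also have "\<dots> \<le> (\<integral>z. \<bar>signed_power p (f z) * b z - signed_power p (cl (f z) z) * b z\<bar> \<partial>M)"
        by (rule integral_abs_bound)
      also have "\<dots> \<le> (\<integral>z. \<bar>f z\<bar> powr p / R \<partial>M)"
        using int[OF f i] icl i signed_power_clamp_bounds(1)[OF p R] unfolding cl_def
        by (intro integral_mono) auto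
      also have "\<dots> = (\<integral>z. \<bar>f z\<bar> powr p \<partial>M) / R" by simp
      also have "\<dots> \<le> C / R" using le R by (intro divide_right_mono) auto
      finally show "\<bar>(\<integral>z. signed_power p (f z) * b z \<partial>M) - (\<integral>z. signed_power p (cl (f z) z) * b z \<partial>M)\<bar> \<le> e / 4"
        using CR by linarith
    qed
    have "(\<lambda>n. \<integral>z. signed_power p (cl (a n z) z) * b z \<partial>M) \<longlonglongrightarrow> (\<integral>z. signed_power p (cl (a0 z) z) * b z \<partial>M)"
    proof (rule integral_dominated_convergence)
      show "integrable M (\<lambda>z. R powr (p - 1) * \<bar>b z\<bar> powr p)" using ib by auto
      show "AE z in M. norm (signed_power p (cl (a n z) z) * b z) \<le> R powr (p - 1) * \<bar>b z\<bar> powr p" for n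
        using signed_power_clamp_bounds(2)[OF p R] unfolding cl_def by simp
      show "AE z in M. (\<lambda>n. signed_power p (cl (a n z) z) * b z) \<longlonglongrightarrow> signed_power p (cl (a0 z) z) * b z"
        using lim unfolding cl_def
        by eventually_elim (intro tendsto_mult_right tendsto_signed_power[OF p] tendsto_max tendsto_min tendsto_const)
    qed (simp_all add: cl_def)
    then obtain N where N: "\<And>n. N \<le> n \<Longrightarrow> \<bar>(\<integral>z. signed_power p (cl (a n z) z) * b z \<partial>M) - (\<integral>z. signed_power p (cl (a0 z) z) * b z \<partial>M)\<bar> < e / 4"
      using LIMSEQ_D[of _ _ "e / 4"] e by fastforce
    have "norm ((\<integral>z. signed_power p (a n z) * b z \<partial>M) - (\<integral>z. signed_power p (a0 z) * b z \<partial>M)) < e" if "N \<le> n" for n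
      using N[OF that] diff[OF a ia C, of n] diff[OF a0 ia0 C0] e unfolding real_norm_def by linarith
    then show "\<exists>N. \<forall>n\<ge>N. norm ((\<integral>z. signed_power p (a n z) * b z \<partial>M) - (\<integral>z. signed_power p (a0 z) * b z \<partial>M)) < e"
      by blast
  qed
qed

context frac_problem
begin

text \<open>The powers for which the uniform energy bound holds. All sufficiently large \<theta>
  belong to them, because \<open>\<delta> < s * p\<close>.\<close>

definition admissible :: "real \<Rightarrow> bool" where
  "admissible \<theta> \<longleftrightarrow> 1 \<le> \<theta> \<and> \<delta> \<le> s * (p - (p - 1 + \<gamma>) / \<theta>)"

lemma admissibleI:
  assumes "1 \<le> \<theta>" "s * (p - 1 + \<gamma>) / (s * p - \<delta>) \<le> \<theta>"
  shows "admissible \<theta>"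
proof -
  have "s * (p - 1 + \<gamma>) \<le> (s * p - \<delta>) * \<theta>"
    using assms(2) \<delta>_less by (simp add: pos_divide_le_eq mult.commute)
  then have "s * (p - 1 + \<gamma>) / \<theta> \<le> s * p - \<delta>"
    using assms(1) by (simp add: pos_divide_le_eq)
  then show ?thesis using assms(1) by (simp add: admissible_def right_diff_distrib)
qed

lemma ex_admissible: obtains \<theta> where "admissible \<theta>"
  using admissibleI[of "max 1 (s * (p - 1 + \<gamma>) / (s * p - \<delta>))"] by auto

text \<open>The value \<open>0\<close> outside \<Omega> is imposed at every point, as
  \<open>weak_solution\<close> demands it there without exceptions; inside, \<open>lim\<close> is
  unspecified where the sequence diverges, which happens on a null set only.\<close>

definition limit_sol :: "'a \<Rightarrow> real" where
  "limit_sol x = (if x \<in> \<Omega> then lim (\<lambda>n. sol n x) else 0)"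

text \<open>The increasing sequence could diverge to infinity. Monotone convergence for
  \<open>sol n x powr (\<theta> * p)\<close>, whose integrals are bounded by the energy bound and
  Poincare's inequality, excludes this almost everywhere.\<close>

lemma sol_tendsto: "AE x in lebesgue. (\<lambda>n. sol n x) \<longlonglongrightarrow> limit_sol x"
proof -
  obtain \<theta> where adm: "admissible \<theta>" by (rule ex_admissible)
  then have \<theta>: "1 \<le> \<theta>" by (simp add: admissible_def)
  obtain C where C: "\<And>n. (\<lambda>x. sol n x powr \<theta>) \<in> \<W> (core n)"
    "\<And>n. \<E> (\<lambda>x. sol n x powr \<theta>) \<le> C"
    using energy_bound adm unfolding admissible_def by blast
  obtain P where P: "0 < P" "\<And>u. u \<in> \<W> \<Omega> \<Longrightarrow> (\<integral>x. \<bar>u x\<bar> powr p \<partial>lebesgue) \<le> P * \<E> u"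
    using Poincare by blast
  let ?g = "\<lambda>n x. ennreal (sol n x powr (\<theta> * p))"
  have "(\<integral>\<^sup>+x. ?g n x \<partial>lebesgue) \<le> ennreal (P * C)" for n
  proof -
    have W: "(\<lambda>x. sol n x powr \<theta>) \<in> \<W> \<Omega>" by (rule frac_sobolev_zero_mono[OF C(1) core_subset])
    have i: "integrable lebesgue (\<lambda>x. sol n x powr (\<theta> * p))"
      using frac_sobolev_zeroD(2)[OF W] by (simp add: powr_powr)
    have "(\<integral>x. sol n x powr (\<theta> * p) \<partial>lebesgue) \<le> P * \<E> (\<lambda>x. sol n x powr \<theta>)"
      using P(2)[OF W] by (simp add: powr_powr)
    also have "\<dots> \<le> P * C" using C(2)[of n] P(1) by simp
    finally show ?thesis using i by (simp add: nn_integral_eq_integral ennreal_leI)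
  qed
  then have "(SUP n. \<integral>\<^sup>+x. ?g n x \<partial>lebesgue) \<le> ennreal (P * C)" by (rule SUP_least)
  moreover have "(\<integral>\<^sup>+x. (SUP n. ?g n x) \<partial>lebesgue) = (SUP n. \<integral>\<^sup>+x. ?g n x \<partial>lebesgue)"
  proof (rule nn_integral_monotone_convergence_SUP_AE)
    show "AE x in lebesgue. ?g n x \<le> ?g (Suc n) x" for n
      using sol_Suc_le[of n] by eventually_elim (use sol_nonneg \<theta> p_pos in \<open>auto intro!: ennreal_leI powr_mono2\<close>)
  qed measurable
  ultimately have "(\<integral>\<^sup>+x. (SUP n. ?g n x) \<partial>lebesgue) \<noteq> \<infinity>"
    by (metis ennreal_neq_top infinity_ennreal_def top.extremum_unique)
  then have "AE x in lebesgue. (SUP n. ?g n x) \<noteq> \<infinity>"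
    by (intro nn_integral_PInf_AE) measurable
  moreover have "AE x in lebesgue. \<forall>n. x \<notin> \<Omega> \<longrightarrow> sol n x = 0"
    using frac_sobolev_zeroD(4)[OF sol_mem_domain] unfolding AE_all_countable by blast
  ultimately show ?thesis
    using incseq_sol
  proof eventually_elim
    case (elim x)
    show ?case
    proof (cases "x \<in> \<Omega>")
      case True
      define r where "r = enn2real (SUP n. ?g n x)"
      have r: "(SUP n. ?g n x) = ennreal r" "0 \<le> r"
      proof -
        have "(SUP n. ?g n x) < top" using elim(1) unfolding infinity_ennreal_def less_top .
        then show "(SUP n. ?g n x) = ennreal r" unfolding r_def by (rule ennreal_enn2real[symmetric])
      qed (simp add: r_def)
      have "sol n x \<le> r powr (1 / (\<theta> * p))" for n
      proof -
        have "?g n x \<le> ennreal r" unfolding r(1)[symmetric] by (rule SUP_upper) simp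
        then have "sol n x powr (\<theta> * p) \<le> r" using r(2) by simp
        then have "(sol n x powr (\<theta> * p)) powr (1 / (\<theta> * p)) \<le> r powr (1 / (\<theta> * p))"
          using \<theta> p_pos by (intro powr_mono2) auto
        then show ?thesis using \<theta> p_pos sol_nonneg[of n x] by (simp add: powr_powr)
      qed
      then have "bdd_above (range (\<lambda>n. sol n x))" by (rule bdd_aboveI2)
      then have "(\<lambda>n. sol n x) \<longlonglongrightarrow> (SUP n. sol n x)" using elim(3) by (rule LIMSEQ_incseq_SUP)
      then show ?thesis using True by (simp add: limit_sol_def limI)
    qed (use elim(2) in \<open>simp add: limit_sol_def\<close>)
  qed
qed

lemma limit_sol_measurable [measurable]: "limit_sol \<in> borel_measurable lebesgue"
  using sol_measurable sol_tendsto by (rule borel_measurable_lebesgue_LIMSEQ)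

lemma limit_sol_nonneg: "AE x in lebesgue. 0 \<le> limit_sol x"
  using sol_tendsto by eventually_elim (auto intro: LIMSEQ_le_const sol_nonneg)

lemma limit_sol_powr_mem:
  assumes "admissible \<theta>"
  shows "(\<lambda>x. limit_sol x powr \<theta>) \<in> \<W> \<Omega>"
proof -
  have \<theta>: "1 \<le> \<theta>" using assms by (simp add: admissible_def)
  obtain C where C: "\<And>n. (\<lambda>x. sol n x powr \<theta>) \<in> \<W> (core n)"
    "\<And>n. \<E> (\<lambda>x. sol n x powr \<theta>) \<le> C"
    using energy_bound assms unfolding admissible_def by blast
  have lim: "AE x in lebesgue. (\<lambda>n. sol n x powr \<theta>) \<longlonglongrightarrow> limit_sol x powr \<theta>"
    using sol_tendsto by eventually_elim (use tendsto_abs_powr[of \<theta>] \<theta> in simp)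
  show ?thesis
    by (rule frac_sobolev_zero_limit(1)[OF order_refl frac_sobolev_zero_mono[OF C(1) core_subset] C(2) lim])
qed

lemma limit_sol_lower_bound:
  assumes "B \<Subset> \<Omega>"
  obtains c where "0 < c" "AE x in lebesgue. x \<in> B \<longrightarrow> c \<le> limit_sol x"
proof -
  have B: "compact (closure B)" "closure B \<subseteq> \<Omega>" using assms by (auto simp: compactly_contained_def)
  obtain c n0 where c: "0 < c" "\<And>n. n0 \<le> n \<Longrightarrow> AE x in lebesgue. x \<in> closure B \<longrightarrow> c \<le> sol n x"
    using sol_lower_bound[OF B] by blast
  have "AE x in lebesgue. \<forall>n. n0 \<le> n \<longrightarrow> x \<in> closure B \<longrightarrow> c \<le> sol n x"
    unfolding AE_all_countable using c(2) by auto
  then have "AE x in lebesgue. x \<in> B \<longrightarrow> c \<le> limit_sol x"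
    using sol_tendsto
  proof eventually_elim
    case (elim x)
    then show ?case using closure_subset[of B] by (intro impI LIMSEQ_le_const[OF elim(2)] exI[of _ n0]) blast
  qed
  then show thesis using that c(1) by blast
qed

text \<open>Above the level \<open>c\<close> the power \<theta> has slope at least
  \<open>c powr (\<theta> - 1)\<close>, so it can be inverted with control of the
  increments.\<close>

lemma abs_diff_le_powr_diff:
  fixes a b c :: real
  assumes "0 < c" "c \<le> a" "c \<le> b" "1 \<le> \<theta>"
  shows "\<bar>a - b\<bar> powr p \<le> c powr (p * (1 - \<theta>)) * \<bar>a powr \<theta> - b powr \<theta>\<bar> powr p"
proof -
  have *: "\<bar>a - b\<bar> \<le> c powr (1 - \<theta>) * \<bar>a powr \<theta> - b powr \<theta>\<bar>" if "c \<le> b" "b \<le> a" for a b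
  proof -
    have "c powr (\<theta> - 1) * (a - b) \<le> a powr (\<theta> - 1) * (a - b)"
      using that assms(1,4) by (intro mult_right_mono powr_mono2) auto
    also have "\<dots> \<le> a powr \<theta> - b powr \<theta>"
      using that assms(1,4) by (intro powr_diff_ge) auto
    finally have "c powr (1 - \<theta>) * (c powr (\<theta> - 1) * (a - b)) \<le> c powr (1 - \<theta>) * (a powr \<theta> - b powr \<theta>)"
      by (intro mult_left_mono) auto
    moreover have "c powr (1 - \<theta>) * c powr (\<theta> - 1) = 1"
      using assms(1) by (simp flip: powr_add)
    ultimately have "a - b \<le> c powr (1 - \<theta>) * (a powr \<theta> - b powr \<theta>)" by (simp flip: mult.assoc)
    moreover have "b powr \<theta> \<le> a powr \<theta>" using that assms by (intro powr_mono2) auto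
    ultimately show ?thesis using that by simp
  qed
  have "\<bar>a - b\<bar> \<le> c powr (1 - \<theta>) * \<bar>a powr \<theta> - b powr \<theta>\<bar>"
    using *[of b a] *[of a b] assms by (cases "b \<le> a") (auto simp: abs_minus_commute)
  then have "\<bar>a - b\<bar> powr p \<le> (c powr (1 - \<theta>) * \<bar>a powr \<theta> - b powr \<theta>\<bar>) powr p"
    using p_pos by (intro powr_mono2) auto
  then show ?thesis by (simp add: powr_mult powr_powr mult.commute)
qed

text \<open>Stated for a general \<open>u\<close>, since it is applied to \<open>limit_sol\<close>
  for its local regularity and to every \<open>sol n\<close> for a bound independent of
  \<open>n\<close>.\<close>

lemma local_energy:
  fixes u :: "'a \<Rightarrow> real"
  assumes u: "u \<in> borel_measurable lebesgue" and uW: "(\<lambda>x. u x powr \<theta>) \<in> \<W> \<Omega>"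
    and \<theta>: "1 \<le> \<theta>" and c: "0 < c" "AE x in lebesgue. x \<in> B \<longrightarrow> c \<le> u x" and B: "B \<in> sets lebesgue"
  shows "integrable \<mu> (\<lambda>z. indicator (B \<times> B) z * \<bar>increment u z\<bar> powr p)"
    "(\<integral>z. indicator (B \<times> B) z * \<bar>increment u z\<bar> powr p \<partial>\<mu>) \<le> c powr (p * (1 - \<theta>)) * \<E> (\<lambda>x. u x powr \<theta>)"
proof -
  note [measurable] = u Times_lebesgue_measurable[OF B B]
  let ?R = "\<lambda>z. c powr (p * (1 - \<theta>)) * \<bar>increment (\<lambda>x. u x powr \<theta>) z\<bar> powr p"
  have R: "integrable \<mu> ?R" using frac_sobolev_zeroD(3)[OF uW] by auto
  have le: "AE z in \<mu>. indicator (B \<times> B) z * \<bar>increment u z\<bar> powr p \<le> ?R z"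
  proof (rule AE_gagliardo_measureI)
    show "AE z in lebesgue. indicator (B \<times> B) z * \<bar>increment u z\<bar> powr p \<le> ?R z"
      using AE_lebesgue_fst[OF c(2), where 'b='a] AE_lebesgue_snd[OF c(2), where 'a='a]
    proof eventually_elim
      case (elim z)
      then show ?case
        using abs_diff_le_powr_diff[OF c(1) _ _ \<theta>, of "u (fst z)" "u (snd z)"]
        by (cases "z \<in> B \<times> B") (auto simp: increment_def)
    qed
  qed
  show i: "integrable \<mu> (\<lambda>z. indicator (B \<times> B) z * \<bar>increment u z\<bar> powr p)"
    by (rule Bochner_Integration.integrable_bound[OF R])
      (use le in \<open>auto elim!: eventually_mono intro: order_trans[OF _ abs_ge_self]\<close>)
  have "(\<integral>z. indicator (B \<times> B) z * \<bar>increment u z\<bar> powr p \<partial>\<mu>) \<le> (\<integral>z. ?R z \<partial>\<mu>)"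
    by (rule integral_mono_AE[OF i R le])
  then show "(\<integral>z. indicator (B \<times> B) z * \<bar>increment u z\<bar> powr p \<partial>\<mu>) \<le> c powr (p * (1 - \<theta>)) * \<E> (\<lambda>x. u x powr \<theta>)"
    by (simp add: seminorm_powr_def)
qed

text \<open>Pointwise \<open>t powr p \<le> 1 + t powr (\<theta> * p)\<close> for
  \<open>t \<ge> 0\<close>, and the summand \<open>1\<close> is paid on \<Omega> only.\<close>

lemma powr_integral_le:
  fixes u :: "'a \<Rightarrow> real"
  assumes u: "u \<in> borel_measurable lebesgue" and uW: "(\<lambda>x. u x powr \<theta>) \<in> \<W> \<Omega>"
    and \<theta>: "1 \<le> \<theta>"
  shows "integrable lebesgue (\<lambda>x. \<bar>u x\<bar> powr p)"
    "(\<integral>x. \<bar>u x\<bar> powr p \<partial>lebesgue) \<le> measure lebesgue \<Omega> + (\<integral>x. \<bar>u x powr \<theta>\<bar> powr p \<partial>lebesgue)"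
proof -
  note [measurable] = u
  let ?R = "\<lambda>x. indicator \<Omega> x + \<bar>u x powr \<theta>\<bar> powr p"
  have R: "integrable lebesgue ?R" using frac_sobolev_zeroD(2)[OF uW] integrable_indicator_domain by auto
  have le: "AE x in lebesgue. \<bar>u x\<bar> powr p \<le> ?R x"
    using frac_sobolev_zeroD(4)[OF uW]
  proof eventually_elim
    case (elim x)
    show ?case
    proof (cases "\<bar>u x\<bar> \<le> 1")
      case True
      then have "\<bar>u x\<bar> powr p \<le> 1" using p_pos by (intro powr_le1) auto
      then show ?thesis using elim p_pos by (cases "x \<in> \<Omega>") (auto simp: add_increasing2 simp del: powr_abs_eq)
    next
      case False
      have "p * 1 \<le> p * \<theta>" using \<theta> p_pos by (intro mult_left_mono) auto
      then have "\<bar>u x\<bar> powr p \<le> \<bar>u x\<bar> powr (\<theta> * p)" using False by (intro powr_mono) (auto simp: mult.commute)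
      then show ?thesis by (simp add: powr_powr add_increasing)
    qed
  qed
  show i: "integrable lebesgue (\<lambda>x. \<bar>u x\<bar> powr p)"
    by (rule Bochner_Integration.integrable_bound[OF R])
      (use le in \<open>auto elim!: eventually_mono intro: order_trans[OF _ abs_ge_self]\<close>)
  have "(\<integral>x. \<bar>u x\<bar> powr p \<partial>lebesgue) \<le> (\<integral>x. ?R x \<partial>lebesgue)" by (rule integral_mono_AE[OF i R le])
  also have "\<dots> = measure lebesgue \<Omega> + (\<integral>x. \<bar>u x powr \<theta>\<bar> powr p \<partial>lebesgue)"
    using frac_sobolev_zeroD(2)[OF uW] integrable_indicator_domain by (subst Bochner_Integration.integral_add) auto
  finally show "(\<integral>x. \<bar>u x\<bar> powr p \<partial>lebesgue) \<le> measure lebesgue \<Omega> + (\<integral>x. \<bar>u x powr \<theta>\<bar> powr p \<partial>lebesgue)" .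
qed

section \<open>The limit is a weak solution\<close>

lemma limit_sol_loc: "limit_sol \<in> frac_sobolev_loc s p \<Omega>"
  unfolding frac_sobolev_loc_def
proof (intro CollectI allI impI)
  fix A :: "'a set" assume A: "open A \<and> A \<Subset> \<Omega>"
  have A'[measurable]: "A \<in> sets lebesgue" using A by auto
  obtain \<theta> where adm: "admissible \<theta>" by (rule ex_admissible)
  then have \<theta>: "1 \<le> \<theta>" by (simp add: admissible_def)
  note W = limit_sol_powr_mem[OF adm]
  obtain c where c: "0 < c" "AE x in lebesgue. x \<in> A \<longrightarrow> c \<le> limit_sol x"
    using limit_sol_lower_bound A by blast
  have "limit_sol \<in> Lp_on p A"
    unfolding Lp_on_def
  proof (intro CollectI conjI)
    show "limit_sol \<in> borel_measurable (lebesgue_on A)"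
      by (rule measurable_restrict_space1) measurable
    have "(\<integral>\<^sup>+x. ennreal (\<bar>limit_sol x\<bar> powr p) \<partial>lebesgue_on A) \<le> (\<integral>\<^sup>+x. ennreal (\<bar>limit_sol x\<bar> powr p) \<partial>lebesgue)"
      by (subst nn_integral_restrict_space) (auto intro!: nn_integral_mono simp: indicator_def)
    also have "\<dots> < \<infinity>"
      using powr_integral_le(1)[OF limit_sol_measurable W \<theta>] by (simp add: nn_integral_eq_integral)
    finally show "(\<integral>\<^sup>+x. ennreal (\<bar>limit_sol x\<bar> powr p) \<partial>lebesgue_on A) < \<infinity>" .
  qed
  moreover have "gagliardo_energy s p A limit_sol < \<infinity>"
    using local_energy(1)[OF limit_sol_measurable W \<theta> c A']
    by (simp add: gagliardo_energy_eq nn_integral_eq_integral)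
  ultimately show "limit_sol \<in> Lp_on p A \<and> gagliardo_energy s p A limit_sol < \<infinity>" by simp
qed

text \<open>The form passes to the limit by weak convergence of the increments restricted to
  \<open>strip A\<close>, the right-hand side by dominated convergence: on \<open>core m\<close>
  both \<open>K\<close> and the negative power of \<open>sol n\<close> are bounded.\<close>

lemma limit_sol_weak:
  assumes A: "open A" "A \<Subset> \<Omega>" and \<phi>: "\<phi> \<in> \<W> A"
  shows "integrable \<mu> (\<lambda>z. signed_power p (increment limit_sol z) * increment \<phi> z)" (is ?i1)
    "set_integrable lebesgue \<Omega> (\<lambda>x. K x / limit_sol x powr \<gamma> * \<phi> x)" (is ?i2)
    "form limit_sol \<phi> =
     (LINT x:\<Omega>|lebesgue. K x / limit_sol x powr \<gamma> * \<phi> x)" (is ?eq)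
proof -
  have A'[measurable]: "A \<in> sets lebesgue" using A by auto
  obtain m \<rho> where m: "closure A \<subseteq> core m" and \<rho>: "0 < \<rho>" "\<And>x y. x \<in> A \<Longrightarrow> y \<notin> core m \<Longrightarrow> \<rho> \<le> dist x y"
    using compactly_contained_separated[OF A(2)] by blast
  have Am: "A \<subseteq> core m" using m closure_subset by blast
  have cm: "compact (closure (core m))" "closure (core m) \<subseteq> \<Omega>"
    using core_compactly_contained[of m] by (auto simp: compactly_contained_def)
  obtain c n1 where c: "0 < c" "\<And>n. n1 \<le> n \<Longrightarrow> AE x in lebesgue. x \<in> closure (core m) \<longrightarrow> c \<le> sol n x"
    using sol_lower_bound[OF cm] by blast
  \<comment> \<open>From this index on the support lies in \<open>core n\<close>, so that \<phi> may
    be used in the equation of \<open>sol n\<close>, and the lower bound on \<open>core m\<close> is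
    in force.\<close>
  define n0 where "n0 = max m n1"
  have lower: "AE x in lebesgue. x \<in> core m \<longrightarrow> c \<le> sol n x" if "n0 \<le> n" for n
    using c(2)[of n] that closure_subset[of "core m"] unfolding n0_def by (auto elim!: eventually_mono)
  obtain \<theta> where adm: "admissible \<theta>" by (rule ex_admissible)
  then have \<theta>: "1 \<le> \<theta>" by (simp add: admissible_def)
  obtain C where C: "\<And>n. (\<lambda>x. sol n x powr \<theta>) \<in> \<W> (core n)"
    "\<And>n. \<E> (\<lambda>x. sol n x powr \<theta>) \<le> C"
    using energy_bound adm unfolding admissible_def by blast
  note CW = frac_sobolev_zero_mono[OF C(1) core_subset]
  obtain P where P: "0 < P" "\<And>u. u \<in> \<W> \<Omega> \<Longrightarrow> (\<integral>x. \<bar>u x\<bar> powr p \<partial>lebesgue) \<le> P * \<E> u"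
    using Poincare by blast
  obtain S where S: "0 \<le> S" "\<And>u. u \<in> borel_measurable lebesgue \<Longrightarrow> integrable lebesgue (\<lambda>x. \<bar>u x\<bar> powr p) \<Longrightarrow>
      integrable \<mu> (\<lambda>z. indicator (core m \<times> core m) z * \<bar>increment u z\<bar> powr p) \<Longrightarrow>
      integrable \<mu> (\<lambda>z. indicator (strip A) z * \<bar>increment u z\<bar> powr p) \<and>
      (\<integral>z. indicator (strip A) z * \<bar>increment u z\<bar> powr p \<partial>\<mu>)
        \<le> (\<integral>z. indicator (core m \<times> core m) z * \<bar>increment u z\<bar> powr p \<partial>\<mu>) + S * (\<integral>x. \<bar>u x\<bar> powr p \<partial>lebesgue)"
    using strip_energy[OF A' core_measurable \<rho>] by blast
  define B where "B = c powr (p * (1 - \<theta>)) * C + S * (measure lebesgue \<Omega> + P * C)"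
  have stripE: "integrable \<mu> (\<lambda>z. indicator (strip A) z * \<bar>increment (sol n) z\<bar> powr p)"
    "(\<integral>z. indicator (strip A) z * \<bar>increment (sol n) z\<bar> powr p \<partial>\<mu>) \<le> B" if n: "n0 \<le> n" for n
  proof -
    note loc = local_energy[OF sol_measurable CW \<theta> c(1) lower[OF n] core_measurable]
    note I = powr_integral_le[OF sol_measurable CW \<theta>]
    note st = S(2)[OF sol_measurable I(1) loc(1)]
    show "integrable \<mu> (\<lambda>z. indicator (strip A) z * \<bar>increment (sol n) z\<bar> powr p)" using st by simp
    have "c powr (p * (1 - \<theta>)) * \<E> (\<lambda>x. sol n x powr \<theta>) \<le> c powr (p * (1 - \<theta>)) * C"
      using C(2) by (intro mult_left_mono) auto
    moreover have "(\<integral>x. \<bar>sol n x powr \<theta>\<bar> powr p \<partial>lebesgue) \<le> P * C"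
      using P(2)[OF CW] C(2)[of n] P(1) by (meson mult_left_mono order_trans less_imp_le)
    then have "S * (\<integral>x. \<bar>sol n x\<bar> powr p \<partial>lebesgue) \<le> S * (measure lebesgue \<Omega> + P * C)"
      using I(2)[of n] S(1) by (intro mult_left_mono) linarith+
    ultimately show "(\<integral>z. indicator (strip A) z * \<bar>increment (sol n) z\<bar> powr p \<partial>\<mu>) \<le> B"
      using st loc(2) unfolding B_def by linarith
  qed
  note \<phi>' = frac_sobolev_zeroD[OF \<phi>]
  note [measurable] = \<phi>'(1) strip_measurable[OF A']
  \<comment> \<open>Restriction to the strip leaves the form unchanged, because \<phi> has no
    increments elsewhere, and makes the sequence bounded in L^p.\<close>
  define a where "a = (\<lambda>n z. indicator (strip A) z * increment (sol (n + n0)) z)"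
  define a0 where "a0 = (\<lambda>z. indicator (strip A) z * increment limit_sol z)"
  have ap: "\<bar>a n z\<bar> powr p = indicator (strip A) z * \<bar>increment (sol (n + n0)) z\<bar> powr p" for n z
    using p_pos by (simp add: a_def indicator_def)
  have am: "a n \<in> borel_measurable \<mu>" "a0 \<in> borel_measurable \<mu>"
    "increment \<phi> \<in> borel_measurable \<mu>" for n
    unfolding a_def a0_def by simp_all
  have lim: "AE z in \<mu>. (\<lambda>n. a n z) \<longlonglongrightarrow> a0 z"
  proof (rule AE_gagliardo_measureI)
    show "AE z in lebesgue. (\<lambda>n. a n z) \<longlonglongrightarrow> a0 z"
      using AE_lebesgue_fst[OF sol_tendsto, where 'b='a] AE_lebesgue_snd[OF sol_tendsto, where 'a='a]
      unfolding a_def a0_def increment_def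
      by eventually_elim (intro tendsto_mult_left tendsto_diff LIMSEQ_ignore_initial_segment)
  qed
  have "integrable \<mu> (\<lambda>z. \<bar>a n z\<bar> powr p)" "(\<integral>z. \<bar>a n z\<bar> powr p \<partial>\<mu>) \<le> B" for n
    unfolding ap using stripE by auto
  note weak = signed_power_weak_limit[OF p_gt am(1) am(2) am(3) this lim \<phi>'(3)]
  have off: "AE z in \<mu>. z \<notin> strip A \<longrightarrow> increment \<phi> z = 0"
  proof (rule AE_gagliardo_measureI)
    show "AE z in lebesgue. z \<notin> strip A \<longrightarrow> increment \<phi> z = 0"
      using AE_lebesgue_fst[OF \<phi>'(4), where 'b='a] AE_lebesgue_snd[OF \<phi>'(4), where 'a='a]
      by eventually_elim (auto simp: increment_def strip_def)
  qed
  have ae0: "AE z in \<mu>. signed_power p (a0 z) * increment \<phi> z = signed_power p (increment limit_sol z) * increment \<phi> z"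
    using off by eventually_elim (auto simp: a0_def indicator_def)
  have ae: "AE z in \<mu>. signed_power p (a n z) * increment \<phi> z = signed_power p (increment (sol (n + n0)) z) * increment \<phi> z" for n
    using off by eventually_elim (auto simp: a_def indicator_def)
  have m0: "(\<lambda>z. signed_power p (increment limit_sol z) * increment \<phi> z) \<in> borel_measurable \<mu>"
    "(\<lambda>z. signed_power p (a0 z) * increment \<phi> z) \<in> borel_measurable \<mu>"
    unfolding a0_def by simp_all
  show ?i1
    using integrable_cong_AE[OF m0(2) m0(1) ae0] weak(1) by simp
  have int0: "(\<integral>z. signed_power p (a0 z) * increment \<phi> z \<partial>\<mu>) = form limit_sol \<phi>"
    by (rule integral_cong_AE[OF m0(2) m0(1) ae0])
  have \<phi>n: "\<phi> \<in> \<W> (core (n + n0))" for n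
    by (rule frac_sobolev_zero_mono[OF \<phi> order_trans[OF Am core_mono]]) (simp add: n0_def)
  let ?r = "\<lambda>n x. source (n + n0) x * (sol (n + n0) x + 1 / real (Suc (n + n0))) powr (- \<gamma>) * \<phi> x"
  let ?rl = "\<lambda>x. indicator \<Omega> x * (K x / limit_sol x powr \<gamma> * \<phi> x)"
  have intn: "(\<integral>z. signed_power p (a n z) * increment \<phi> z \<partial>\<mu>) = (\<integral>x. ?r n x \<partial>lebesgue)" for n
  proof -
    have "(\<integral>z. signed_power p (a n z) * increment \<phi> z \<partial>\<mu>) = form (sol (n + n0)) \<phi>"
      by (rule integral_cong_AE[OF _ _ ae]) (simp_all add: a_def)
    then show ?thesis using sol_eq[OF \<phi>n] by simp
  qed
  have \<phi>i: "integrable lebesgue \<phi>"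
  proof -
    obtain c where "0 \<le> c" "\<And>t. 0 \<le> t \<Longrightarrow> t powr 1 \<le> 1 * t powr p + c"
      using powr_less_exponent_le[of 1 p 1] p_gt by auto
    then show ?thesis
      using A(2) closure_subset[of A] by (intro integral_abs_le(1)[OF frac_sobolev_zero_mono[OF \<phi>], of 1 c]) (auto simp: compactly_contained_def)
  qed
  have lowern: "AE x in lebesgue. \<forall>n. x \<in> core m \<longrightarrow> c \<le> sol (n + n0) x"
    unfolding AE_all_countable using lower by simp
  define Q where "Q = C2 * real (Suc m) powr \<delta> * c powr (- \<gamma>)"
  have src: "source (n + n0) x = K x" if "x \<in> A" for n x
  proof -
    have "m \<le> n + n0" by (simp add: n0_def)
    then have "x \<in> core (n + n0)" using that Am core_mono by blast
    then show ?thesis by (simp add: source_def)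
  qed
  have limr: "AE x in lebesgue. (\<lambda>n. ?r n x) \<longlonglongrightarrow> ?rl x"
    using lowern sol_tendsto \<phi>'(4)
  proof eventually_elim
    case (elim x)
    show ?case
    proof (cases "x \<in> A")
      case True
      then have x: "x \<in> core m" "x \<in> \<Omega>" using Am core_subset by auto
      have s1: "(\<lambda>n. sol (n + n0) x) \<longlonglongrightarrow> limit_sol x" using elim(2) by (rule LIMSEQ_ignore_initial_segment)
      have pos: "0 < limit_sol x"
        using LIMSEQ_le_const[OF s1, of c] elim(1) x(1) c(1) by force
      have "(\<lambda>n. 1 / real (Suc (n + n0))) \<longlonglongrightarrow> 0"
        using LIMSEQ_ignore_initial_segment[OF LIMSEQ_inverse_real_of_nat, of n0] by (simp add: inverse_eq_divide)
      then have "(\<lambda>n. sol (n + n0) x + 1 / real (Suc (n + n0))) \<longlonglongrightarrow> limit_sol x"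
        using tendsto_add[OF s1] by fastforce
      then have "(\<lambda>n. (sol (n + n0) x + 1 / real (Suc (n + n0))) powr (- \<gamma>)) \<longlonglongrightarrow> limit_sol x powr (- \<gamma>)"
        using pos by (intro tendsto_powr tendsto_const) auto
      then have "(\<lambda>n. K x * (sol (n + n0) x + 1 / real (Suc (n + n0))) powr (- \<gamma>) * \<phi> x) \<longlonglongrightarrow> K x * limit_sol x powr (- \<gamma>) * \<phi> x"
        by (intro tendsto_mult_right tendsto_mult_left)
      then show ?thesis using x(2) src[OF True] by (simp add: powr_minus_divide)
    qed (use elim(3) in simp)
  qed
  have bdr: "AE x in lebesgue. norm (?r n x) \<le> Q * \<bar>\<phi> x\<bar>" for n
    using lowern \<phi>'(4)
  proof eventually_elim
    case (elim x)
    show ?case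
    proof (cases "x \<in> A")
      case True
      then have x: "x \<in> core m" "x \<in> \<Omega>" using Am core_subset by auto
      have "c \<le> sol (n + n0) x + 1 / real (Suc (n + n0))" using elim(1) x(1) by (simp add: add_increasing2)
      then have "(sol (n + n0) x + 1 / real (Suc (n + n0))) powr (- \<gamma>) \<le> c powr (- \<gamma>)"
        using c(1) \<gamma>_pos by (intro powr_mono2') auto
      then have "K x * (sol (n + n0) x + 1 / real (Suc (n + n0))) powr (- \<gamma>) \<le> Q"
        unfolding Q_def using K_core_le[OF x(1)] K_pos[OF x(2)] C2_pos by (intro mult_mono) auto
      then have "K x * (sol (n + n0) x + 1 / real (Suc (n + n0))) powr (- \<gamma>) * \<bar>\<phi> x\<bar> \<le> Q * \<bar>\<phi> x\<bar>"
        by (intro mult_right_mono) auto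
      then show ?thesis using K_pos[OF x(2)] src[OF True] by (simp add: abs_mult)
    qed (use elim(2) in simp)
  qed
  have Km: "(\<lambda>x. indicator \<Omega> x * K x) \<in> borel_measurable lebesgue"
    using K_measurable by (subst (asm) borel_measurable_restrict_space_iff) auto
  have r0m: "?rl \<in> borel_measurable lebesgue"
  proof -
    have "?rl = (\<lambda>x. (indicator \<Omega> x * K x) / limit_sol x powr \<gamma> * \<phi> x)" by (simp add: fun_eq_iff)
    also have "\<dots> \<in> borel_measurable lebesgue" using Km by measurable
    finally show ?thesis .
  qed
  have rm: "?r n \<in> borel_measurable lebesgue" for n by measurable
  have Q\<phi>: "integrable lebesgue (\<lambda>x. Q * \<bar>\<phi> x\<bar>)" using \<phi>i by auto
  note dom = integral_dominated_convergence[OF r0m rm Q\<phi> limr bdr]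
  have "integrable lebesgue ?rl" by (rule integrable_dominated_convergence[OF r0m rm Q\<phi> limr bdr])
  then show ?i2 by (simp add: set_integrable_def)
  show ?eq
    using LIMSEQ_unique[OF weak(2)[unfolded intn int0] dom] by (simp add: set_lebesgue_integral_def)
qed

lemma limit_sol_weak_solution: "weak_solution s p \<gamma> K \<Omega> limit_sol"
  unfolding weak_solution_def
proof (intro conjI allI impI ballI)
  obtain \<theta> where adm: "admissible \<theta>" by (rule ex_admissible)
  then show "\<exists>\<kappa>\<ge>1. (\<lambda>x. limit_sol x powr \<kappa>) \<in> \<W> \<Omega>"
    using limit_sol_powr_mem by (auto simp: admissible_def)
  show "limit_sol \<in> frac_sobolev_loc s p \<Omega>" by (rule limit_sol_loc)
  show "limit_sol x = 0" if "x \<notin> \<Omega>" for x using that by (simp add: limit_sol_def)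
  show "\<exists>c>0. AE x in lebesgue. x \<in> B \<longrightarrow> c \<le> limit_sol x" if "B \<Subset> \<Omega>" for B
    using limit_sol_lower_bound[OF that] by blast
  fix \<phi> assume "\<phi> \<in> test_functions s p \<Omega>"
  then obtain A where A: "open A" "A \<Subset> \<Omega>" and \<phi>: "\<phi> \<in> \<W> A"
    by (auto simp: test_functions_def)
  note w = limit_sol_weak[OF A \<phi>]
  note [measurable] = frac_sobolev_zeroD(1)[OF \<phi>]
  have m: "(\<lambda>z. signed_power p (increment limit_sol z) * increment \<phi> z) \<in> borel_measurable lebesgue" by measurable
  show "integrable lebesgue (frac_form_integrand s p limit_sol \<phi>)"
    using w(1) unfolding frac_form_integrand_eq integrable_gagliardo_measure[OF m] .
  show "set_integrable lebesgue \<Omega> (\<lambda>x. K x / limit_sol x powr \<gamma> * \<phi> x)" by (rule w(2))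
  show "integral\<^sup>L lebesgue (frac_form_integrand s p limit_sol \<phi>) = (LINT x:\<Omega>|lebesgue. K x / limit_sol x powr \<gamma> * \<phi> x)"
    using w(3) unfolding frac_form_integrand_eq integral_gagliardo_measure[OF m] .
qed

text \<open>Nothing but local energy is known for \<open>v\<close>. The positive part of
  \<open>sol n - v\<close> is supported in \<open>core n\<close> and bounded by
  \<open>sol n\<close>, so it is admissible in both equations, and dropping the shift only increases
  the right-hand side of \<open>v\<close>.\<close>

lemma sol_le_weak_solution:
  assumes v: "weak_solution s p \<gamma> K \<Omega> v"
  shows "AE x in lebesgue. sol n x \<le> v x"
proof -
  have loc: "v \<in> frac_sobolev_loc s p \<Omega>" and v0: "\<And>x. x \<notin> \<Omega> \<Longrightarrow> v x = 0"
    and lower: "\<And>B. B \<Subset> \<Omega> \<Longrightarrow> \<exists>c>0. AE x in lebesgue. x \<in> B \<longrightarrow> c \<le> v x"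
    and weak: "\<And>\<phi>. \<phi> \<in> test_functions s p \<Omega> \<Longrightarrow> integrable lebesgue (frac_form_integrand s p v \<phi>) \<and>
        set_integrable lebesgue \<Omega> (\<lambda>x. K x / v x powr \<gamma> * \<phi> x) \<and>
        integral\<^sup>L lebesgue (frac_form_integrand s p v \<phi>) = (LINT x:\<Omega>|lebesgue. K x / v x powr \<gamma> * \<phi> x)"
    using v unfolding weak_solution_def by auto
  obtain \<kappa> where \<kappa>: "1 \<le> \<kappa>" "(\<lambda>x. v x powr \<kappa>) \<in> \<W> \<Omega>"
    using v unfolding weak_solution_def by auto
  have "AE x in lebesgue. x \<in> core k \<longrightarrow> 0 < v x" for k
  proof -
    obtain c where "0 < c" "AE x in lebesgue. x \<in> core k \<longrightarrow> c \<le> v x" using lower[OF core_compactly_contained] by blast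
    then show ?thesis by (auto elim!: eventually_mono)
  qed
  then have "AE x in lebesgue. \<forall>k. x \<in> core k \<longrightarrow> 0 < v x" unfolding AE_all_countable by blast
  then have vpos: "AE x in lebesgue. x \<in> \<Omega> \<longrightarrow> 0 < v x"
  proof eventually_elim
    case (elim x)
    show ?case
    proof
      assume "x \<in> \<Omega>"
      then obtain k where "x \<in> core k" using compact_subset_core[of "{x}"] by auto
      then show "0 < v x" using elim by blast
    qed
  qed
  \<comment> \<open>Local membership gives measurability on interior sets only. On the whole space
    it is recovered from the measurable power \<open>v powr \<kappa>\<close>, which can be inverted
    since \<open>v\<close> is nonnegative almost everywhere.\<close>
  have vm[measurable]: "v \<in> borel_measurable lebesgue"
  proof (rule borel_measurable_lebesgue_AE_eq)
    show "(\<lambda>x. (v x powr \<kappa>) powr (1 / \<kappa>)) \<in> borel_measurable lebesgue"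
      using frac_sobolev_zeroD(1)[OF \<kappa>(2)] by measurable
    show "AE x in lebesgue. (v x powr \<kappa>) powr (1 / \<kappa>) = v x"
      using vpos
    proof eventually_elim
      case (elim x)
      then show ?case using \<kappa>(1) v0[of x] by (cases "x \<in> \<Omega>") (auto simp: powr_powr)
    qed
  qed
  \<comment> \<open>The indicator changes the positive part on a null set only; with it \<phi>
    vanishes at every point off \<open>core n\<close>, as \<open>frac_sobolev_zero_localI\<close>
    requires.\<close>
  define \<phi> where "\<phi> = (\<lambda>x. indicator (core n) x * max (sol n x - v x) 0)"
  have \<phi>m[measurable]: "\<phi> \<in> borel_measurable lebesgue" unfolding \<phi>_def by measurable
  have off: "\<phi> x = 0" if "x \<notin> core n" for x using that by (simp add: \<phi>_def)
  have eq: "AE x in lebesgue. \<phi> x = max (sol n x - v x) 0"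
    using frac_sobolev_zeroD(4)[OF sol_mem[of n]] vpos
  proof eventually_elim
    case (elim x)
    have "0 \<le> v x" using elim(2) v0[of x] by (cases "x \<in> \<Omega>") auto
    then show ?case using elim(1) by (auto simp: \<phi>_def indicator_def)
  qed
  have \<phi>le: "AE x in lebesgue. \<bar>\<phi> x\<bar> \<le> \<bar>sol n x\<bar>"
    using eq vpos
  proof eventually_elim
    case (elim x)
    have "0 \<le> v x" using elim(2) v0[of x] by (cases "x \<in> \<Omega>") auto
    then show ?case using elim(1) sol_nonneg[of n x] by auto
  qed
  obtain m \<rho> where m: "closure (core n) \<subseteq> core m" and \<rho>: "0 < \<rho>" "\<And>x y. x \<in> core n \<Longrightarrow> y \<notin> core m \<Longrightarrow> \<rho> \<le> dist x y"
    using compactly_contained_separated[OF core_compactly_contained] by blast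
  have [measurable]: "core m \<times> core m \<in> sets lebesgue" by (rule Times_lebesgue_measurable) measurable
  have "gagliardo_energy s p (core m) v < \<infinity>"
    using loc open_core core_compactly_contained unfolding frac_sobolev_loc_def by blast
  then have iv: "integrable \<mu> (\<lambda>z. indicator (core m \<times> core m) z * \<bar>increment v z\<bar> powr p)"
    by (intro integrableI_nonneg) (auto simp: gagliardo_energy_eq)
  have \<phi>W: "\<phi> \<in> \<W> (core n)"
  proof (rule frac_sobolev_zero_localI[OF core_measurable core_measurable \<rho> \<phi>m])
    show "integrable lebesgue (\<lambda>x. \<bar>\<phi> x\<bar> powr p)"
      by (rule Bochner_Integration.integrable_bound[OF frac_sobolev_zeroD(2)[OF sol_mem]])
        (use \<phi>le p_pos in \<open>auto elim!: eventually_mono intro: powr_mono2 simp del: powr_abs_eq\<close>)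
    let ?R = "\<lambda>z. 2 powr p * (\<bar>increment (sol n) z\<bar> powr p + indicator (core m \<times> core m) z * \<bar>increment v z\<bar> powr p)"
    have R: "integrable \<mu> ?R"
      using frac_sobolev_zeroD(3)[OF sol_mem] iv by auto
    have "AE z in \<mu>. indicator (core m \<times> core m) z * \<bar>increment \<phi> z\<bar> powr p \<le> ?R z"
      using AE_increment_cong[OF eq, of s p]
    proof eventually_elim
      case (elim z)
      show ?case
      proof (cases "z \<in> core m \<times> core m")
        case True
        have "\<bar>increment \<phi> z\<bar> \<le> \<bar>increment (sol n) z + (- increment v z)\<bar>"
          unfolding elim unfolding increment_def by (auto simp: max_def)
        then have "\<bar>increment \<phi> z\<bar> powr p \<le> \<bar>increment (sol n) z + (- increment v z)\<bar> powr p"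
          using p_pos by (intro powr_mono2) auto
        also have "\<dots> \<le> 2 powr p * (\<bar>increment (sol n) z\<bar> powr p + \<bar>- increment v z\<bar> powr p)"
          by (rule abs_add_powr_le[OF p_pos])
        finally show ?thesis using True by (simp only: indicator_simps mult_1 abs_minus_cancel)
      next
        case False
        then have "indicator (core m \<times> core m) z = (0::real)" by simp
        then show ?thesis by (simp only: mult_zero_left add_0_right) simp
      qed
    qed
    then show "integrable \<mu> (\<lambda>z. indicator (core m \<times> core m) z * \<bar>increment \<phi> z\<bar> powr p)"
      by (intro Bochner_Integration.integrable_bound[OF R]) (auto elim!: eventually_mono intro: order_trans[OF _ abs_ge_self])
  qed (use off in auto)
  have "\<phi> \<in> test_functions s p \<Omega>"
    using \<phi>W open_core core_compactly_contained unfolding test_functions_def by blast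
  note wv = weak[OF this]
  have mv: "(\<lambda>z. signed_power p (increment v z) * increment \<phi> z) \<in> borel_measurable lebesgue" by measurable
  have i1: "integrable \<mu> (\<lambda>z. signed_power p (increment v z) * increment \<phi> z)"
    using wv unfolding frac_form_integrand_eq integrable_gagliardo_measure[OF mv] by blast
  let ?l = "\<lambda>x. source n x * (sol n x + 1 / real (Suc n)) powr (- \<gamma>) * \<phi> x"
  let ?r = "\<lambda>x. indicator \<Omega> x * (K x / v x powr \<gamma> * \<phi> x)"
  have i2: "form v \<phi> = (\<integral>x. ?r x \<partial>lebesgue)"
    using wv unfolding frac_form_integrand_eq integral_gagliardo_measure[OF mv] by (simp add: set_lebesgue_integral_def)
  have ir: "integrable lebesgue ?r" using wv by (simp add: set_integrable_def)
  have "(\<integral>x. ?l x \<partial>lebesgue) \<le> (\<integral>x. ?r x \<partial>lebesgue)"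
  proof (rule integral_mono_AE[OF sol_integrable[OF \<phi>W] ir])
    show "AE x in lebesgue. ?l x \<le> ?r x"
      using vpos
    proof eventually_elim
      case (elim x)
      show ?case
      proof (cases "x \<in> core n \<and> v x < sol n x")
        case True
        then have x: "x \<in> \<Omega>" using core_subset by blast
        then have "(sol n x + 1 / real (Suc n)) powr (- \<gamma>) \<le> v x powr (- \<gamma>)"
          using True elim \<gamma>_pos by (intro powr_mono2') (auto simp: add_increasing2)
        then have "K x * (sol n x + 1 / real (Suc n)) powr (- \<gamma>) * \<phi> x \<le> K x * v x powr (- \<gamma>) * \<phi> x"
          using K_pos[OF x] by (intro mult_right_mono mult_left_mono) (auto simp: \<phi>_def)
        then show ?thesis using True x by (simp add: source_def powr_minus_divide)
      next
        case False
        then have "\<phi> x = 0" by (auto simp: \<phi>_def)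
        then show ?thesis by simp
      qed
    qed
  qed
  then have "form (sol n) \<phi>
    \<le> form v \<phi>"
    using sol_eq[OF \<phi>W] i2 by simp
  then show ?thesis
    by (rule weak_comparison[OF frac_sobolev_zero_mono[OF \<phi>W core_subset] eq integrable_form[OF sol_mem \<phi>W] i1])
qed

lemma limit_sol_minimal: "minimal_weak_solution s p \<gamma> K \<Omega> limit_sol"
  unfolding minimal_weak_solution_def
proof (intro conjI allI impI limit_sol_weak_solution)
  fix v assume v: "weak_solution s p \<gamma> K \<Omega> v"
  have "AE x in lebesgue. \<forall>n. sol n x \<le> v x"
    unfolding AE_all_countable using sol_le_weak_solution[OF v] by blast
  then show "AE x in lebesgue. x \<in> \<Omega> \<longrightarrow> limit_sol x \<le> v x"
    using sol_tendsto by eventually_elim (auto intro: LIMSEQ_le_const2)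
qed

end

theorem theorem1p2:
  fixes \<Omega> :: "'a::euclidean_space set" and s p \<gamma> \<delta> :: real and K\<^sub>\<delta> :: "'a \<Rightarrow> real"
  assumes "bounded_lipschitz_domain \<Omega>"
    and "0 < s" "s < 1"
    and "1 < p"
    and "0 < \<gamma>"
    and "0 < \<delta>" "\<delta> < s * p"
    and "K\<^sub>\<delta> \<in> borel_measurable (lebesgue_on \<Omega>)"
    and "\<exists>C1>0. \<exists>C2>0. \<forall>x\<in>\<Omega>.
           C1 * infdist x (frontier \<Omega>) powr (- \<delta>) \<le> K\<^sub>\<delta> x \<and>
           K\<^sub>\<delta> x \<le> C2 * infdist x (frontier \<Omega>) powr (- \<delta>)"
  shows "(\<delta> - s * (1 - \<gamma>) \<le> 0 \<longrightarrow>
            (\<exists>u. minimal_weak_solution s p \<gamma> K\<^sub>\<delta> \<Omega> u \<and> u \<in> frac_sobolev_zero s p \<Omega>)) \<and>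
         (\<delta> - s * (1 - \<gamma>) > 0 \<longrightarrow>
            (\<exists>u \<theta>\<^sub>0. minimal_weak_solution s p \<gamma> K\<^sub>\<delta> \<Omega> u \<and>
               \<theta>\<^sub>0 > Max {1, (p + \<gamma> - 1) / p,
                         (s * p - 1) * (p - 1 + \<gamma>) / (p * (s * p - \<delta>))} \<and>
               (\<forall>\<theta>\<ge>\<theta>\<^sub>0. (\<lambda>x. u x powr \<theta>) \<in> frac_sobolev_zero s p \<Omega>)))"
proof -
  obtain C1 C2 where C: "0 < C1" "0 < C2" "\<And>x. x \<in> \<Omega> \<Longrightarrow> C1 * infdist x (frontier \<Omega>) powr (- \<delta>) \<le> K\<^sub>\<delta> x \<and>
           K\<^sub>\<delta> x \<le> C2 * infdist x (frontier \<Omega>) powr (- \<delta>)"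
    using assms(9) by blast
  interpret D: frac_domain s p \<Omega>
    by unfold_locales (use assms in auto)
  interpret frac_problem s p \<Omega> \<gamma> \<delta> C1 C2 K\<^sub>\<delta>
    by unfold_locales (use assms C in \<open>auto simp: D.d_def\<close>)
  show ?thesis
  proof (intro conjI impI)
    assume "\<delta> - s * (1 - \<gamma>) \<le> 0"
    \<comment> \<open>For \<theta> equal to \<open>1\<close> the condition reads
      \<open>\<delta> \<le> s * (1 - \<gamma>)\<close>, which is the case distinction of the
      theorem.\<close>
    then have "admissible 1" by (simp add: admissible_def algebra_simps)
    then have "(\<lambda>x. limit_sol x powr 1) \<in> frac_sobolev_zero s p \<Omega>" by (rule limit_sol_powr_mem)
    moreover have "AE x in lebesgue. limit_sol x powr 1 = limit_sol x"
      using limit_sol_nonneg by eventually_elim simp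
    ultimately have "limit_sol \<in> frac_sobolev_zero s p \<Omega>" by (rule D.frac_sobolev_zero_cong)
    then show "\<exists>u. minimal_weak_solution s p \<gamma> K\<^sub>\<delta> \<Omega> u \<and> u \<in> frac_sobolev_zero s p \<Omega>"
      using limit_sol_minimal by blast
  next
    let ?S = "{1, (p + \<gamma> - 1) / p, (s * p - 1) * (p - 1 + \<gamma>) / (p * (s * p - \<delta>))}"
    \<comment> \<open>The second argument of \<open>max\<close> is the threshold of
      \<open>admissibleI\<close>; the added \<open>1\<close> makes the inequality with
      \<open>Max\<close> strict.\<close>
    define \<theta>\<^sub>0 where "\<theta>\<^sub>0 = max (Max ?S) (s * (p - 1 + \<gamma>) / (s * p - \<delta>)) + 1"
    have 1: "1 \<le> Max ?S" by (rule Max_ge) auto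
    have gt: "Max ?S < \<theta>\<^sub>0" "s * (p - 1 + \<gamma>) / (s * p - \<delta>) \<le> \<theta>\<^sub>0" unfolding \<theta>\<^sub>0_def by linarith+
    have "(\<lambda>x. limit_sol x powr \<theta>) \<in> frac_sobolev_zero s p \<Omega>" if "\<theta>\<^sub>0 \<le> \<theta>" for \<theta>
      using that 1 gt by (intro limit_sol_powr_mem admissibleI) linarith+
    then show "\<exists>u \<theta>\<^sub>0. minimal_weak_solution s p \<gamma> K\<^sub>\<delta> \<Omega> u \<and> \<theta>\<^sub>0 > Max ?S \<and>
               (\<forall>\<theta>\<ge>\<theta>\<^sub>0. (\<lambda>x. u x powr \<theta>) \<in> frac_sobolev_zero s p \<Omega>)"
      using limit_sol_minimal gt(1) by blast
  qed
qed

end
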